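(* There exists a data structure answering Approximate Similarity Search queries under edit distance in $\tilde{O}(d\,3^r n^{1/c})$ time per query and $\tilde{O}(3^r n^{1+1/c} + dn)$ space.
   Context: The edit distance $\mathrm{ED}(x,y)$ between strings $x,y$ is the minimum number of single-character insertions, deletions and replacements needed to transform $x$ into $y$. Approximate Similarity Search under edit distance: given a set $S$ of $n$ strings and constants $c$ and $r$, preprocess $S$ so as to answer queries $q$ of the form: "if there exists $y\in S$ with $\mathrm{ED}(q,y)\le r$, return some $y'\in S$ with $\mathrm{ED}(q,y')\le cr$", correctly with probability $>1/10$. All query and database strings have length at most $d$, over an alphabet $\Sigma$; it is assumed that $d=O(n)$ and $|\Sigma|=O(n)$. The notation $\tilde{O}(\cdot)$ hides polylogarithmic factors. *)

theory Defs
  imports "HOL-Probability.Probability_Mass_Function"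
begin

section \<open>Edit distance\<close>

inductive edit_step :: "'a list \<Rightarrow> 'a list \<Rightarrow> bool" where
  ins: "edit_step (u @ v) (u @ [a] @ v)"
| del: "edit_step (u @ [a] @ v) (u @ v)"
| rep: "edit_step (u @ [a] @ v) (u @ [b] @ v)"

definition ED :: "'a list \<Rightarrow> 'a list \<Rightarrow> nat" where
  "ED x y = (LEAST k. (edit_step ^^ k) x y)"

text \<open>The alphabet of size \<open>\<sigma>\<close> is \<open>{0, ..., \<sigma> - 1}\<close>, so that a character fits into a machine word.\<close>

definition strings :: "nat \<Rightarrow> nat \<Rightarrow> nat list set" where
  "strings \<sigma> d = {x. set x \<subseteq> {..<\<sigma>} \<and> length x \<le> d}"


section \<open>The word RAM\<close>

text \<open>
  A randomized word RAM with \<open>w\<close>-bit words, programmed in a structured language.  A program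
  mentions finitely many registers; memory is addressed by words.  Every instruction and every
  test of a conditional or loop takes one time unit.  Random words come from a tape; instructions
  that read past its end, or that address a cell outside the first \<open>m\<close> cells, are
  stuck, so that \<open>m\<close> bounds the space used.
\<close>

datatype binop = Add | Sub | Mul | Div | Mod | And | Or | Xor | Shl | Shr | Less | Equal

datatype prog =
    Skip
  | Const nat nat
  | Op binop nat nat nat
  | Load nat nat
  | Store nat nat
  | Rand nat
  | Seq prog prog
  | Cond nat prog prog
  | While nat prog

record state =
  regs :: "nat \<Rightarrow> nat"
  mem :: "nat \<Rightarrow> nat"
  tape :: "nat list"

fun apply_op :: "nat \<Rightarrow> binop \<Rightarrow> nat \<Rightarrow> nat \<Rightarrow> nat" where
  "apply_op w Add a b = (a + b) mod 2 ^ w"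
| "apply_op w Sub a b = (a + 2 ^ w - b) mod 2 ^ w"
| "apply_op w Mul a b = (a * b) mod 2 ^ w"
| "apply_op w Div a b = (a div b) mod 2 ^ w"
| "apply_op w Mod a b = (a mod b) mod 2 ^ w"
| "apply_op w And a b = Bit_Operations.and a b mod 2 ^ w"
| "apply_op w Or a b = Bit_Operations.or a b mod 2 ^ w"
| "apply_op w Xor a b = Bit_Operations.xor a b mod 2 ^ w"
| "apply_op w Shl a b = push_bit b a mod 2 ^ w"
| "apply_op w Shr a b = drop_bit b a mod 2 ^ w"
| "apply_op w Less a b = of_bool (a < b) mod 2 ^ w"
| "apply_op w Equal a b = of_bool (a = b) mod 2 ^ w"

text \<open>\<open>exec w m P s t s'\<close>: started in \<open>s\<close>, program \<open>P\<close> halts in \<open>s'\<close> after exactly \<open>t\<close> time units.\<close>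

inductive exec :: "nat \<Rightarrow> nat \<Rightarrow> prog \<Rightarrow> state \<Rightarrow> nat \<Rightarrow> state \<Rightarrow> bool"
  for w m :: nat where
  Skip: "exec w m Skip s 1 s"
| Const: "exec w m (Const i v) s 1 (s\<lparr>regs := (regs s)(i := v mod 2 ^ w)\<rparr>)"
| Op: "exec w m (Op f i j k) s 1
         (s\<lparr>regs := (regs s)(i := apply_op w f (regs s j) (regs s k))\<rparr>)"
| Load: "regs s j < m \<Longrightarrow>
         exec w m (Load i j) s 1 (s\<lparr>regs := (regs s)(i := mem s (regs s j))\<rparr>)"
| Store: "regs s i < m \<Longrightarrow>
         exec w m (Store i j) s 1 (s\<lparr>mem := (mem s)(regs s i := regs s j)\<rparr>)"
| Rand: "tape s = v # vs \<Longrightarrow>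
         exec w m (Rand i) s 1 (s\<lparr>regs := (regs s)(i := v), tape := vs\<rparr>)"
| Seq: "exec w m P s t s' \<Longrightarrow> exec w m Q s' t' s'' \<Longrightarrow> exec w m (Seq P Q) s (t + t') s''"
| CondTrue: "regs s i \<noteq> 0 \<Longrightarrow> exec w m P s t s' \<Longrightarrow> exec w m (Cond i P Q) s (1 + t) s'"
| CondFalse: "regs s i = 0 \<Longrightarrow> exec w m Q s t s' \<Longrightarrow> exec w m (Cond i P Q) s (1 + t) s'"
| WhileFalse: "regs s i = 0 \<Longrightarrow> exec w m (While i P) s 1 s"
| WhileTrue: "regs s i \<noteq> 0 \<Longrightarrow> exec w m P s t s' \<Longrightarrow> exec w m (While i P) s' t' s'' \<Longrightarrow>
         exec w m (While i P) s (1 + t + t') s''"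

lemma exec_deterministic:
  "exec w m P s t s' \<Longrightarrow> exec w m P s u s'' \<Longrightarrow> u = t \<and> s'' = s'"
proof (induction arbitrary: u s'' rule: exec.induct)
  case (Seq P s t s' Q t' s3)
  from Seq.prems show ?case by cases (use Seq.IH in blast)
next
  case (CondTrue s i P t s' Q)
  from CondTrue.prems show ?case by cases (use CondTrue in blast)+
next
  case (CondFalse s i Q t s' P)
  from CondFalse.prems show ?case by cases (use CondFalse in blast)+
next
  case (WhileTrue s i P t s' t' s3)
  from WhileTrue.prems show ?case by cases (use WhileTrue in blast)+
qed (auto elim: exec.cases)

definition tapes :: "nat \<Rightarrow> nat \<Rightarrow> nat list set" where
  "tapes w l = {vs. set vs \<subseteq> {..<2 ^ w} \<and> length vs = l}"

text \<open>Words of \<open>\<Theta>(log n)\<close> bits, with factor \<open>b\<close>.\<close>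

definition word_size :: "nat \<Rightarrow> nat \<Rightarrow> nat" where
  "word_size b n = b * nat \<lceil>log 2 (real n + 1)\<rceil>"


section \<open>Approximate similarity search\<close>

text \<open>A string is stored at address \<open>p\<close> as its length followed by its characters.\<close>

definition store_string :: "nat \<Rightarrow> nat list \<Rightarrow> (nat \<Rightarrow> nat) \<Rightarrow> nat \<Rightarrow> nat" where
  "store_string p x M a =
     (if a = p then length x
      else if p < a \<and> a \<le> p + length x then x ! (a - p - 1)
      else M a)"

definition holds_string :: "(nat \<Rightarrow> nat) \<Rightarrow> nat \<Rightarrow> nat list \<Rightarrow> bool" where
  "holds_string M p x \<longleftrightarrow> M p = length x \<and> (\<forall>i<length x. M (p + 1 + i) = x ! i)"

text \<open>
  Input of the preprocessing program.  The cells \<open>0, ..., d\<close> are set aside for the query string,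
  and the \<open>j\<close>-th database string, counted from 1, is stored at address \<open>j * (d + 1)\<close>.
  The real number \<open>c\<close> enters only through the integer part of \<open>c * r\<close>, edit distances being
  integers; and since no two strings of length at most \<open>d\<close> are at distance greater than \<open>d\<close>,
  the two distance thresholds are cut off at \<open>d\<close>, so that they fit into a word.
\<close>

definition prep_input ::
  "nat \<Rightarrow> nat \<Rightarrow> real \<Rightarrow> nat \<Rightarrow> nat list list \<Rightarrow> nat list \<Rightarrow> state" where
  "prep_input \<sigma> d c r S vs = \<lparr>
     regs = (\<lambda>_. 0)(0 := length S, 1 := d, 2 := \<sigma>, 3 := min r d, 4 := min (nat \<lfloor>c * real r\<rfloor>) d),
     mem = (\<lambda>a. let j = a div (d + 1); i = a mod (d + 1) in
       if 1 \<le> j \<and> j \<le> length S then store_string 0 (S ! (j - 1)) (\<lambda>_. 0) i else 0),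
     tape = vs \<rparr>"

text \<open>
  \<open>serve w m T Q s qs s'\<close>: starting in \<open>s\<close>, the query program \<open>Q\<close> answers the queries \<open>qs\<close> one
  after the other, each in time at most \<open>T\<close> and within the first \<open>m\<close> memory cells, ending in \<open>s'\<close>.
  Each query string is put into memory at address 0 and the rest of the state is kept.
\<close>

inductive serve ::
  "nat \<Rightarrow> nat \<Rightarrow> real \<Rightarrow> prog \<Rightarrow> state \<Rightarrow> nat list list \<Rightarrow> state \<Rightarrow> bool"
  for w m :: nat and T :: real and Q :: prog where
  none: "serve w m T Q s [] s"
| query: "exec w m Q (s\<lparr>mem := store_string 0 q (mem s)\<rparr>) t s' \<Longrightarrow> real t \<le> T \<Longrightarrow>
    serve w m T Q s' qs s'' \<Longrightarrow> serve w m T Q s (q # qs) s''"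

text \<open>
  The answer to a query is the address, in register 0, of a copy of the string returned.  Nothing
  is asked of the answer if no database string is within distance \<open>r\<close> of the query.
\<close>

definition correct_answer ::
  "nat \<Rightarrow> real \<Rightarrow> nat \<Rightarrow> nat list set \<Rightarrow> nat list \<Rightarrow> state \<Rightarrow> bool" where
  "correct_answer m c r S q s \<longleftrightarrow>
     (\<exists>y\<in>S. ED q y \<le> r) \<longrightarrow>
     (\<exists>y'\<in>S. real (ED q y') \<le> c * real r \<and>
        holds_string (mem s) (regs s 0) y' \<and> regs s 0 + length y' < m)"

text \<open>The summand 1 keeps the factor positive for \<open>n = 1\<close>.\<close>

definition polylog :: "real \<Rightarrow> nat \<Rightarrow> nat \<Rightarrow> real" where
  "polylog C k n = C * (1 + ln (real n)) ^ k"

end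

theory Submission
  imports Defs
begin

text \<open>
  A string is fingerprinted by a random walk along it.  In each step a coin common to all strings
  shows \<open>\<bottom>\<close> with probability \<open>\<theta>\<close>.  If it does not, the random code of the current character is
  added to the fingerprint and the walk advances; if it does, nothing is emitted and the parity of
  the code decides whether the walk advances.  Two walks advance together on equal characters.  On
  different characters they survive only a \<open>\<bottom>\<close>, and then advance by a deletion, an insertion, a
  replacement or not at all, each with probability \<open>1/4\<close>.  With \<open>p = \<theta> / (4 - \<theta>)\<close>, the walks follow
  a given sequence of edits with probability \<open>p ^ ED x y\<close>, and they meet with probability at most
  \<open>(3 * p) ^ ED x y\<close>, apart from accidental agreement of the codes.  Choosing \<open>\<theta>\<close> such that
  \<open>(3 * p) ^ (K + 1)\<close> is about \<open>1 / n\<close>, where \<open>K\<close> is the larger threshold, about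
  \<open>p powr (- r) \<le> 3 ^ r * n powr (1 / c)\<close> hash tables suffice.  Candidates from the tables are
  verified by dynamic programming on a diagonal band of width \<open>2 * K + 1\<close>, and a query gives up
  after a fixed number of false candidates, which Markov's inequality makes unlikely.
\<close>

text \<open>Both rates are fixed points. On different characters a \<open>\<bottom>\<close> is
  followed by a prescribed edit or by standing still with probability 1/4 each, so
  \<open>p = \<theta> / 4 * (1 + p)\<close>. Each of the three moves lowers the distance by at most
  1, so the upper rate solves \<open>s = \<theta> / 4 * (3 + s)\<close>, whence
  \<open>s = 3 * p\<close>. This ratio is the source of \<open>3 ^ r\<close>. One random word per
  step and character would take too much space. A step uses only about log n words, combined
  linearly over GF(2); pairwise independence is enough, since a collision concerns two strings. As d
  = O(n), a seed then takes near-linear space. Verification costs about d * K, so K must not grow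
  with c. Cutting it off at about r * log n costs a factor 2 only, because n powr (1 / log n) is
  bounded. When fewer than n tables suffice, 3 ^ r < n, so r itself is logarithmic; otherwise a
  linear scan is affordable. The machine has no reals: \<theta> is a multiple of 1 / M, found by
  search in fixed-point integers, and the analysis has to show that all roundings together change
  the number of tables by a constant factor.\<close>

unbundle bit_operations_syntax

section \<open>Edit distance and alignments\<close>

text \<open>Edit steps may occur anywhere and in any order; an alignment reads both strings once
  from the left, which opens the distance to structural recursion. \<open>align_rep\<close> may
  replace a character by itself, which is harmless because only least costs matter.\<close>

inductive align :: "nat \<Rightarrow> 'a list \<Rightarrow> 'a list \<Rightarrow> bool" where
  align_Nil: "align 0 [] []"
| align_match: "align k x y \<Longrightarrow> align k (a # x) (a # y)"
| align_del: "align k x y \<Longrightarrow> align (Suc k) (a # x) y"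
| align_ins: "align k x y \<Longrightarrow> align (Suc k) x (b # y)"
| align_rep: "align k x y \<Longrightarrow> align (Suc k) (a # x) (b # y)"

lemma edit_step_Cons: "edit_step x y \<Longrightarrow> edit_step (a # x) (a # y)"
proof (induction rule: edit_step.induct)
  case (ins u v c) show ?case using edit_step.ins[of "a # u" v c] by simp
next
  case (del u c v) show ?case using edit_step.del[of "a # u" c v] by simp
next
  case (rep u c v c') show ?case using edit_step.rep[of "a # u" c v c'] by simp
qed

lemma edit_step_Nil_cases:
  assumes "edit_step [] z" obtains a where "z = [a]"
  using assms by cases auto

lemma edit_step_Cons_cases:
  assumes "edit_step (b # y) z"
  obtains (ins) c where "z = c # b # y" | (del) "z = y" | (rep) c where "z = c # y"
    | (tail) z' where "z = b # z'" "edit_step y z'"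
  using assms
proof cases
  case (ins u v a)
  then show thesis
  proof (cases u)
    case Nil then show thesis using ins that(1) by auto
  next
    case (Cons c u') then show thesis using ins that(4) edit_step.ins[of u' v a] by auto
  qed
next
  case (del u a v)
  then show thesis
  proof (cases u)
    case Nil then show thesis using del that(2) by auto
  next
    case (Cons c u') then show thesis using del that(4) edit_step.del[of u' a v] by auto
  qed
next
  case (rep u a v c)
  then show thesis
  proof (cases u)
    case Nil then show thesis using rep that(3) by auto
  next
    case (Cons c' u') then show thesis using rep that(4) edit_step.rep[of u' a v c] by auto
  qed
qed

text \<open>A later edit is absorbed into the alignment. The cost is only bounded by
  \<open>Suc k\<close>, since the edit may undo part of the alignment, as when it deletes an
  inserted character.\<close>

lemma align_step:
  "align k x y \<Longrightarrow> edit_step y z \<Longrightarrow> \<exists>k'\<le>Suc k. align k' x z"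
proof (induction arbitrary: z rule: align.induct)
  case align_Nil
  then show ?case by (elim edit_step_Nil_cases) (metis align.intros(1,4) le_refl)
next
  case (align_match k x y a)
  note h = align_match.hyps
  from align_match.prems show ?case
  proof (cases rule: edit_step_Cons_cases)
    case (tail z') then show ?thesis using align_match.IH align.align_match by metis
  next
    case (ins c)
    show ?thesis unfolding ins by (intro exI[of _ "Suc k"] conjI le_refl align_ins align.align_match h)
  next
    case del
    show ?thesis unfolding del by (intro exI[of _ "Suc k"] conjI le_refl align_del h)
  next
    case (rep c)
    show ?thesis unfolding rep by (intro exI[of _ "Suc k"] conjI le_refl align_rep h)
  qed
next
  case (align_del k x y a)
  then obtain k' where "k' \<le> Suc k" "align k' x z" by blast
  then show ?case using align.align_del[of k' x z a] by (intro exI[of _ "Suc k'"]) simp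
next
  case (align_ins k x y b)
  from align_ins.prems show ?case
  proof (cases rule: edit_step_Cons_cases)
    case (tail z')
    then obtain k' where "k' \<le> Suc k" "align k' x z'" using align_ins.IH by blast
    then show ?thesis unfolding tail using align.align_ins[of k' x z' b] by (intro exI[of _ "Suc k'"]) simp
  next
    case del then show ?thesis using align_ins.hyps by (intro exI[of _ k]) simp
  next
    case (rep c)
    show ?thesis unfolding rep by (intro exI[of _ "Suc k"] conjI le_SucI le_refl align.align_ins align_ins.hyps)
  next
    case (ins c)
    show ?thesis unfolding ins
      by (intro exI[of _ "Suc (Suc k)"] conjI le_refl align.align_ins align_ins.hyps)
  qed
next
  case (align_rep k x y a b)
  from align_rep.prems show ?case
  proof (cases rule: edit_step_Cons_cases)
    case (tail z')
    then obtain k' where "k' \<le> Suc k" "align k' x z'" using align_rep.IH by blast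
    then show ?thesis unfolding tail using align.align_rep[of k' x z' a b] by (intro exI[of _ "Suc k'"]) simp
  next
    case del
    show ?thesis unfolding del by (intro exI[of _ "Suc k"] conjI le_SucI le_refl align.align_del align_rep.hyps)
  next
    case (rep c)
    show ?thesis unfolding rep by (intro exI[of _ "Suc k"] conjI le_SucI le_refl align.align_rep align_rep.hyps)
  next
    case (ins c)
    show ?thesis unfolding ins
      by (intro exI[of _ "Suc (Suc k)"] conjI le_refl align.align_ins align.align_rep align_rep.hyps)
  qed
qed

lemma align_refl: "align 0 x x"
  by (induction x) (auto intro: align.intros)

lemma align_sym: "align k x y \<Longrightarrow> align k y x"
  by (induction rule: align.induct) (auto intro: align.intros)

lemma relpowp_align: "(edit_step ^^ k) x y \<Longrightarrow> \<exists>k'\<le>k. align k' x y"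
proof (induction k arbitrary: y)
  case 0 then show ?case by (auto intro: align_refl)
next
  case (Suc k)
  then obtain z where "(edit_step ^^ k) x z" "edit_step z y" by auto
  with Suc.IH align_step show ?case by (metis Suc_le_mono le_trans)
qed

lemma relpowp_edit_step_Cons: "(edit_step ^^ k) x y \<Longrightarrow> (edit_step ^^ k) (a # x) (a # y)"
proof (induction k arbitrary: y)
  case (Suc k)
  then obtain z where "(edit_step ^^ k) x z" "edit_step z y" by auto
  then show ?case using Suc.IH edit_step_Cons by (metis relpowp_Suc_I)
qed simp

lemma align_relpowp: "align k x y \<Longrightarrow> (edit_step ^^ k) x y"
proof (induction rule: align.induct)
  case (align_match k x y a) show ?case by (rule relpowp_edit_step_Cons[OF align_match.IH])
next
  case (align_del k x y a)
  then show ?case using edit_step.del[of "[]" a x] relpowp_Suc_I2[of edit_step "a # x" x k y] by simp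
next
  case (align_ins k x y b)
  then show ?case using edit_step.ins[of "[]" y b] relpowp_Suc_I[of k edit_step x y "b # y"] by simp
next
  case (align_rep k x y a b)
  then show ?case using edit_step.rep[of "[]" a y b] relpowp_edit_step_Cons[of k x y a]
      relpowp_Suc_I[of k edit_step "a # x" "a # y" "b # y"] by simp
qed simp

lemma align_exists: "\<exists>k. align k x y"
proof (induction x)
  case Nil
  show ?case by (induction y) (auto intro: align.intros)
qed (auto intro: align.intros)

text \<open>A shortest edit sequence becomes an alignment of at most its length; turned back into
  edits, it cannot be shorter, by minimality.\<close>

lemma align_ED: "align (ED x y) x y"
proof -
  have ex: "\<exists>k. (edit_step ^^ k) x y" using align_exists align_relpowp by blast
  have "(edit_step ^^ ED x y) x y" unfolding ED_def by (rule LeastI_ex[OF ex])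
  then obtain k' where k': "k' \<le> ED x y" "align k' x y" using relpowp_align by blast
  then have "ED x y \<le> k'" unfolding ED_def by (intro Least_le align_relpowp)
  with k' show ?thesis by (metis le_antisym)
qed

lemma ED_le: "align k x y \<Longrightarrow> ED x y \<le> k"
  unfolding ED_def by (intro Least_le align_relpowp)

lemma ED_sym: "ED x y = ED y x"
  by (meson align_ED align_sym ED_le le_antisym)

lemma ED_edit_step: "edit_step y z \<Longrightarrow> ED x z \<le> Suc (ED x y)"
  using align_step[OF align_ED] ED_le le_trans by blast

lemma ED_refl [simp]: "ED x x = 0"
  using ED_le[OF align_refl] by auto

lemma align_length: "align k x y \<Longrightarrow> length x \<le> length y + k \<and> length y \<le> length x + k"
  by (induction rule: align.induct) auto

lemma ED_length: "length x \<le> length y + ED x y" "length y \<le> length x + ED x y"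
  using align_length[OF align_ED] by auto

lemma ED_le_max: "ED x y \<le> max (length x) (length y)"
proof (induction x arbitrary: y)
  case Nil
  have "align (length y) [] y" by (induction y) (auto intro: align.intros)
  from ED_le[OF this] show ?case by simp
next
  case (Cons a x)
  show ?case
  proof (cases y)
    case Nil
    have "align (length z) z []" for z :: "'a list" by (induction z) (auto intro: align.intros)
    from ED_le[OF this[of "a # x"]] show ?thesis using Nil by simp
  next
    case (Cons b z)
    then show ?thesis using Cons.IH[of z] ED_le[OF align_rep[OF align_ED[of x z]], of a b] by simp
  qed
qed

lemma ED_Nil [simp]: "ED [] y = length y" "ED x [] = length x"
  using ED_le_max[of "[]" y] ED_length(2)[of y "[]"] ED_le_max[of x "[]"] ED_length(1)[of x "[]"]
  by (simp_all add: ED_sym)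

section \<open>Recursion of the edit distance on the first characters\<close>

lemma ED_Cons_le:
  "ED x (b # y) \<le> Suc (ED x y)" "ED (a # x) y \<le> Suc (ED x y)"
  "ED (a # x) (b # y) \<le> Suc (ED x y)"
  by (rule ED_le[OF align_ins[OF align_ED]], rule ED_le[OF align_del[OF align_ED]],
      rule ED_le[OF align_rep[OF align_ED]])

text \<open>An optimal alignment that does not match the heads pays one unit for a head; that unit
  also pays for deleting the head left over on the other side.\<close>

lemma ED_Cons_Cons_same [simp]: "ED (a # x) (a # y) = ED x y"
proof (rule antisym)
  show "ED (a # x) (a # y) \<le> ED x y" by (intro ED_le align_match align_ED)
  have tl: "ED u v \<le> Suc (ED u (a # v))" for u v
    using ED_edit_step[OF edit_step.del[of "[]" a v]] by simp
  show "ED x y \<le> ED (a # x) (a # y)"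
    using align_ED[of "a # x" "a # y"]
  proof cases
    case align_match then show ?thesis using ED_le by auto
  next
    case (align_del k) then show ?thesis using ED_le[of k x "a # y"] tl[of x y] by simp
  next
    case (align_ins k) then show ?thesis using ED_le[of k "a # x" y] tl[of y x] by (simp add: ED_sym)
  next
    case (align_rep k) then show ?thesis using ED_le[of k x y] by simp
  qed
qed

text \<open>With different heads every alignment begins with a paid operation. The three
  alternatives are the three moves of the walks after a \<open>\<bottom>\<close>.\<close>

lemma ED_Cons_Cons_diff:
  assumes "a \<noteq> b"
  shows "ED (a # x) (b # y) = Suc (min (ED x y) (min (ED x (b # y)) (ED (a # x) y)))"
proof (rule antisym)
  show "ED (a # x) (b # y) \<le> Suc (min (ED x y) (min (ED x (b # y)) (ED (a # x) y)))"
    using ED_Cons_le(1)[of "a # x" b y] ED_Cons_le(2)[of a x "b # y"] ED_Cons_le(3)[of a x b y] by simp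
  show "Suc (min (ED x y) (min (ED x (b # y)) (ED (a # x) y))) \<le> ED (a # x) (b # y)"
    using align_ED[of "a # x" "b # y"]
  proof cases
    case (align_del k) then show ?thesis using ED_le[of k x "b # y"] by simp
  next
    case (align_ins k) then show ?thesis using ED_le[of k "a # x" y] by simp
  next
    case (align_rep k) then show ?thesis using ED_le[of k x y] by simp
  qed (use assms in simp)
qed

lemma ED_Cons_Cons:
  "ED (a # x) (b # y) =
     min (ED x y + of_bool (a \<noteq> b)) (min (ED x (b # y) + 1) (ED (a # x) y + 1))"
proof (cases "a = b")
  case True
  have "ED x y \<le> Suc (ED x (b # y))"
    using ED_edit_step[OF edit_step.del[of "[]" b y]] by simp
  moreover have "ED x y \<le> Suc (ED (a # x) y)"
    using ED_edit_step[OF edit_step.del[of "[]" a x], of y] by (simp add: ED_sym)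
  ultimately show ?thesis using True by simp
qed (simp add: ED_Cons_Cons_diff)

text \<open>Stated with \<open>tl\<close> so that the bounds also cover a walk that has run off the
  end of a string, where \<open>tl\<close> does nothing.\<close>

lemma ED_tl_le:
  "ED x y \<le> Suc (ED (tl x) y)" "ED x y \<le> Suc (ED x (tl y))" "ED x y \<le> Suc (ED (tl x) (tl y))"
proof -
  show "ED x y \<le> Suc (ED (tl x) y)" by (cases x) (simp_all add: ED_Cons_le)
  show "ED x y \<le> Suc (ED x (tl y))" by (cases y) (simp_all add: ED_Cons_le)
  show "ED x y \<le> Suc (ED (tl x) (tl y))"
    by (cases x; cases y) (simp_all add: ED_Cons_le(3))
qed

section \<open>Reversal, and the recursion on the last characters\<close>

lemma edit_step_rev: "edit_step x y \<Longrightarrow> edit_step (rev x) (rev y)"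
proof (induction rule: edit_step.induct)
  case (ins u v c) show ?case using edit_step.ins[of "rev v" "rev u" c] by simp
next
  case (del u c v) show ?case using edit_step.del[of "rev v" c "rev u"] by simp
next
  case (rep u c v c') show ?case using edit_step.rep[of "rev v" c "rev u" c'] by simp
qed

lemma ED_rev: "ED (rev x) (rev y) = ED x y"
proof -
  have step: "(edit_step ^^ k) (rev x) (rev y)" if "(edit_step ^^ k) x y" for k and x y :: "'b list"
    using that
  proof (induction k arbitrary: y)
    case (Suc k)
    then obtain z where "(edit_step ^^ k) x z" "edit_step z y" by auto
    then show ?case using Suc.IH edit_step_rev by (metis relpowp_Suc_I)
  qed simp
  have le: "ED (rev u) (rev v) \<le> ED u v" for u v :: "'b list"
    using step[OF align_relpowp[OF align_ED[of u v]]] unfolding ED_def by (rule Least_le)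
  show ?thesis using le[of x y] le[of "rev x" "rev y"] by simp
qed

text \<open>Fingerprints consume strings from the front, whereas dynamic programming extends
  prefixes at the back; reversal transfers the recursion from one to the other.\<close>

lemma ED_snoc_snoc:
  "ED (x @ [a]) (y @ [b]) =
     min (ED x y + of_bool (a \<noteq> b)) (min (ED x (y @ [b]) + 1) (ED (x @ [a]) y + 1))"
  using ED_Cons_Cons[of a "rev x" b "rev y"] ED_rev[of "x @ [a]" "y @ [b]"] ED_rev[of x y]
    ED_rev[of x "y @ [b]"] ED_rev[of "x @ [a]" y] by simp

section \<open>Random tapes\<close>

lemma xor_less_2pow: "a < 2 ^ w \<Longrightarrow> b < 2 ^ w \<Longrightarrow> a XOR b < 2 ^ w" for a b :: nat
  by (metis take_bit_nat_eq_self_iff take_bit_xor)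

text \<open>Expectations are finite averages, so that drawing the first word of a tape is the
  rewrite rule \<open>expect_Suc\<close>; \<open>prob_tapes\<close> is the bridge to
  \<open>measure_pmf\<close>.\<close>

definition avg :: "nat \<Rightarrow> (nat \<Rightarrow> real) \<Rightarrow> real" where
  "avg w g = (\<Sum>v<2 ^ w. g v) / 2 ^ w"

definition expect :: "nat \<Rightarrow> nat \<Rightarrow> (nat list \<Rightarrow> real) \<Rightarrow> real" where
  "expect w l f = (\<Sum>vs\<in>tapes w l. f vs) / (2 ^ w) ^ l"

lemma tapes_0 [simp]: "tapes w 0 = {[]}"
  by (auto simp: tapes_def)

lemma tapes_Suc: "tapes w (Suc l) = (\<lambda>(v, vs). v # vs) ` ({..<2 ^ w} \<times> tapes w l)"
  by (auto simp: tapes_def length_Suc_conv image_iff)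

lemma finite_tapes [simp]: "finite (tapes w l)"
  by (induction l) (simp_all add: tapes_Suc)

lemma card_tapes: "card (tapes w l) = (2 ^ w) ^ l"
  by (induction l) (simp_all add: tapes_Suc card_image inj_on_def card_cartesian_product)

lemma expect_0 [simp]: "expect w 0 f = f []"
  by (simp add: expect_def)

lemma expect_Suc: "expect w (Suc l) f = avg w (\<lambda>v. expect w l (\<lambda>vs. f (v # vs)))"
proof -
  have "(\<Sum>vs\<in>tapes w (Suc l). f vs) = (\<Sum>(v, vs)\<in>{..<2 ^ w} \<times> tapes w l. f (v # vs))"
    unfolding tapes_Suc by (subst sum.reindex) (auto simp: inj_on_def case_prod_unfold)
  then show ?thesis
    by (simp add: expect_def avg_def sum.cartesian_product[symmetric] sum_divide_distrib[symmetric] mult.commute)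
qed

lemma avg_const [simp]: "avg w (\<lambda>v. c) = c"
  by (simp add: avg_def)

lemma avg_cong: "(\<And>v. v < 2 ^ w \<Longrightarrow> f v = g v) \<Longrightarrow> avg w f = avg w g"
  by (simp add: avg_def)

text \<open>XOR with a fixed word is an involution on the words.\<close>

lemma avg_xor:
  assumes "a < 2 ^ w"
  shows "avg w (\<lambda>v. f (v XOR a)) = avg w f"
proof -
  have "(\<Sum>v<2 ^ w. f (v XOR a)) = (\<Sum>v<2 ^ w. f v)"
    by (rule sum.reindex_bij_witness[of _ "\<lambda>v. v XOR a" "\<lambda>v. v XOR a"])
      (use assms in \<open>auto simp: xor_less_2pow xor.assoc\<close>)
  then show ?thesis by (simp add: avg_def)
qed

lemma avg_less:
  assumes "t \<le> 2 ^ w"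
  shows "avg w (\<lambda>v. if v < t then a else b) = t / 2 ^ w * a + (1 - t / 2 ^ w) * b"
proof -
  have "{..<2 ^ w} \<inter> {v. v < t} = {..<t}" "{..<2 ^ w} \<inter> - {v. v < t} = {t..<2 ^ w}"
    using assms by auto
  then have "(\<Sum>v<2 ^ w. if v < t then a else b) = real t * a + (2 ^ w - real t) * b"
    using assms by (subst sum.If_cases) (simp_all add: of_nat_diff)
  then show ?thesis by (simp add: avg_def field_simps)
qed

lemma avg_odd:
  assumes "0 < w"
  shows "avg w (\<lambda>v. f (odd v)) = (f True + f False) / 2"
proof -
  have "(\<Sum>v<2 * m. f (odd v)) = m * (f True + f False)" for m :: nat
    by (induction m) (simp_all add: algebra_simps)
  from this[of "2 ^ (w - 1)"] have "(\<Sum>v<(2::nat) ^ w. f (odd v)) = 2 ^ (w - 1) * (f True + f False)"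
    using assms by (simp flip: power_Suc)
  moreover have "(2::real) ^ w = 2 * 2 ^ (w - 1)" using assms by (simp flip: power_Suc)
  ultimately show ?thesis by (simp add: avg_def)
qed

lemma avg_take_bit:
  assumes "l \<le> w" "a < 2 ^ w"
  shows "avg w (\<lambda>v. of_bool (take_bit l (v XOR a) = 0)) = 1 / 2 ^ l"
proof -
  \<comment> \<open>Exactly one of any \<open>2 ^ l\<close> consecutive numbers starting at a
    multiple of \<open>2 ^ l\<close> has its low \<open>l\<close> bits zero.\<close>
  have "(\<Sum>v<m * 2 ^ l. of_bool (v mod 2 ^ l = 0) :: real) = m" for m :: nat
  proof (induction m)
    case (Suc m)
    have "(\<Sum>v = m * 2 ^ l..<m * 2 ^ l + 2 ^ l. of_bool (v mod 2 ^ l = 0) :: real) =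
        (\<Sum>v<(2::nat) ^ l. of_bool (v = 0))"
      using sum.shift_bounds_nat_ivl[of "\<lambda>v. of_bool (v mod 2 ^ l = 0) :: real" 0 "m * 2 ^ l" "2 ^ l"]
      by (simp add: add.commute lessThan_atLeast0)
    also have "\<dots> = 1" by (simp add: of_bool_def sum.delta)
    finally have "(\<Sum>v = m * 2 ^ l..<m * 2 ^ l + 2 ^ l. of_bool (v mod 2 ^ l = 0) :: real) = 1" .
    moreover have "(\<Sum>v<Suc m * 2 ^ l. of_bool (v mod 2 ^ l = 0) :: real) =
        (\<Sum>v<m * 2 ^ l. of_bool (v mod 2 ^ l = 0)) +
        (\<Sum>v = m * 2 ^ l..<m * 2 ^ l + 2 ^ l. of_bool (v mod 2 ^ l = 0))"
      using sum.atLeastLessThan_concat[of 0 "m * 2 ^ l" "m * 2 ^ l + 2 ^ l" "\<lambda>v. of_bool (v mod 2 ^ l = 0) :: real"]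
      by (simp add: lessThan_atLeast0 add.commute)
    ultimately show ?case using Suc by simp
  qed simp
  from this[of "2 ^ (w - l)"] have "(\<Sum>v<(2::nat) ^ w. of_bool (take_bit l v = 0) :: real) = 2 ^ (w - l)"
    using assms by (simp add: take_bit_eq_mod flip: power_add)
  moreover have "(2::real) ^ w = 2 ^ (w - l) * 2 ^ l" using assms by (simp flip: power_add)
  ultimately have "avg w (\<lambda>v. of_bool (take_bit l v = 0)) = 1 / 2 ^ l" by (simp add: avg_def)
  then show ?thesis using avg_xor[OF assms(2), of "\<lambda>v. of_bool (take_bit l v = 0)"] by simp
qed

lemma expect_const [simp]: "expect w l (\<lambda>vs. c) = c"
  by (simp add: expect_def card_tapes)

lemma expect_add: "expect w l (\<lambda>vs. f vs + g vs) = expect w l f + expect w l g"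
  by (simp add: expect_def sum.distrib add_divide_distrib)

lemma expect_mult: "expect w l (\<lambda>vs. c * f vs) = c * expect w l f"
  by (simp add: expect_def sum_distrib_left[symmetric])

lemma expect_mult_right: "expect w l (\<lambda>vs. f vs * c) = expect w l f * c"
  using expect_mult[of w l c f] by (simp add: mult.commute)

lemma expect_sum: "expect w l (\<lambda>vs. \<Sum>i\<in>I. f i vs) = (\<Sum>i\<in>I. expect w l (f i))"
  by (simp add: expect_def sum.swap[of _ I] sum_divide_distrib)

lemma expect_mono: "(\<And>vs. vs \<in> tapes w l \<Longrightarrow> f vs \<le> g vs) \<Longrightarrow> expect w l f \<le> expect w l g"
  by (auto simp: expect_def intro!: divide_right_mono sum_mono)

lemma expect_cong: "(\<And>vs. vs \<in> tapes w l \<Longrightarrow> f vs = g vs) \<Longrightarrow> expect w l f = expect w l g"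
  by (simp add: expect_def)

lemma avg_expect_swap: "avg w (\<lambda>v. expect w l (f v)) = expect w l (\<lambda>vs. avg w (\<lambda>v. f v vs))"
  by (simp add: avg_def expect_def sum_divide_distrib[symmetric] sum.swap[of _ "tapes w l"] mult.commute)

lemma expect_append:
  "expect w (a + b) f = expect w a (\<lambda>xs. expect w b (\<lambda>ys. f (xs @ ys)))"
  by (induction a arbitrary: f) (simp_all add: expect_Suc)

lemma prob_tapes:
  "measure_pmf.prob (pmf_of_set (tapes w l)) {vs. P vs} = expect w l (\<lambda>vs. of_bool (P vs))"
proof -
  have "tapes w l \<noteq> {}" using card_tapes[of w l] by (metis card.empty power_eq_0_iff zero_neq_numeral)
  moreover have "(\<Sum>vs\<in>tapes w l. of_bool (P vs) :: real) = card (tapes w l \<inter> {vs. P vs})"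
    by (simp add: sum.If_cases of_bool_def)
  ultimately show ?thesis by (simp add: measure_pmf_of_set expect_def card_tapes)
qed

section \<open>Locality-sensitive fingerprints\<close>

text \<open>The end of the string acts as an extra character with code 1. All codes are odd: none is
  zero, and two different ones are linearly independent over GF(2), which makes their random words
  independent.\<close>

definition code :: "nat list \<Rightarrow> nat" where
  "code x = (case x of [] \<Rightarrow> 1 | a # _ \<Rightarrow> 2 * a + 3)"

text \<open>A random linear map over GF(2), given by the images \<open>vs\<close> of the
  \<open>B\<close> unit vectors and applied to the bits of \<open>c\<close>. It stands in for a
  table with one random word per character.\<close>

fun xor_words :: "nat \<Rightarrow> nat \<Rightarrow> nat list \<Rightarrow> nat" where
  "xor_words 0 c vs = 0"
| "xor_words (Suc B) c vs = (if odd c then hd vs else 0) XOR xor_words B (c div 2) (tl vs)"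

text \<open>Every step takes one coin and \<open>B\<close> hash words off the tape, whether or not
  the walk advances, so that the walks on all strings share their randomness step by step. Past the
  end, \<open>tl\<close> keeps the string empty and the hash of code 1 is emitted.\<close>

fun fprint :: "nat \<Rightarrow> nat \<Rightarrow> nat \<Rightarrow> nat list \<Rightarrow> nat list \<Rightarrow> nat" where
  "fprint B th 0 x vs = 0"
| "fprint B th (Suc t) x vs =
     (let X = xor_words B (code x) (tl vs); vs' = drop (Suc B) vs in
      if hd vs < th then fprint B th t (if odd X then tl x else x) vs'
      else X XOR fprint B th t (tl x) vs')"

lemma Cons_tapes [simp]: "v # vs \<in> tapes w (Suc l) \<longleftrightarrow> v < 2 ^ w \<and> vs \<in> tapes w l"
  by (auto simp: tapes_def)

lemma take_tapes: "vs \<in> tapes w (a + b) \<Longrightarrow> take a vs \<in> tapes w a"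
  by (auto simp: tapes_def dest: in_set_takeD)

lemma drop_tapes: "vs \<in> tapes w (a + b) \<Longrightarrow> drop a vs \<in> tapes w b"
  by (auto simp: tapes_def dest: in_set_dropD)

lemma xor_words_0 [simp]: "xor_words B 0 vs = 0"
  by (induction B arbitrary: vs) auto

lemma xor_words_less: "vs \<in> tapes w B \<Longrightarrow> xor_words B c vs < 2 ^ w"
proof (induction B arbitrary: c vs)
  case (Suc B)
  then obtain v vs' where "vs = v # vs'" by (cases vs) (auto simp: tapes_def)
  then show ?case using Suc by (auto intro: xor_less_2pow)
qed simp

lemma xor_words_append: "length V = B \<Longrightarrow> xor_words B c (V @ r) = xor_words B c V"
proof (induction B arbitrary: c V)
  case (Suc B)
  then show ?case by (cases V) auto
qed simp

lemma fprint_less: "vs \<in> tapes w (t * Suc B) \<Longrightarrow> fprint B th t x vs < 2 ^ w"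
proof (induction t arbitrary: x vs)
  case (Suc t)
  have "vs \<in> tapes w (Suc (B + t * Suc B))" using Suc.prems by (simp add: ac_simps)
  then obtain u V where vs: "vs = u # V" "V \<in> tapes w (B + t * Suc B)"
    by (cases vs) (auto simp: tapes_def)
  have "xor_words B c (take B V @ drop B V) < 2 ^ w" for c
    using take_tapes[OF vs(2)] by (subst xor_words_append) (auto simp: tapes_def xor_words_less)
  moreover have "drop B V \<in> tapes w (t * Suc B)" using vs(2) by (rule drop_tapes)
  ultimately show ?case using Suc.IH by (simp add: Let_def vs(1) xor_less_2pow)
qed simp

text \<open>Flipping the first word at which the two codes differ permutes the outcomes.\<close>

lemma expect_xor_words_diff:
  assumes "c \<noteq> c'" "c < 2 ^ B" "c' < 2 ^ B"
  shows "expect w B (\<lambda>vs. f (xor_words B c vs XOR xor_words B c' vs)) = avg w f"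
  using assms
proof (induction B arbitrary: c c')
  case (Suc B)
  let ?Z = "\<lambda>vs. xor_words B (c div 2) vs XOR xor_words B (c' div 2) vs"
  show ?case
  proof (cases "odd c = odd c'")
    case True
    then have "c div 2 \<noteq> c' div 2" using Suc.prems(1)
      by (metis dvd_mult_div_cancel odd_two_times_div_two_succ)
    moreover have "c div 2 < 2 ^ B" "c' div 2 < 2 ^ B" using Suc.prems by auto
    ultimately have "expect w B (\<lambda>vs. f (?Z vs)) = avg w f" by (rule Suc.IH)
    moreover have "(v XOR a) XOR (v XOR b) = a XOR b" for v a b :: nat
      by (metis xor.assoc xor.left_commute xor_self_eq xor.left_neutral)
    ultimately show ?thesis using True by (simp add: expect_Suc)
  next
    case False
    have "((if odd c then v else 0) XOR xor_words B (c div 2) vs) XOR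
        ((if odd c' then v else 0) XOR xor_words B (c' div 2) vs) = v XOR ?Z vs" for v vs
      using False by (auto simp: xor.assoc xor.left_commute)
    then have "expect w (Suc B) (\<lambda>vs. f (xor_words (Suc B) c vs XOR xor_words (Suc B) c' vs)) =
        avg w (\<lambda>v. expect w B (\<lambda>vs. f (v XOR ?Z vs)))"
      by (simp add: expect_Suc)
    also have "\<dots> = expect w B (\<lambda>vs. avg w (\<lambda>v. f (v XOR ?Z vs)))" by (rule avg_expect_swap)
    also have "\<dots> = expect w B (\<lambda>vs. avg w f)"
      by (intro expect_cong avg_xor xor_less_2pow xor_words_less)
    finally show ?thesis by simp
  qed
qed simp

text \<open>The first word enters both hashes, as the codes are odd. It makes the first hash uniform
  and cancels in the XOR of the two, which depends on the remaining words only and is uniform by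
  \<open>expect_xor_words_diff\<close>.\<close>

lemma expect_xor_words_pair:
  assumes "c \<noteq> c'" "odd c" "odd c'" "c < 2 ^ B" "c' < 2 ^ B"
  shows "expect w B (\<lambda>vs. f (xor_words B c vs) (xor_words B c' vs)) = avg w (\<lambda>a. avg w (\<lambda>b. f a b))"
proof (cases B)
  case 0 then show ?thesis using assms by simp
next
  case (Suc D)
  let ?Y = "\<lambda>vs. xor_words D (c div 2) vs" and ?Y' = "\<lambda>vs. xor_words D (c' div 2) vs"
  have "expect w B (\<lambda>vs. f (xor_words B c vs) (xor_words B c' vs)) =
      avg w (\<lambda>v. expect w D (\<lambda>vs. f (v XOR ?Y vs) (v XOR ?Y' vs)))"
    using assms by (simp add: Suc expect_Suc)
  also have "\<dots> = expect w D (\<lambda>vs. avg w (\<lambda>v. f (v XOR ?Y vs) (v XOR ?Y' vs)))"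
    by (rule avg_expect_swap)
  also have "\<dots> = expect w D (\<lambda>vs. avg w (\<lambda>v. f v (v XOR (?Y vs XOR ?Y' vs))))"
  proof (rule expect_cong)
    fix vs assume "vs \<in> tapes w D"
    then have "?Y vs < 2 ^ w" by (rule xor_words_less)
    from avg_xor[OF this, of "\<lambda>v. f v (v XOR (?Y vs XOR ?Y' vs))"]
    show "avg w (\<lambda>v. f (v XOR ?Y vs) (v XOR ?Y' vs)) = avg w (\<lambda>v. f v (v XOR (?Y vs XOR ?Y' vs)))"
      by (simp add: xor.assoc flip: xor.assoc[of "xor_words D (c div 2) vs"])
  qed
  also have "\<dots> = avg w (\<lambda>v. expect w D (\<lambda>vs. f v (v XOR (?Y vs XOR ?Y' vs))))"
    by (rule avg_expect_swap[symmetric])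
  also have "\<dots> = avg w (\<lambda>v. avg w (\<lambda>b. f v (b XOR v)))"
  proof -
    have "c div 2 \<noteq> c' div 2" using assms by (metis odd_two_times_div_two_succ)
    then show ?thesis using assms
      by (subst expect_xor_words_diff) (auto simp: Suc xor.commute)
  qed
  also have "\<dots> = avg w (\<lambda>v. avg w (\<lambda>b. f v b))"
    by (intro avg_cong avg_xor)
  finally show ?thesis .
qed

lemma odd_code [simp]: "odd (code x)"
  by (simp add: code_def split: list.split)

section \<open>Collision probability of two walks\<close>

definition coll :: "nat \<Rightarrow> nat \<Rightarrow> nat \<Rightarrow> nat \<Rightarrow> nat \<Rightarrow> nat list \<Rightarrow> nat list \<Rightarrow> real" where
  "coll w l B th t x y = expect w (t * Suc B)
     (\<lambda>vs. of_bool (take_bit l (fprint B th t x vs XOR fprint B th t y vs) = 0))"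

lemma coll_0 [simp]: "coll w l B th 0 x y = 1"
  by (simp add: coll_def)

lemma coll_nonneg: "0 \<le> coll w l B th t x y"
  unfolding coll_def using expect_mono[of w _ "\<lambda>vs. 0"] by simp

lemma coll_le_1: "coll w l B th t x y \<le> 1"
  unfolding coll_def using expect_mono[of w _ _ "\<lambda>vs. 1"] by simp

lemma coll_Suc:
  assumes "th \<le> 2 ^ w"
  shows "coll w l B th (Suc t) x y =
    th / 2 ^ w * expect w B (\<lambda>V. coll w l B th t
      (if odd (xor_words B (code x) V) then tl x else x) (if odd (xor_words B (code y) V) then tl y else y)) +
    (1 - th / 2 ^ w) * expect w B (\<lambda>V. expect w (t * Suc B) (\<lambda>r.
      of_bool (take_bit l ((xor_words B (code x) V XOR fprint B th t (tl x) r) XOR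
        (xor_words B (code y) V XOR fprint B th t (tl y) r)) = 0)))"
proof -
  have len: "Suc t * Suc B = Suc (B + t * Suc B)" by (simp add: ac_simps)
  have "coll w l B th (Suc t) x y = avg w (\<lambda>u. expect w B (\<lambda>V. expect w (t * Suc B) (\<lambda>r.
      of_bool (take_bit l (fprint B th (Suc t) x (u # V @ r) XOR fprint B th (Suc t) y (u # V @ r)) = 0))))"
    unfolding coll_def len expect_Suc expect_append by simp
  also have "\<dots> = avg w (\<lambda>u. if u < th
      then expect w B (\<lambda>V. coll w l B th t
        (if odd (xor_words B (code x) V) then tl x else x) (if odd (xor_words B (code y) V) then tl y else y))
      else expect w B (\<lambda>V. expect w (t * Suc B) (\<lambda>r.
        of_bool (take_bit l ((xor_words B (code x) V XOR fprint B th t (tl x) r) XOR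
          (xor_words B (code y) V XOR fprint B th t (tl y) r)) = 0))))"
    unfolding coll_def
    by (intro avg_cong) (auto simp: Let_def tapes_def xor_words_append intro!: expect_cong)
  also have "\<dots> = th / 2 ^ w * expect w B (\<lambda>V. coll w l B th t
      (if odd (xor_words B (code x) V) then tl x else x) (if odd (xor_words B (code y) V) then tl y else y)) +
    (1 - th / 2 ^ w) * expect w B (\<lambda>V. expect w (t * Suc B) (\<lambda>r.
      of_bool (take_bit l ((xor_words B (code x) V XOR fprint B th t (tl x) r) XOR
        (xor_words B (code y) V XOR fprint B th t (tl y) r)) = 0)))"
    by (rule avg_less[OF assms])
  finally show ?thesis .
qed

text \<open>Equal codes have equal hashes: emitted words cancel in the XOR, and after a
  \<open>\<bottom>\<close> both walks advance or both stay, with probability 1/2 each.\<close>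

lemma coll_Suc_same:
  assumes "th \<le> 2 ^ w" "0 < w" "code x = code y" "code x < 2 ^ B"
  shows "coll w l B th (Suc t) x y =
    th / 2 ^ w * ((coll w l B th t x y + coll w l B th t (tl x) (tl y)) / 2) +
    (1 - th / 2 ^ w) * coll w l B th t (tl x) (tl y)"
proof -
  have c: "code x \<noteq> 0" "0 < (2::nat) ^ B" using odd_code[of x] by (metis even_zero, simp)
  have "expect w B (\<lambda>V. coll w l B th t
      (if odd (xor_words B (code x) V) then tl x else x) (if odd (xor_words B (code y) V) then tl y else y)) =
    avg w (\<lambda>v. coll w l B th t (if odd v then tl x else x) (if odd v then tl y else y))"
    using expect_xor_words_diff[OF c(1) assms(4) c(2), of w
        "\<lambda>v. coll w l B th t (if odd v then tl x else x) (if odd v then tl y else y)"] assms(3) by simp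
  also have "\<dots> = (coll w l B th t x y + coll w l B th t (tl x) (tl y)) / 2"
    using avg_odd[OF assms(2), of "\<lambda>v. coll w l B th t (if v then tl x else x) (if v then tl y else y)"]
    by simp
  finally have 1: "expect w B (\<lambda>V. coll w l B th t
      (if odd (xor_words B (code x) V) then tl x else x) (if odd (xor_words B (code y) V) then tl y else y)) =
    (coll w l B th t x y + coll w l B th t (tl x) (tl y)) / 2" .
  have "(v XOR a) XOR (v XOR b) = a XOR b" for v a b :: nat
    by (metis xor.assoc xor.left_commute xor_self_eq xor.left_neutral)
  then have 2: "expect w B (\<lambda>V. expect w (t * Suc B) (\<lambda>r.
      of_bool (take_bit l ((xor_words B (code x) V XOR fprint B th t (tl x) r) XOR
        (xor_words B (code y) V XOR fprint B th t (tl y) r)) = 0))) = coll w l B th t (tl x) (tl y)"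
    by (simp add: assms(3) coll_def)
  show ?thesis unfolding coll_Suc[OF assms(1)] 1 2 ..
qed

text \<open>After a \<open>\<bottom>\<close> the two parities are independent, whence four equally
  likely continuations. Without one, two independent uniform words enter the fingerprints, so the
  low bits agree with probability exactly \<open>1 / 2 ^ l\<close>, whatever the walks do
  later.\<close>

lemma coll_Suc_diff:
  assumes "th \<le> 2 ^ w" "0 < w" "code x \<noteq> code y" "code x < 2 ^ B" "code y < 2 ^ B" "l \<le> w"
  shows "coll w l B th (Suc t) x y =
    th / 2 ^ w * ((coll w l B th t x y + coll w l B th t (tl x) y +
      coll w l B th t x (tl y) + coll w l B th t (tl x) (tl y)) / 4) +
    (1 - th / 2 ^ w) * (1 / 2 ^ l)"
proof -
  let ?f = "\<lambda>a b. coll w l B th t (if a then tl x else x) (if b then tl y else y)"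
  have "expect w B (\<lambda>V. coll w l B th t
      (if odd (xor_words B (code x) V) then tl x else x) (if odd (xor_words B (code y) V) then tl y else y)) =
    avg w (\<lambda>a. avg w (\<lambda>b. ?f (odd a) (odd b)))"
    using expect_xor_words_pair[OF assms(3) _ _ assms(4,5), of w "\<lambda>a b. ?f (odd a) (odd b)"] by simp
  also have "\<dots> = avg w (\<lambda>a. (?f (odd a) True + ?f (odd a) False) / 2)"
    by (intro avg_cong) (rule avg_odd[OF assms(2), of "?f _"])
  also have "\<dots> = (?f False False + ?f True False + ?f False True + ?f True True) / 4"
    by (subst avg_odd[OF assms(2), of "\<lambda>a. (?f a True + ?f a False) / 2"]) (simp add: field_simps)
  finally have 1: "expect w B (\<lambda>V. coll w l B th t
      (if odd (xor_words B (code x) V) then tl x else x) (if odd (xor_words B (code y) V) then tl y else y)) =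
    (coll w l B th t x y + coll w l B th t (tl x) y +
      coll w l B th t x (tl y) + coll w l B th t (tl x) (tl y)) / 4" by simp
  let ?p = "fprint B th t (tl x)" and ?q = "fprint B th t (tl y)"
  have "expect w B (\<lambda>V. expect w (t * Suc B) (\<lambda>r.
      of_bool (take_bit l ((xor_words B (code x) V XOR ?p r) XOR (xor_words B (code y) V XOR ?q r)) = 0))) =
    avg w (\<lambda>a. avg w (\<lambda>b. expect w (t * Suc B) (\<lambda>r. of_bool (take_bit l ((a XOR ?p r) XOR (b XOR ?q r)) = 0))))"
    using expect_xor_words_pair[OF assms(3) _ _ assms(4,5), of w "\<lambda>a b. expect w (t * Suc B) (\<lambda>r.
      of_bool (take_bit l ((a XOR ?p r) XOR (b XOR ?q r)) = 0))"] by simp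
  also have "\<dots> = avg w (\<lambda>a. expect w (t * Suc B) (\<lambda>r. avg w (\<lambda>b.
      of_bool (take_bit l ((a XOR ?p r) XOR (b XOR ?q r)) = 0))))"
    by (simp add: avg_expect_swap)
  also have "\<dots> = avg w (\<lambda>a. expect w (t * Suc B) (\<lambda>r. 1 / 2 ^ l))"
  proof (intro avg_cong expect_cong)
    fix a :: nat and r assume a: "a < 2 ^ w" and r: "r \<in> tapes w (t * Suc B)"
    have "(a XOR ?p r) XOR (b XOR ?q r) = b XOR (a XOR ?p r XOR ?q r)" for b
      by (simp add: xor.assoc xor.left_commute)
    moreover have "a XOR ?p r XOR ?q r < 2 ^ w"
      by (intro xor_less_2pow a fprint_less[OF r])
    ultimately show "avg w (\<lambda>b. of_bool (take_bit l ((a XOR ?p r) XOR (b XOR ?q r)) = 0)) = 1 / 2 ^ l"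
      using avg_take_bit[OF assms(6), of "a XOR ?p r XOR ?q r"] by presburger
  qed
  finally have 2: "expect w B (\<lambda>V. expect w (t * Suc B) (\<lambda>r.
      of_bool (take_bit l ((xor_words B (code x) V XOR ?p r) XOR (xor_words B (code y) V XOR ?q r)) = 0))) =
    1 / 2 ^ l" by simp
  show ?thesis unfolding coll_Suc[OF assms(1)] 1 2 ..
qed

lemma ED_code_same: "code x = code y \<Longrightarrow> ED (tl x) (tl y) = ED x y"
  by (cases x; cases y) (simp_all add: code_def)

lemma ED_code_diff:
  assumes "code x \<noteq> code y"
  shows "ED x y = Suc (ED (tl x) y) \<or> ED x y = Suc (ED x (tl y)) \<or> ED x y = Suc (ED (tl x) (tl y))"
proof (cases x)
  case Nil
  then show ?thesis using assms by (cases y) auto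
next
  case (Cons a x')
  show ?thesis
  proof (cases y)
    case Nil then show ?thesis using Cons by simp
  next
    case (Cons b y')
    then have "a \<noteq> b" using assms \<open>x = a # x'\<close> by (auto simp: code_def)
    from ED_Cons_Cons_diff[OF this, of x' y'] show ?thesis
      unfolding Cons \<open>x = a # x'\<close> list.sel by linarith
  qed
qed

text \<open>The first conjunct is for code 1 of the empty string, so that every suffix of
  \<open>x\<close> has a code of at most \<open>B\<close> bits.\<close>

definition fits :: "nat \<Rightarrow> nat list \<Rightarrow> bool" where
  "fits B x \<longleftrightarrow> 1 < (2::nat) ^ B \<and> (\<forall>a\<in>set x. 2 * a + 3 < 2 ^ B)"

lemma fits_tl: "fits B x \<Longrightarrow> fits B (tl x)"
  by (cases x) (auto simp: fits_def)

lemma fits_code: "fits B x \<Longrightarrow> code x < 2 ^ B"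
  by (cases x) (auto simp: fits_def code_def)

text \<open>As \<open>p = \<theta> / 4 * (1 + p)\<close>, it suffices to keep two of the four
  continuations after a \<open>\<bottom>\<close>: standing still and one edit that lowers the
  distance. The bound holds for every \<open>t\<close>, since walks of no steps collide with
  certainty.\<close>

lemma coll_lower:
  fixes th w :: nat
  defines "\<theta> \<equiv> th / 2 ^ w"
  defines "p \<equiv> \<theta> / (4 - \<theta>)"
  assumes "th \<le> 2 ^ w" "0 < w" "l \<le> w" "fits B x" "fits B y"
  shows "p ^ ED x y \<le> coll w l B th t x y"
  using assms(6,7)
proof (induction t arbitrary: x y)
  case 0
  have "0 \<le> \<theta>" "\<theta> \<le> 1" using assms(3) by (simp_all add: \<theta>_def)
  then have "0 \<le> p" "p \<le> 1" by (simp_all add: p_def field_simps)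
  then show ?case by (simp add: power_le_one)
next
  case (Suc t)
  have \<theta>: "0 \<le> \<theta>" "\<theta> \<le> 1" using assms(3) by (simp_all add: \<theta>_def)
  then have p: "0 \<le> p" "\<theta> * (p + 1) = 4 * p" by (simp_all add: p_def field_simps)
  let ?c = "coll w l B th t"
  show ?case
  proof (cases "code x = code y")
    case True
    have "p ^ ED x y \<le> ?c x y" "p ^ ED x y \<le> ?c (tl x) (tl y)"
      using Suc.IH[of x y] Suc.IH[of "tl x" "tl y"] Suc.prems fits_tl ED_code_same[OF True] by simp_all
    then have "\<theta> * p ^ ED x y \<le> \<theta> * ((?c x y + ?c (tl x) (tl y)) / 2)"
        "(1 - \<theta>) * p ^ ED x y \<le> (1 - \<theta>) * ?c (tl x) (tl y)"
      using \<theta> by (intro mult_left_mono; simp)+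
    moreover have "p ^ ED x y = \<theta> * p ^ ED x y + (1 - \<theta>) * p ^ ED x y" by (simp add: algebra_simps)
    ultimately show ?thesis
      unfolding coll_Suc_same[OF assms(3,4) True fits_code[OF Suc.prems(1)], of l t] \<theta>_def[symmetric]
      by linarith
  next
    case False
    obtain D where D: "ED x y = Suc D" "ED (tl x) y = D \<or> ED x (tl y) = D \<or> ED (tl x) (tl y) = D"
      using ED_code_diff[OF False] by auto
    have "p ^ ED x y \<le> ?c x y" "p ^ ED (tl x) y \<le> ?c (tl x) y" "p ^ ED x (tl y) \<le> ?c x (tl y)"
        "p ^ ED (tl x) (tl y) \<le> ?c (tl x) (tl y)"
      by (intro Suc.IH fits_tl Suc.prems)+
    then have "p ^ Suc D + p ^ D \<le> ?c x y + ?c (tl x) y + ?c x (tl y) + ?c (tl x) (tl y)"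
      using D(2) zero_le_power[OF p(1)] D(1) by (smt (verit) coll_nonneg)
    then have "\<theta> * (p ^ Suc D + p ^ D) \<le> \<theta> * (?c x y + ?c (tl x) y + ?c x (tl y) + ?c (tl x) (tl y))"
      using \<theta>(1) by (intro mult_left_mono)
    moreover have "\<theta> * (p ^ Suc D + p ^ D) = 4 * p ^ Suc D"
    proof -
      have "\<theta> * (p ^ Suc D + p ^ D) = \<theta> * (p + 1) * p ^ D" by (simp add: algebra_simps)
      also have "\<dots> = 4 * p ^ Suc D" unfolding p(2) by simp
      finally show ?thesis .
    qed
    moreover have "0 \<le> (1 - \<theta>) * (1 / 2 ^ l)" using \<theta> by simp
    ultimately show ?thesis
      unfolding coll_Suc_diff[OF assms(3,4) False fits_code[OF Suc.prems(1)] fits_code[OF Suc.prems(2)] assms(5)]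
        \<theta>_def[symmetric] D(1) by simp
  qed
qed

text \<open>As \<open>s = \<theta> / 4 * (3 + s)\<close>, it suffices that standing still keeps the
  distance and that the other three continuations lower it by at most 1. The term
  \<open>1 / 2 ^ l\<close> is accidental agreement. The last term pays for walks unfinished after
  \<open>t\<close> steps: the potential \<open>2 ^ length x - 1\<close> at least halves with each
  character read, so its expectation shrinks by 3/4 per step even if the walk advances with
  probability 1/2 only.\<close>

lemma coll_upper:
  fixes th w :: nat
  defines "\<theta> \<equiv> th / 2 ^ w"
  defines "s \<equiv> 3 * \<theta> / (4 - \<theta>)"
  assumes "th \<le> 2 ^ w" "0 < w" "l \<le> w" "fits B x" "fits B y"
  shows "coll w l B th t x y \<le>
    s ^ ED x y + 1 / 2 ^ l + ((2 ^ length x - 1) + (2 ^ length y - 1)) * (3 / 4) ^ t"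
  using assms(6,7)
proof (induction t arbitrary: x y)
  case 0
  have g: "0 \<le> (2::real) ^ length z - 1" "z \<noteq> [] \<Longrightarrow> 1 \<le> (2::real) ^ length z - 1" for z :: "nat list"
  proof -
    show "0 \<le> (2::real) ^ length z - 1" by simp
    show "1 \<le> (2::real) ^ length z - 1" if "z \<noteq> []"
      using that power_increasing[of 1 "length z" "2::real"] by (cases z) auto
  qed
  have "0 \<le> \<theta>" "\<theta> \<le> 1" using assms(3) by (simp_all add: \<theta>_def)
  then have s: "0 \<le> s" by (simp add: s_def)
  have c: "s ^ ED x y \<ge> 0" "(1 / 2 ^ l :: real) \<ge> 0" using s by simp_all
  show ?case
  proof (cases "x = y")
    case True then show ?thesis using g(1)[of y] c(2) unfolding coll_0 power_0 mult_1_right True ED_refl by linarith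
  next
    case False
    then have "x \<noteq> [] \<or> y \<noteq> []" by auto
    then have "1 \<le> (2 ^ length x - 1) + (2 ^ length y - 1 :: real)" using g[of x] g[of y] by linarith
    then show ?thesis using c unfolding coll_0 power_0 mult_1_right by linarith
  qed
next
  case (Suc t)
  have \<theta>: "0 \<le> \<theta>" "\<theta> \<le> 1" using assms(3) by (simp_all add: \<theta>_def)
  then have s: "0 \<le> s" "s \<le> 1" "\<theta> * (s + 3) = 4 * s" by (simp_all add: s_def field_simps)
  let ?c = "coll w l B th t"
  define g where "g z = (2::real) ^ length z - 1" for z :: "nat list"
  define k where "k = (3 / 4 :: real) ^ t"
  define b where "b = (1 / 2 ^ l :: real)"
  have k: "0 \<le> k" by (simp add: k_def)
  have g0: "0 \<le> g z" for z by (simp add: g_def)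
  have gtl: "g z + g (tl z) \<le> 3 / 2 * g z" for z
    by (cases z) (simp_all add: g_def)
  have IH: "?c u v \<le> s ^ ED u v + b + (g u + g v) * k" if "fits B u" "fits B v" for u v
    using Suc.IH[OF that] by (simp add: g_def k_def b_def)
  have goal: "coll w l B th (Suc t) x y \<le> s ^ ED x y + b + (g x + g y) * (3 / 4 * k)"
  proof (cases "code x = code y")
    case True
    show ?thesis
    proof (cases "x = []")
      \<comment> \<open>Both strings are exhausted, so the distance term alone is already 1.\<close>
      case True
      then have "y = []" using \<open>code x = code y\<close> by (cases y) (auto simp: code_def)
      moreover have "0 \<le> b" by (simp add: b_def)
      ultimately show ?thesis using True coll_le_1[of w l B th "Suc t" x y] by (simp add: g_def)
    next
      case False
      then obtain a x' y' where xy: "x = a # x'" "y = a # y'"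
        using True by (cases x; cases y) (auto simp: code_def)
      have g2: "g x = 2 * g x' + 1" "g y = 2 * g y' + 1" by (simp_all add: xy g_def)
      have 1: "?c x y \<le> s ^ ED x y + b + (g x + g y) * k" by (rule IH[OF Suc.prems])
      have 2: "?c (tl x) (tl y) \<le> s ^ ED x y + b + (g x' + g y') * k"
        using IH[OF fits_tl[OF Suc.prems(1)] fits_tl[OF Suc.prems(2)]] by (simp add: xy)
      let ?m = "s ^ ED x y + b"
      have "\<theta> * ((?c x y + ?c (tl x) (tl y)) / 2) \<le>
          \<theta> * ((?m + (g x + g y) * k + (?m + (g x' + g y') * k)) / 2)"
        using 1 2 \<theta>(1) by (intro mult_left_mono divide_right_mono add_mono) auto
      moreover have "(1 - \<theta>) * ?c (tl x) (tl y) \<le> (1 - \<theta>) * (?m + (g x' + g y') * k)"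
        using 2 \<theta>(2) by (intro mult_left_mono) auto
      moreover have "\<theta> * ((?m + (g x + g y) * k + (?m + (g x' + g y') * k)) / 2) +
          (1 - \<theta>) * (?m + (g x' + g y') * k) =
          ?m + ((1 + \<theta> / 2) * (g x' + g y') + \<theta>) * k"
        unfolding g2 by (simp add: field_simps)
      \<comment> \<open>On equal characters the walks stay with probability
        \<open>\<theta> / 2\<close>, which is at most 1/2, so the potential still shrinks by
        3/4.\<close>
      moreover have "((1 + \<theta> / 2) * (g x' + g y') + \<theta>) * k \<le> (g x + g y) * (3 / 4) * k"
      proof (rule mult_right_mono[OF _ k])
        have "(1 + \<theta> / 2) * (g x' + g y') \<le> 3 / 2 * (g x' + g y')"
          using \<theta>(2) g0[of x'] g0[of y'] by (intro mult_right_mono) auto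
        moreover have "(g x + g y) * (3 / 4) = 3 / 2 * (g x' + g y') + 3 / 2"
          unfolding g2 by simp
        ultimately show "(1 + \<theta> / 2) * (g x' + g y') + \<theta> \<le> (g x + g y) * (3 / 4)"
          using \<theta>(2) by linarith
      qed
      moreover have "(g x + g y) * (3 / 4) * k = (g x + g y) * (3 / 4 * k)" by (rule mult.assoc)
      ultimately show ?thesis
        unfolding coll_Suc_same[OF assms(3,4) \<open>code x = code y\<close> fits_code[OF Suc.prems(1)]] \<theta>_def[symmetric]
        by linarith
    qed
  next
    case False
    then obtain D where D: "ED x y = Suc D" using ED_code_diff by blast
    have pw: "s ^ ED u v \<le> s ^ D" if "D \<le> ED u v" for u v
      using that s by (intro power_decreasing)
    have pws: "s ^ ED (tl x) y \<le> s ^ D" "s ^ ED x (tl y) \<le> s ^ D" "s ^ ED (tl x) (tl y) \<le> s ^ D"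
      using ED_tl_le[of x y] D by (auto intro!: pw)
    note f = Suc.prems fits_tl[OF Suc.prems(1)] fits_tl[OF Suc.prems(2)]
    let ?S = "?c x y + ?c (tl x) y + ?c x (tl y) + ?c (tl x) (tl y)"
    have "?S \<le> (s ^ Suc D + 3 * s ^ D) + 4 * b + 2 * ((g x + g (tl x)) + (g y + g (tl y))) * k"
      using IH[OF f(1,2)] IH[OF f(3,2)] IH[OF f(1,4)] IH[OF f(3,4)] pws D by (simp add: algebra_simps)
    \<comment> \<open>Among the four continuations each string stays in two and advances in two;
      \<open>g z + g (tl z)\<close> is at most 3/2 of \<open>g z\<close>.\<close>
    also have "\<dots> \<le> (s ^ Suc D + 3 * s ^ D) + 4 * b + 2 * (3 / 2 * g x + 3 / 2 * g y) * k"
      using gtl[of x] gtl[of y] k by (intro add_left_mono mult_right_mono) auto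
    finally have "\<theta> * ?S \<le> \<theta> * ((s ^ Suc D + 3 * s ^ D) + 4 * b + 3 * (g x + g y) * k)"
      using \<theta>(1) by (intro mult_left_mono) auto
    also have "\<dots> = \<theta> * (s + 3) * s ^ D + 4 * \<theta> * b + \<theta> * (3 * ((g x + g y) * k))"
      by (simp add: algebra_simps)
    also have "\<dots> \<le> 4 * s ^ Suc D + 4 * \<theta> * b + 3 * ((g x + g y) * k)"
      using \<theta>(2) g0[of x] g0[of y] k unfolding s(3)
      by (intro add_mono mult_left_le_one_le) (auto simp: \<theta>)
    finally have "\<theta> * ?S \<le> 4 * s ^ Suc D + 4 * \<theta> * b + 3 * ((g x + g y) * k)" .
    moreover have "\<theta> * (?S / 4) = \<theta> * ?S / 4" by simp
    ultimately have S: "\<theta> * (?S / 4) \<le> s ^ Suc D + \<theta> * b + 3 / 4 * ((g x + g y) * k)"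
      by linarith
    show ?thesis
      unfolding coll_Suc_diff[OF assms(3,4) False fits_code[OF Suc.prems(1)] fits_code[OF Suc.prems(2)] assms(5)]
        \<theta>_def[symmetric] D b_def[symmetric]
    proof -
      have "(1 - \<theta>) * b = b - \<theta> * b" "(g x + g y) * (3 / 4 * k) = 3 / 4 * ((g x + g y) * k)"
        by (simp_all add: algebra_simps)
      then show "\<theta> * (?S / 4) + (1 - \<theta>) * b \<le> s ^ Suc D + b + (g x + g y) * (3 / 4 * k)"
        using S by linarith
    qed
  qed
  then show ?case by (simp add: g_def k_def b_def mult.assoc)
qed

section \<open>Symbolic execution with time bounds\<close>

text \<open>Total correctness, with the exact running time handed to the postcondition. The
  existence of one run is enough because execution is deterministic.\<close>

definition wp :: "nat \<Rightarrow> nat \<Rightarrow> prog \<Rightarrow> state \<Rightarrow> (nat \<Rightarrow> state \<Rightarrow> bool) \<Rightarrow> bool" where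
  "wp w m P s Q \<longleftrightarrow> (\<exists>t s'. exec w m P s t s' \<and> Q t s')"

lemma wp_simps [simp]:
  "wp w m Skip s Q \<longleftrightarrow> Q 1 s"
  "wp w m (Const i v) s Q \<longleftrightarrow> Q 1 (s\<lparr>regs := (regs s)(i := v mod 2 ^ w)\<rparr>)"
  "wp w m (Op f i j k) s Q \<longleftrightarrow> Q 1 (s\<lparr>regs := (regs s)(i := apply_op w f (regs s j) (regs s k))\<rparr>)"
  "wp w m (Load i j) s Q \<longleftrightarrow>
     regs s j < m \<and> Q 1 (s\<lparr>regs := (regs s)(i := mem s (regs s j))\<rparr>)"
  "wp w m (Store i j) s Q \<longleftrightarrow>
     regs s i < m \<and> Q 1 (s\<lparr>mem := (mem s)(regs s i := regs s j)\<rparr>)"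
  "wp w m (Rand i) s Q \<longleftrightarrow>
     tape s \<noteq> [] \<and> Q 1 (s\<lparr>regs := (regs s)(i := hd (tape s)), tape := tl (tape s)\<rparr>)"
  "wp w m (Seq P P') s Q \<longleftrightarrow> wp w m P s (\<lambda>t s'. wp w m P' s' (\<lambda>t'. Q (t + t')))"
  "wp w m (Cond i P P') s Q \<longleftrightarrow>
     (if regs s i \<noteq> 0 then wp w m P s (\<lambda>t. Q (Suc t)) else wp w m P' s (\<lambda>t. Q (Suc t)))"
  subgoal unfolding wp_def by (auto elim: exec.cases intro: exec.intros simp del: One_nat_def)
  subgoal unfolding wp_def by (auto elim: exec.cases intro: exec.intros simp del: One_nat_def)
  subgoal unfolding wp_def by (auto elim: exec.cases intro: exec.intros simp del: One_nat_def)
  subgoal unfolding wp_def by (auto elim: exec.cases intro: exec.intros simp del: One_nat_def)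
  subgoal unfolding wp_def by (auto elim: exec.cases intro: exec.intros simp del: One_nat_def)
  subgoal unfolding wp_def
  proof safe
    assume "tape s \<noteq> []" "Q 1 (s\<lparr>regs := (regs s)(i := hd (tape s)), tape := tl (tape s)\<rparr>)"
    then show "\<exists>t s'. exec w m (Rand i) s t s' \<and> Q t s'"
      using exec.Rand[of s "hd (tape s)" "tl (tape s)" w m i] by auto
  qed (auto elim: exec.cases)
  subgoal unfolding wp_def by (auto elim!: exec.cases[of w m "Seq P P'"] intro: exec.Seq)
  subgoal
  proof -
    have "exec w m (Cond i P P') s t s' \<longleftrightarrow>
        (\<exists>t'. t = Suc t' \<and> exec w m (if regs s i \<noteq> 0 then P else P') s t' s')" for t s'
      using exec.CondTrue[of s i w m P _ s' P'] exec.CondFalse[of s i w m P' _ s' P]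
      by (auto elim!: exec.cases[of w m "Cond i P P'" s t s'])
    then show ?thesis unfolding wp_def by auto
  qed
  done

lemma wp_mono:
  assumes "wp w m P s Q" "\<And>t s'. Q t s' \<Longrightarrow> Q' t s'"
  shows "wp w m P s Q'"
  using assms unfolding wp_def by blast

text \<open>The potential \<open>\<Phi>\<close> bounds the time still needed, and so proves termination as well.\<close>

lemma wp_While:
  assumes "I s"
    and "\<And>s. I s \<Longrightarrow> regs s i \<noteq> 0 \<Longrightarrow> wp w m P s (\<lambda>t s'. I s' \<and> \<Phi> s' + t + 1 \<le> \<Phi> s)"
    and "\<And>s. I s \<Longrightarrow> 1 \<le> \<Phi> s"
  shows "wp w m (While i P) s (\<lambda>t s'. I s' \<and> regs s' i = 0 \<and> t \<le> \<Phi> s)"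
  using assms(1)
proof (induction "\<Phi> s" arbitrary: s rule: less_induct)
  case less
  show ?case
  proof (cases "regs s i = 0")
    case True
    then show ?thesis using less.prems assms(3)[OF less.prems] exec.WhileFalse[of s i w m P]
      unfolding wp_def by blast
  next
    case False
    then obtain t s' where s': "exec w m P s t s'" "I s'" "\<Phi> s' + t + 1 \<le> \<Phi> s"
      using assms(2)[OF less.prems] unfolding wp_def by blast
    then have "wp w m (While i P) s' (\<lambda>t s''. I s'' \<and> regs s'' i = 0 \<and> t \<le> \<Phi> s')"
      using less.hyps[of s'] by simp
    then obtain t' s'' where "exec w m (While i P) s' t' s''" "I s''" "regs s'' i = 0" "t' \<le> \<Phi> s'"
      unfolding wp_def by blast
    then show ?thesis using exec.WhileTrue[OF False s'(1)] s'(3) unfolding wp_def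
      by (intro exI[of _ "1 + t + t'"] exI[of _ s'']) simp
  qed
qed

text \<open>The OR of a word with itself serves as a register move.\<close>

abbreviation Copy :: "nat \<Rightarrow> nat \<Rightarrow> prog" where
  "Copy i j \<equiv> Op Or i j j"

fun seq :: "prog list \<Rightarrow> prog" where
  "seq [] = Skip"
| "seq [P] = P"
| "seq (P # Q # Ps) = Seq P (seq (Q # Ps))"

text \<open>These replace the modular equations in the simplifier, so that each arithmetic step of a
  program calls for a proof that its result fits in a word.\<close>

lemma apply_op_exact:
  "a + b < 2 ^ w \<Longrightarrow> apply_op w Add a b = a + b"
  "b \<le> a \<Longrightarrow> a < 2 ^ w \<Longrightarrow> apply_op w Sub a b = a - b"
  "a * b < 2 ^ w \<Longrightarrow> apply_op w Mul a b = a * b"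
  "a < 2 ^ w \<Longrightarrow> apply_op w Div a b = a div b"
  "a < 2 ^ w \<Longrightarrow> apply_op w Mod a b = a mod b"
  "a < 2 ^ w \<Longrightarrow> apply_op w Or a a = a"
  "a < 2 ^ w \<Longrightarrow> b < 2 ^ w \<Longrightarrow> apply_op w Xor a b = a XOR b"
  "1 < (2::nat) ^ w \<Longrightarrow> apply_op w And a 1 = of_bool (odd a)"
  "a * 2 ^ b < 2 ^ w \<Longrightarrow> apply_op w Shl a b = a * 2 ^ b"
  "a < 2 ^ w \<Longrightarrow> apply_op w Shr a 1 = a div 2"
  "1 < (2::nat) ^ w \<Longrightarrow> apply_op w Less a b = of_bool (a < b)"
  "1 < (2::nat) ^ w \<Longrightarrow> apply_op w Equal a b = of_bool (a = b)"
proof -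
  show "apply_op w Sub a b = a - b" if "b \<le> a" "a < 2 ^ w"
  proof -
    have eq: "a + 2 ^ w - b = (a - b) + 2 ^ w" using that by simp
    show ?thesis unfolding apply_op.simps eq mod_add_self2
      by (rule mod_less[OF less_imp_diff_less[OF that(2)]])
  qed
  show "apply_op w Xor a b = a XOR b" if "a < 2 ^ w" "b < 2 ^ w"
    using xor_less_2pow[OF that] by simp
  show "apply_op w And a 1 = of_bool (odd a)" if "1 < (2::nat) ^ w"
    using mod_less[OF le_less_trans[OF _ that], of "a mod 2"] by (simp add: and_one_eq mod_2_eq_odd)
  show "apply_op w Shr a 1 = a div 2" if "a < 2 ^ w"
    using mod_less[OF le_less_trans[OF div_le_dividend that], of 2] by (simp add: drop_bit_eq_div)
  show "apply_op w Div a b = a div b" if "a < 2 ^ w"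
    unfolding apply_op.simps by (rule mod_less[OF le_less_trans[OF div_le_dividend that]])
  show "apply_op w Mod a b = a mod b" if "a < 2 ^ w"
    unfolding apply_op.simps by (rule mod_less[OF le_less_trans[OF mod_less_eq_dividend that]])
  show "apply_op w Less a b = of_bool (a < b)" "apply_op w Equal a b = of_bool (a = b)"
    if "1 < (2::nat) ^ w"
    using that by simp_all
qed (simp_all add: push_bit_eq_mult)

declare apply_op.simps [simp del]
declare apply_op_exact [simp] apply_op_exact(8,10)[unfolded One_nat_def, simp]

text \<open>Keeps the simplifier out of the postcondition, so that programs are executed symbolically step by step.\<close>

lemma wp_cong [cong]: "P = P' \<Longrightarrow> s = s' \<Longrightarrow> wp w m P s Q = wp w m P' s' Q"
  by simp

text \<open>Most loops are verified by induction with this equation, which yields their effect and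
  time together; the scan for a query is the one that uses \<open>wp_While\<close>.\<close>

lemma wp_While_unfold:
  "wp w m (While i P) s Q \<longleftrightarrow>
    (if regs s i = 0 then Q 1 s
     else wp w m P s (\<lambda>t s'. wp w m (While i P) s' (\<lambda>t' s''. Q (1 + t + t') s'')))"
proof (cases "regs s i = 0")
  case True
  then show ?thesis unfolding wp_def
    by (auto elim: exec.cases[of w m "While i P"] intro: exec.WhileFalse simp del: One_nat_def)
next
  case False
  have "exec w m (While i P) s t s'' \<Longrightarrow> \<exists>t1 s' t2. exec w m P s t1 s' \<and>
      exec w m (While i P) s' t2 s'' \<and> t = 1 + t1 + t2" for t s''
    by (erule exec.cases) (use False in auto)
  moreover have "exec w m P s t1 s' \<Longrightarrow> exec w m (While i P) s' t2 s'' \<Longrightarrow>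
      exec w m (While i P) s (1 + t1 + t2) s''" for t1 t2 s' s''
    using False by (rule exec.WhileTrue)
  ultimately show ?thesis using False unfolding wp_def by (simp del: plus_1_eq_Suc) blast
qed

section \<open>Computing fingerprints in memory\<close>

fun seg :: "(nat \<Rightarrow> nat) \<Rightarrow> nat \<Rightarrow> nat \<Rightarrow> nat list" where
  "seg M p 0 = []"
| "seg M p (Suc k) = M p # seg M (Suc p) k"

lemma length_seg [simp]: "length (seg M p k) = k"
  by (induction k arbitrary: p) auto

lemma drop_seg: "drop j (seg M p (j + k)) = seg M (p + j) k"
  by (induction j arbitrary: p) auto

lemma seg_cong: "(\<And>i. p \<le> i \<Longrightarrow> i < p + k \<Longrightarrow> M i = M' i) \<Longrightarrow> seg M p k = seg M' p k"
  by (induction k arbitrary: p) auto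

lemma seg_append: "seg M p (j + k) = seg M p j @ seg M (p + j) k"
  by (induction j arbitrary: p) auto

definition xor_loop :: prog where
  "xor_loop = While 46 (seq [Op And 50 46 19, Cond 50 (seq [Load 51 49, Op Xor 48 48 51]) Skip,
     Op Add 49 49 19, Op Shr 46 46 19])"

text \<open>The loop may stop before \<open>B\<close> rounds, once the remaining code is 0; the
  skipped words would contribute nothing.\<close>

lemma xor_loop:
  assumes "regs s 19 = 1" "regs s 46 < 2 ^ B" "2 ^ B < (2::nat) ^ w" "regs s 48 < 2 ^ w"
    "regs s 49 + B < 2 ^ w" "regs s 49 + B \<le> m" "\<forall>i<B. mem s (regs s 49 + i) < 2 ^ w"
  shows "wp w m xor_loop s (\<lambda>t s'. t \<le> 7 * B + 1 \<and> mem s' = mem s \<and> tape s' = tape s \<and>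
    (\<forall>i<46. regs s' i = regs s i) \<and>
    regs s' 48 = regs s 48 XOR xor_words B (regs s 46) (seg (mem s) (regs s 49) B))"
  using assms
proof (induction B arbitrary: s)
  case 0
  then show ?case by (simp add: xor_loop_def wp_While_unfold)
next
  case (Suc B)
  show ?case
  proof (cases "regs s 46 = 0")
    case True
    then show ?thesis by (simp add: xor_loop_def wp_While_unfold)
  next
    case False
    have w: "1 < (2::nat) ^ w" "regs s 46 < 2 ^ w" "2 ^ B < (2::nat) ^ w"
      using Suc.prems(2,3) False unfolding power_Suc by linarith+
    have hd: "mem s (regs s 49) < 2 ^ w" and tl: "\<forall>i<B. mem s (Suc (regs s 49) + i) < 2 ^ w"
      using Suc.prems(7) by auto
    show ?thesis
      unfolding xor_loop_def
      apply (subst wp_While_unfold)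
      apply (simp only: if_not_P[OF False] xor_loop_def[symmetric])
      using Suc.prems w hd tl
      apply (cases "odd (regs s 46)"; simp)
       apply (rule wp_mono[OF Suc.IH]; simp add: xor_less_2pow xor.assoc less_mult_imp_div_less mult.commute)
      apply (rule wp_mono[OF Suc.IH]; simp add: xor_less_2pow xor.assoc less_mult_imp_div_less mult.commute)
      done
  qed
qed

text \<open>Registers 42 and 43 are length and address of the unread suffix, 44 and 45 the position
  in the seed and the steps left, 40 the fingerprint. Register 50 holds first the coin and then the
  decision whether to advance.\<close>

definition hash_loop :: prog where
  "hash_loop = While 45 (seq [
     Cond 42 (seq [Load 46 43, Op Add 46 46 46, Const 47 3, Op Add 46 46 47]) (Const 46 1),
     Const 48 0, Op Add 49 44 19, xor_loop,
     Load 51 44, Op Less 50 51 11,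
     Cond 50 (Op And 50 48 19) (seq [Op Xor 40 40 48, Const 50 1]),
     Cond 50 (Cond 42 (seq [Op Sub 42 42 19, Op Add 43 43 19]) Skip) Skip,
     Op Add 44 44 9, Op Add 44 44 19, Op Sub 45 45 19])"

lemma fprint_seg_Suc:
  "fprint B th (Suc t) x (seg M p (Suc t * Suc B)) =
     (let X = xor_words B (code x) (seg M (Suc p) B); vs' = seg M (p + Suc B) (t * Suc B) in
      if M p < th then fprint B th t (if odd X then tl x else x) vs'
      else X XOR fprint B th t (tl x) vs')"
proof -
  have "Suc t * Suc B = Suc (B + t * Suc B)" by simp
  moreover have "drop B (seg M (Suc p) (B + t * Suc B)) = seg M (Suc p + B) (t * Suc B)"
    by (rule drop_seg)
  ultimately show ?thesis
    by (simp only: fprint.simps seg.simps list.sel drop_Suc_Cons seg_append[of M "Suc p" B]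
        xor_words_append[OF length_seg]) (simp add: Let_def)
qed

lemma hash_loop:
  assumes "regs s 19 = 1" "regs s 9 = B" "regs s 11 = th" "regs s 45 = t"
    "2 ^ B < (2::nat) ^ w" "2 < B" "regs s 40 < 2 ^ w"
    "regs s 44 + t * Suc B < 2 ^ w" "regs s 44 + t * Suc B \<le> m" "t < 2 ^ w"
    "\<forall>i<t * Suc B. mem s (regs s 44 + i) < 2 ^ w"
    "regs s 42 = length x" "\<forall>i<length x. mem s (regs s 43 + i) = x ! i"
    "regs s 43 + length x < 2 ^ w" "regs s 43 + length x \<le> m" "fits B x"
  shows "wp w m hash_loop s (\<lambda>t' s'. t' \<le> t * (7 * B + 25) + 1 \<and> mem s' = mem s \<and>
    tape s' = tape s \<and> (\<forall>i<40. regs s' i = regs s i) \<and> regs s' 40 < 2 ^ w \<and>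
    regs s' 40 = regs s 40 XOR fprint B th t x (seg (mem s) (regs s 44) (t * Suc B)))"
  using assms
proof (induction t arbitrary: s x)
  case 0
  then show ?case by (simp add: hash_loop_def wp_While_unfold)
next
  case (Suc t)
  let ?sp = "regs s 44"
  define X where "X = xor_words B (code x) (seg (mem s) (Suc ?sp) B)"
  have B: "(8::nat) \<le> 2 ^ B" using power_increasing[of 3 B "2::nat"] Suc.prems(6) by simp
  have w: "1 < (2::nat) ^ w" "3 < (2::nat) ^ w" "0 < (2::nat) ^ w" using Suc.prems(5) B by linarith+
  have sp: "?sp + Suc B + t * Suc B < 2 ^ w" "?sp + Suc B + t * Suc B \<le> m"
    using Suc.prems(8,9) by simp_all
  have sp': "Suc (?sp + B) < 2 ^ w" "Suc (?sp + B) \<le> m" "Suc ?sp < 2 ^ w" "?sp < m" "?sp < 2 ^ w"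
      "Suc t < 2 ^ w" "?sp + B < 2 ^ w"
    using sp Suc.prems(10) by simp_all
  have memw: "mem s (Suc ?sp + i) < 2 ^ w" if "i < B" for i
    using Suc.prems(11)[rule_format, of "Suc i"] that by simp
  have memw': "\<forall>i<t * Suc B. mem s (?sp + Suc B + i) < 2 ^ w"
  proof (intro allI impI)
    fix i assume "i < t * Suc B"
    then show "mem s (?sp + Suc B + i) < 2 ^ w"
      using Suc.prems(11)[rule_format, of "Suc B + i"] by (simp add: add.assoc)
  qed
  have Xw: "X < 2 ^ w" unfolding X_def
  proof (rule xor_words_less)
    have "set (seg M p k) \<subseteq> {..<2 ^ w}" if "\<forall>i<k. M (p + i) < 2 ^ w" for M p k
      using that
    proof (induction k arbitrary: p)
      case (Suc k)
      then show ?case using Suc.prems[rule_format, of 0] Suc.prems[rule_format, of "Suc _"] by simp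
    qed simp
    then show "seg (mem s) (Suc ?sp) B \<in> tapes w B" using memw by (simp add: tapes_def)
  qed
  have fits': "fits B (if odd X then tl x else x)" "fits B (tl x)"
    using Suc.prems(16) fits_tl by simp_all
  have code: "code x < 2 ^ B" "code x < 2 ^ w"
    using fits_code[OF Suc.prems(16)] less_trans[OF fits_code[OF Suc.prems(16)] Suc.prems(5)] by simp_all
  have step: "wp w m xor_loop u (\<lambda>t' s'. t' \<le> 7 * B + 1 \<and> mem s' = mem s \<and> tape s' = tape s \<and>
      (\<forall>i<46. regs s' i = regs s i) \<and> regs s' 48 = X)"
    if "mem u = mem s" "tape u = tape s" "\<forall>i<46. regs u i = regs s i" "regs u 46 = code x"
      "regs u 48 = 0" "regs u 49 = Suc ?sp" for u
    by (rule wp_mono[OF xor_loop[of u B w m]])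
      (use that code sp' memw Suc.prems(1,5) in \<open>auto simp: X_def w\<close>)
  have fp: "fprint B th (Suc t) x (seg (mem s) ?sp (Suc t * Suc B)) =
     (let vs' = seg (mem s) (?sp + Suc B) (t * Suc B) in
      if mem s ?sp < th then fprint B th t (if odd X then tl x else x) vs'
      else X XOR fprint B th t (tl x) vs')"
    unfolding fprint_seg_Suc X_def by (simp add: Let_def)
  \<comment> \<open>The unread string after this step; only a \<open>\<bottom>\<close> with an even
    hash leaves it in place.\<close>
  define y where "y = (if mem s ?sp < th \<and> even X then x else tl x)"
  have "0 < w" using w by (cases w) auto
  have IH: "wp w m hash_loop u (\<lambda>t' s'. t' \<le> t * (7 * B + 25) + 1 \<and> mem s' = mem s \<and>
      tape s' = tape s \<and> (\<forall>i<40. regs s' i = regs s i) \<and> regs s' 40 < 2 ^ w \<and>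
      regs s' 40 = regs s 40 XOR fprint B th (Suc t) x (seg (mem s) ?sp (Suc t * Suc B)))"
    if "mem u = mem s" "tape u = tape s" "\<forall>i<40. regs u i = regs s i" "regs u 45 = t"
      "regs u 40 = (if mem s ?sp < th then regs s 40 else regs s 40 XOR X)"
      "regs u 44 = ?sp + B + 1" "regs u 42 = length y"
      "regs u 43 = regs s 43 + (length x - length y)" for u
  proof (rule wp_mono[OF Suc.IH[of u y]])
    have y: "length y \<le> length x" "y = drop (length x - length y) x" "fits B y"
      using Suc.prems(16) fits_tl[OF Suc.prems(16)] by (cases x; simp add: y_def)+
    show "\<forall>i<length y. mem u (regs u 43 + i) = y ! i"
    proof (intro allI impI)
      fix i assume i: "i < length y"
      have "mem u (regs u 43 + i) = mem s (regs s 43 + (length x - length y + i))"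
        using that by (simp add: add.assoc)
      also have "\<dots> = x ! (length x - length y + i)" by (rule Suc.prems(13)[rule_format]) (use i y(1) in linarith)
      also have "\<dots> = y ! i" using arg_cong[OF y(2), of "\<lambda>z. z ! i"] i y(1) by simp
      finally show "mem u (regs u 43 + i) = y ! i" .
    qed
    show "regs u 43 + length y < 2 ^ w" "regs u 43 + length y \<le> m" "fits B y"
      using Suc.prems(14,15) y(1,3) that by simp_all
    show "regs u 44 + t * Suc B < 2 ^ w" "regs u 44 + t * Suc B \<le> m" "t < 2 ^ w"
        "\<forall>i<t * Suc B. mem u (regs u 44 + i) < 2 ^ w"
      using that sp sp'(6) memw' by simp_all
    show "regs u 40 < 2 ^ w" using that Xw Suc.prems(7) by (simp add: xor_less_2pow)
    fix t' s' assume "t' \<le> t * (7 * B + 25) + 1 \<and> mem s' = mem u \<and>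
      tape s' = tape u \<and> (\<forall>i<40. regs s' i = regs u i) \<and> regs s' 40 < 2 ^ w \<and>
      regs s' 40 = regs u 40 XOR fprint B th t y (seg (mem u) (regs u 44) (t * Suc B))"
    then show "t' \<le> t * (7 * B + 25) + 1 \<and> mem s' = mem s \<and>
      tape s' = tape s \<and> (\<forall>i<40. regs s' i = regs s i) \<and> regs s' 40 < 2 ^ w \<and>
      regs s' 40 = regs s 40 XOR fprint B th (Suc t) x (seg (mem s) ?sp (Suc t * Suc B))"
      unfolding fp using that by (auto simp: Let_def y_def xor.assoc)
  qed (use that Suc.prems(1-6) in auto)
  show ?case
  proof (cases x)
    case Nil
    then have "y = []" by (simp add: y_def)
    show ?thesis unfolding hash_loop_def
      apply (subst wp_While_unfold)
      apply (simp only: hash_loop_def[symmetric])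
      using Suc.prems(1-4,7,12,14,15) w sp' Xw \<open>0 < w\<close>
      apply (simp add: Nil)
      apply (rule wp_mono[OF step], simp_all add: code_def Nil)
      apply (intro conjI impI)
         apply ((rule wp_mono[OF IH]; simp add: Nil \<open>y = []\<close> del: fprint.simps seg.simps)+)
      done
  next
    case (Cons a x')
    then have "length y = (if mem s ?sp < th \<and> even X then Suc (length x') else length x')"
      by (simp add: y_def)
    moreover have "mem s (regs s 43) = a" using Suc.prems(13)[rule_format, of 0] Cons by simp
    moreover have "2 * a + 3 < 2 ^ w" using code(2) Cons by (simp add: code_def)
    ultimately show ?thesis unfolding hash_loop_def
      apply (subst wp_While_unfold)
      apply (simp only: hash_loop_def[symmetric])
      using Suc.prems(1-4,7,12,14,15) w sp' Xw \<open>0 < w\<close>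
      apply (simp add: Cons)
      apply (rule wp_mono[OF step], simp_all add: code_def Cons)
      apply (intro conjI impI)
         apply ((rule wp_mono[OF IH]; simp add: Cons del: fprint.simps seg.simps)+)
      done
  qed
qed

definition hash :: prog where
  "hash = seq [Load 42 21, Op Add 43 21 19, Copy 44 20, Copy 45 10, Const 40 0, hash_loop,
     Op Mod 40 40 13]"

lemma hash:
  assumes "regs s 19 = 1" "regs s 9 = B" "regs s 10 = t" "regs s 11 = th"
    "2 ^ B < (2::nat) ^ w" "2 < B" "regs s 20 + t * Suc B < 2 ^ w" "regs s 20 + t * Suc B \<le> m"
    "t < 2 ^ w" "\<forall>i<t * Suc B. mem s (regs s 20 + i) < 2 ^ w"
    "holds_string (mem s) (regs s 21) x" "regs s 21 + length x + 1 < 2 ^ w"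
    "regs s 21 + length x < m" "fits B x"
  shows "wp w m hash s (\<lambda>t' s'. t' \<le> t * (7 * B + 25) + 7 \<and> mem s' = mem s \<and>
    tape s' = tape s \<and> (\<forall>i<40. regs s' i = regs s i) \<and>
    regs s' 40 = fprint B th t x (seg (mem s) (regs s 20) (t * Suc B)) mod regs s 13)"
proof -
  have w: "regs s 20 < 2 ^ w" "regs s 21 < m" "regs s 21 < 2 ^ w" "1 < (2::nat) ^ w"
      "Suc (regs s 21) < 2 ^ w" "Suc (regs s 21) + length x < 2 ^ w" "Suc (regs s 21) + length x \<le> m"
    using assms(5,7,12,13) one_le_power[of "2::nat" B] by linarith+
  have len: "mem s (regs s 21) = length x" "\<forall>i<length x. mem s (Suc (regs s 21 + i)) = x ! i"
    using assms(11) by (simp_all add: holds_string_def)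
  have loop: "wp w m hash_loop u (\<lambda>t' s'. t' \<le> t * (7 * B + 25) + 1 \<and> mem s' = mem s \<and>
      tape s' = tape s \<and> (\<forall>i<40. regs s' i = regs s i) \<and> regs s' 40 < 2 ^ w \<and>
      regs s' 40 = fprint B th t x (seg (mem s) (regs s 20) (t * Suc B)))"
    if "mem u = mem s" "tape u = tape s" "\<forall>i<40. regs u i = regs s i" "regs u 45 = t"
      "regs u 40 = 0" "regs u 44 = regs s 20" "regs u 42 = length x"
      "regs u 43 = Suc (regs s 21)" for u
    by (rule wp_mono[OF hash_loop[of u B th t w m x]])
      (use that assms(1-10,14) w len in auto)
  show ?thesis
    unfolding hash_def using assms(1,3,9) w len
    apply simp
    apply (rule wp_mono[OF loop]; simp)
    done
qed

section \<open>Banded dynamic programming\<close>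

text \<open>The dynamic programming table in diagonal coordinates: \<delta> in row \<open>i\<close>
  stands for the column \<open>j\<close> with \<open>i + \<delta> = K + 1 + j\<close>, and the
  diagonals 0 and \<open>2 * K + 2\<close> are sentinels of value \<open>K + 1\<close>. Here
  \<open>x\<close> is stored at 0 and \<open>y\<close> at \<open>p\<close>. Cells left of column 0
  always exceed \<open>K\<close>, and valid cells never depend on columns beyond the end of
  \<open>y\<close>, so it does not matter which memory those cells compare.\<close>

fun band :: "nat \<Rightarrow> (nat \<Rightarrow> nat) \<Rightarrow> nat \<Rightarrow> nat \<Rightarrow> nat \<Rightarrow> nat" where
  "band K M p 0 \<delta> = (if \<delta> < Suc K then Suc K else \<delta> - Suc K)"
| "band K M p (Suc i) 0 = Suc K"
| "band K M p (Suc i) (Suc \<delta>) =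
    (if \<delta> = 2 * K + 1 then Suc K
     else min (band K M p i (Suc \<delta>) + of_bool (M (Suc i) \<noteq> M (p - K + Suc i + \<delta>)))
       (min (band K M p (Suc i) \<delta> + 1) (band K M p i (Suc (Suc \<delta>)) + 1)))"

text \<open>Keeps the table entries within a word.\<close>

lemma band_le: "\<delta> \<le> 2 * K + 2 \<Longrightarrow> band K M p i \<delta> \<le> K + 1 + i"
  by (induction K M p i \<delta> rule: band.induct) (auto simp: min_def)

lemma min_add_cong:
  fixes a b :: nat
  assumes "min a c = min b c"
  shows "min (a + e) c = min (b + e) c"
  using assms by (auto simp: min_def split: if_splits)

text \<open>Minimum and addition are compatible with truncation at \<open>c\<close>, so cells need
  only be right up to \<open>K + 1\<close>. The two neighbours change places to match the order in
  \<open>ED_snoc_snoc\<close>.\<close>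

lemma truncated_recurrence_cong:
  fixes a :: nat
  assumes "min a c = min a' c" "min l c = min l' c" "min r c = min r' c"
  shows "min (min (a + e) (min (l + 1) (r + 1))) c = min (min (a' + e) (min (r' + 1) (l' + 1))) c"
proof -
  have distrib: "min (min p (min q u)) c = min (min p c) (min (min q c) (min u c))" for p q u
    by (simp add: min_def)
  show ?thesis
    unfolding distrib min_add_cong[OF assms(1), of e] min_add_cong[OF assms(2), of 1]
      min_add_cong[OF assms(3), of 1]
    by (simp only: min.left_commute min.commute)
qed

lemma truncated_first_column:
  fixes a :: nat
  assumes "c \<le> a" "c \<le> l" "min r c = min i c"
  shows "min (min (a + e) (min (l + 1) (r + 1))) c = min (Suc i) c"
proof -
  have "min (min p (min q u)) c = min u c" if "c \<le> p" "c \<le> q" for p q u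
    using that by (simp add: min_def)
  from this[of "a + e" "l + 1" "r + 1"] show ?thesis
    using assms(1,2) min_add_cong[OF assms(3), of 1] by simp
qed

text \<open>At the edges of the band the difference of the lengths alone exceeds \<open>K\<close>,
  which justifies the sentinels. The claim about cells left of column 0 is what makes column 0
  itself come out right.\<close>

lemma band_ED:
  assumes "\<forall>i<length x. M (Suc i) = x ! i" "\<forall>j<length y. M (p + 1 + j) = y ! j" "K \<le> p"
    "i \<le> length x" "\<delta> \<le> 2 * K + 2"
  shows "(i + \<delta> < K + 1 \<longrightarrow> K + 1 \<le> band K M p i \<delta>) \<and>
    (\<forall>j\<le>length y. i + \<delta> = K + 1 + j \<longrightarrow>
      min (band K M p i \<delta>) (K + 1) = min (ED (take i x) (take j y)) (K + 1))"
  using assms(4,5)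
proof (induction i arbitrary: \<delta>)
  case 0 then show ?case by auto
next
  case (Suc i)
  note IHi = Suc.IH
  from Suc.prems show ?case
  proof (induction \<delta>)
    case 0
    have "K + 1 \<le> ED (take (Suc i) x) (take j y)" if "Suc i = K + 1 + j" for j
      using ED_length(1)[of "take (Suc i) x" "take j y"] 0 that by simp
    then show ?case by (auto simp: min_def)
  next
    case (Suc \<delta>)
    show ?case
    proof (cases "\<delta> = 2 * K + 1")
      case True
      have "K + 1 \<le> ED (take (Suc i) x) (take j y)" if "Suc i + Suc \<delta> = K + 1 + j" "j \<le> length y" for j
        using ED_length(2)[of "take j y" "take (Suc i) x"] Suc.prems that True by simp
      then show ?thesis using True by (auto simp: min_def)
    next
      case False
      then have \<delta>: "\<delta> \<le> 2 * K" using Suc.prems by simp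
      note A = IHi[of "Suc \<delta>"] and L = Suc.IH and R = IHi[of "Suc (Suc \<delta>)"]
      have b: "band K M p (Suc i) (Suc \<delta>) =
          min (band K M p i (Suc \<delta>) + of_bool (M (Suc i) \<noteq> M (p - K + Suc i + \<delta>)))
            (min (band K M p (Suc i) \<delta> + 1) (band K M p i (Suc (Suc \<delta>)) + 1))"
        using False by simp
      show ?thesis
      proof (intro conjI impI allI)
        assume "Suc i + Suc \<delta> < K + 1"
        then show "K + 1 \<le> band K M p (Suc i) (Suc \<delta>)"
          unfolding b using A L R Suc.prems \<delta> by (auto simp: min_def)
      next
        fix j assume j: "j \<le> length y" "Suc i + Suc \<delta> = K + 1 + j"
        show "min (band K M p (Suc i) (Suc \<delta>)) (K + 1) =
          min (ED (take (Suc i) x) (take j y)) (K + 1)"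
        proof (cases j)
          case 0
          have "K + 1 \<le> band K M p i (Suc \<delta>)" "K + 1 \<le> band K M p (Suc i) \<delta>"
            using A L Suc.prems \<delta> j 0 by auto
          moreover have "min (band K M p i (Suc (Suc \<delta>))) (K + 1) = min i (K + 1)"
            using R Suc.prems \<delta> j 0 by auto
          moreover have "ED (take (Suc i) x) (take j y) = Suc i" using 0 Suc.prems(1) by simp
          ultimately show ?thesis
            unfolding b using truncated_first_column[of "K + 1"] by presburger
        next
          case (Suc j')
          have a: "min (band K M p i (Suc \<delta>)) (K + 1) = min (ED (take i x) (take j' y)) (K + 1)"
            using A Suc.prems \<delta> j Suc by auto
          have l: "min (band K M p (Suc i) \<delta>) (K + 1) = min (ED (take (Suc i) x) (take j' y)) (K + 1)"
            using L Suc.prems \<delta> j Suc by auto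
          have r: "min (band K M p i (Suc (Suc \<delta>))) (K + 1) = min (ED (take i x) (take j y)) (K + 1)"
            using R Suc.prems \<delta> j by auto
          have "p - K + Suc i + \<delta> = p + 1 + j'" using j Suc assms(3) by simp
          then have M: "M (Suc i) = x ! i" "M (p - K + Suc i + \<delta>) = y ! j'"
            using assms(1,2) Suc.prems(1) j(1) Suc by (simp, metis Suc_le_eq)
          have "take (Suc i) x = take i x @ [x ! i]" "take j y = take j' y @ [y ! j']"
            using Suc.prems(1) j(1) Suc by (simp_all add: take_Suc_conv_app_nth)
          then have "ED (take (Suc i) x) (take j y) =
              min (ED (take i x) (take j' y) + of_bool (x ! i \<noteq> y ! j'))
                (min (ED (take i x) (take j y) + 1) (ED (take (Suc i) x) (take j' y) + 1))"
            using ED_snoc_snoc[of "take i x" "x ! i" "take j' y" "y ! j'"] by simp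
          then show ?thesis unfolding b M using truncated_recurrence_cong[OF a l r] by simp
        qed
      qed
    qed
  qed
qed

definition init_loop :: prog where
  "init_loop = While 54 (seq [Op Less 56 53 51, Cond 56 (Copy 57 51) (Op Sub 57 53 51),
     Store 55 57, Op Add 53 53 19, Op Add 55 55 19, Op Sub 54 54 19])"

lemma init_loop:
  assumes "regs s 19 = 1" "regs s 51 = Suc K" "regs s 54 = k" "Suc K < 2 ^ w"
    "regs s 53 + k < 2 ^ w" "regs s 55 + k < 2 ^ w" "regs s 55 + k \<le> m"
  shows "wp w m init_loop s (\<lambda>t s'. t \<le> 8 * k + 1 \<and> tape s' = tape s \<and>
    (\<forall>i<53. regs s' i = regs s i) \<and>
    (\<forall>a. a < regs s 55 \<or> regs s 55 + k \<le> a \<longrightarrow> mem s' a = mem s a) \<and>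
    (\<forall>j<k. mem s' (regs s 55 + j) = band K M p 0 (regs s 53 + j)))"
  using assms
proof (induction k arbitrary: s)
  case 0
  then show ?case by (simp add: init_loop_def wp_While_unfold)
next
  case (Suc k)
  have w: "0 < w" "1 < (2::nat) ^ w" using Suc.prems(4) by (cases w; simp)+
  have IH: "wp w m init_loop u (\<lambda>t s'. t \<le> 8 * k + 1 \<and> tape s' = tape s \<and>
    (\<forall>i<53. regs s' i = regs s i) \<and>
    (\<forall>a. a < regs s 55 \<or> regs s 55 + Suc k \<le> a \<longrightarrow> mem s' a = mem s a) \<and>
    (\<forall>j<Suc k. mem s' (regs s 55 + j) = band K M p 0 (regs s 53 + j)))"
    if "tape u = tape s" "\<forall>i<53. regs u i = regs s i" "regs u 53 = Suc (regs s 53)"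
      "regs u 55 = Suc (regs s 55)" "regs u 54 = k"
      "mem u = (mem s)(regs s 55 := band K M p 0 (regs s 53))" for u
  proof (rule wp_mono[OF Suc.IH[of u]])
    fix t s' assume h: "t \<le> 8 * k + 1 \<and> tape s' = tape u \<and>
      (\<forall>i<53. regs s' i = regs u i) \<and>
      (\<forall>a. a < regs u 55 \<or> regs u 55 + k \<le> a \<longrightarrow> mem s' a = mem u a) \<and>
      (\<forall>j<k. mem s' (regs u 55 + j) = band K M p 0 (regs u 53 + j))"
    have "mem s' (regs s 55 + j) = band K M p 0 (regs s 53 + j)" if "j < Suc k" for j
    proof (cases j)
      case 0
      then show ?thesis using h \<open>regs u 55 = Suc (regs s 55)\<close> \<open>mem u = _\<close> by simp
    next
      case (Suc j')
      then show ?thesis using h \<open>regs u 55 = Suc (regs s 55)\<close> \<open>regs u 53 = Suc (regs s 53)\<close> that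
        by simp
    qed
    then show "t \<le> 8 * k + 1 \<and> tape s' = tape s \<and>
    (\<forall>i<53. regs s' i = regs s i) \<and>
    (\<forall>a. a < regs s 55 \<or> regs s 55 + Suc k \<le> a \<longrightarrow> mem s' a = mem s a) \<and>
    (\<forall>j<Suc k. mem s' (regs s 55 + j) = band K M p 0 (regs s 53 + j))"
      using h that by simp
  qed (use that Suc.prems in auto)
  show ?case
    unfolding init_loop_def
    apply (subst wp_While_unfold)
    apply (simp only: init_loop_def[symmetric])
    using Suc.prems w
    apply simp
    apply (intro conjI impI)
     apply ((rule wp_mono[OF IH]; simp)+)
    done
qed

text \<open>One row of memory suffices: in diagonal coordinates a new cell depends on its own old
  value, on the new value to its left and on the old value to its right, so the row can be updated
  in place from left to right.\<close>

definition cell_loop :: prog where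
  "cell_loop = While 54 (seq [Load 63 62, Op Equal 64 61 63, Load 65 55,
     Cond 64 Skip (Op Add 65 65 19),
     Op Sub 66 55 19, Load 67 66, Op Add 67 67 19,
     Op Less 68 67 65, Cond 68 (Copy 65 67) Skip,
     Op Add 66 55 19, Load 67 66, Op Add 67 67 19,
     Op Less 68 67 65, Cond 68 (Copy 65 67) Skip,
     Store 55 65, Op Add 62 62 19, Op Add 55 55 19, Op Sub 54 54 19])"

lemma cell_loop:
  assumes "regs s 19 = 1" "regs s 61 = M (Suc i)" "regs s 54 = k" "\<delta> + k = 2 * K + 1"
    "regs s 55 = D + Suc \<delta>" "regs s 62 = p - K + Suc i + \<delta>"
    "D + 2 * K + 3 < 2 ^ w" "D + 2 * K + 3 \<le> m" "K + i + 4 < 2 ^ w"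
    "p - K + Suc i + 2 * K + 1 \<le> D"
    "\<forall>a<D. mem s a = M a"
    "\<forall>j\<le>\<delta>. mem s (D + j) = band K M p (Suc i) j"
    "\<forall>j. \<delta> < j \<and> j \<le> 2 * K + 2 \<longrightarrow> mem s (D + j) = band K M p i j"
  shows "wp w m cell_loop s (\<lambda>t s'. t \<le> 22 * k + 1 \<and> tape s' = tape s \<and>
    (\<forall>i<54. regs s' i = regs s i) \<and> (\<forall>i\<in>{56..60}. regs s' i = regs s i) \<and>
    (\<forall>a. a < D \<or> D + 2 * K + 2 < a \<longrightarrow> mem s' a = mem s a) \<and>
    (\<forall>j\<le>2 * K + 2. mem s' (D + j) = band K M p (Suc i) j))"
  using assms
proof (induction k arbitrary: s \<delta>)
  case 0
  \<comment> \<open>The loop stops before the right sentinel, whose value \<open>K + 1\<close> is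
    the same in every row.\<close>
  have "mem s (D + j) = band K M p (Suc i) j" if "j \<le> 2 * K + 2" for j
  proof (cases "j = 2 * K + 2")
    case True
    moreover have "band K M p i (2 * K + 2) = Suc K" by (cases i) auto
    moreover have "mem s (D + (2 * K + 2)) = band K M p i (2 * K + 2)"
      using "0.prems"(13)[rule_format, of "2 * K + 2"] "0.prems"(4) by simp
    ultimately show ?thesis by simp
  next
    case False
    then show ?thesis using 0 that by simp
  qed
  then show ?case using 0 by (simp add: cell_loop_def wp_While_unfold)
next
  case (Suc k)
  have w: "0 < w" "1 < (2::nat) ^ w" using Suc.prems(9) by (cases w; simp)+
  let ?A = "mem s (D + Suc \<delta>)" and ?L = "mem s (D + \<delta>)" and ?R = "mem s (D + Suc (Suc \<delta>))"
  have \<delta>: "\<delta> \<le> 2 * K" using Suc.prems(4) by simp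
  have A: "?A = band K M p i (Suc \<delta>)" and L: "?L = band K M p (Suc i) \<delta>"
    and R: "?R = band K M p i (Suc (Suc \<delta>))"
    using Suc.prems(12,13) \<delta> by (auto simp del: add_Suc_right)
  have bnd: "Suc ?A < 2 ^ w" "Suc ?L < 2 ^ w" "Suc ?R < 2 ^ w" "?A < 2 ^ w"
    using band_le[of "Suc \<delta>" K M p i] band_le[of \<delta> K M p "Suc i"] band_le[of "Suc (Suc \<delta>)" K M p i]
      A L R \<delta> Suc.prems(9) by simp_all
  have yp: "p - K + Suc i + \<delta> < D" "p - K + Suc i + \<delta> < m"  "Suc (p - K + Suc i + \<delta>) < 2 ^ w"
    using Suc.prems(7,8,10) \<delta> by linarith+
  have y: "mem s (p - K + Suc i + \<delta>) = M (p - K + Suc i + \<delta>)" using Suc.prems(11) yp(1) by simp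
  have addr: "Suc (Suc (Suc (D + \<delta>))) < 2 ^ w" "Suc (Suc (D + \<delta>)) < m"
    using Suc.prems(7,8) \<delta> by linarith+
  let ?v = "min (?A + of_bool (M (Suc i) \<noteq> M (p - K + Suc i + \<delta>))) (min (?L + 1) (?R + 1))"
  have v: "band K M p (Suc i) (Suc \<delta>) = ?v"
    unfolding A L R using \<delta> by simp
  have IH: "wp w m cell_loop u (\<lambda>t s'. t \<le> 22 * k + 1 \<and> tape s' = tape s \<and>
    (\<forall>i<54. regs s' i = regs s i) \<and> (\<forall>i\<in>{56..60}. regs s' i = regs s i) \<and>
    (\<forall>a. a < D \<or> D + 2 * K + 2 < a \<longrightarrow> mem s' a = mem s a) \<and>
    (\<forall>j\<le>2 * K + 2. mem s' (D + j) = band K M p (Suc i) j))"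
    if "tape u = tape s" "\<forall>i<54. regs u i = regs s i" "\<forall>i\<in>{56..60}. regs u i = regs s i"
      "regs u 61 = M (Suc i)" "regs u 54 = k" "regs u 55 = Suc (Suc (D + \<delta>))"
      "regs u 62 = Suc (p - K + Suc i + \<delta>)"
      "mem u = (mem s)(Suc (D + \<delta>) := ?v)" for u
  proof (rule wp_mono[OF Suc.IH[of u "Suc \<delta>"]])
    show "\<forall>j\<le>Suc \<delta>. mem u (D + j) = band K M p (Suc i) j"
      using that(8) Suc.prems(12) v by (simp add: le_Suc_eq del: band.simps)
    show "\<forall>j. Suc \<delta> < j \<and> j \<le> 2 * K + 2 \<longrightarrow> mem u (D + j) = band K M p i j"
      using that(8) Suc.prems(13) by (simp del: band.simps)
    show "\<forall>a<D. mem u a = M a" using that(8) Suc.prems(11) by simp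
    fix t s' assume h: "t \<le> 22 * k + 1 \<and> tape s' = tape u \<and>
      (\<forall>i<54. regs s' i = regs u i) \<and> (\<forall>i\<in>{56..60}. regs s' i = regs u i) \<and>
      (\<forall>a. a < D \<or> D + 2 * K + 2 < a \<longrightarrow> mem s' a = mem u a) \<and>
      (\<forall>j\<le>2 * K + 2. mem s' (D + j) = band K M p (Suc i) j)"
    moreover have "mem u a = mem s a" if "a < D \<or> D + 2 * K + 2 < a" for a
      using that \<delta> \<open>mem u = _\<close> by auto
    ultimately show "t \<le> 22 * k + 1 \<and> tape s' = tape s \<and>
      (\<forall>i<54. regs s' i = regs s i) \<and> (\<forall>i\<in>{56..60}. regs s' i = regs s i) \<and>
      (\<forall>a. a < D \<or> D + 2 * K + 2 < a \<longrightarrow> mem s' a = mem s a) \<and>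
      (\<forall>j\<le>2 * K + 2. mem s' (D + j) = band K M p (Suc i) j)"
      using that(1-3) by (simp del: band.simps)
  qed (use that(2-7) Suc.prems(1,4-10) in simp_all)
  define q where "q = p - K + Suc i + \<delta>"
  define e :: nat where "e = of_bool (M (Suc i) \<noteq> M q)"
  define r where "r = D + \<delta>"
  note facts = Suc.prems(1-3) w
  have r: "regs s 55 = Suc r" "Suc (Suc (Suc r)) < 2 ^ w" "Suc (Suc r) < m"
    using Suc.prems(5) addr by (simp_all add: r_def)
  have q: "regs s 62 = q" "q < m" "Suc q < 2 ^ w" "mem s q = M q"
    using Suc.prems(6) yp y by (simp_all add: q_def)
  have bnd': "Suc (mem s (Suc r)) < 2 ^ w" "Suc (mem s r) < 2 ^ w" "Suc (mem s (Suc (Suc r))) < 2 ^ w"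
    "mem s (Suc r) < 2 ^ w"
    using bnd by (simp_all add: r_def)
  have k: "Suc k < 2 ^ w" using Suc.prems(4,7) by linarith
  let ?v = "min (mem s (Suc r) + e) (min (mem s r + 1) (mem s (Suc (Suc r)) + 1))"
  have IH': "wp w m cell_loop u (\<lambda>t s'. t \<le> 22 * k + 1 \<and> tape s' = tape s \<and>
    (\<forall>i<54. regs s' i = regs s i) \<and> (\<forall>i\<in>{56..60}. regs s' i = regs s i) \<and>
    (\<forall>a. a < D \<or> D + 2 * K + 2 < a \<longrightarrow> mem s' a = mem s a) \<and>
    (\<forall>j\<le>2 * K + 2. mem s' (D + j) = band K M p (Suc i) j))"
    if "tape u = tape s" "\<forall>i<54. regs u i = regs s i" "\<forall>i\<in>{56..60}. regs u i = regs s i"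
      "regs u 61 = M (Suc i)" "regs u 54 = k" "regs u 55 = Suc (Suc r)"
      "regs u 62 = Suc q" "\<forall>a. a \<noteq> Suc r \<longrightarrow> mem u a = mem s a" "mem u (Suc r) = ?v" for u
  proof (rule IH)
    have "mem u = (mem s)(Suc r := ?v)" using that(8,9) by auto
    then show "mem u = (mem s)(Suc (D + \<delta>) := min (mem s (D + Suc \<delta>) +
        of_bool (M (Suc i) \<noteq> M (p - K + Suc i + \<delta>))) (min (mem s (D + \<delta>) + 1) (mem s (D + Suc (Suc \<delta>)) + 1)))"
      by (simp add: r_def q_def e_def)
    show "regs u 55 = Suc (Suc (D + \<delta>))" "regs u 62 = Suc (p - K + Suc i + \<delta>)"
      using that(6,7) by (simp_all add: r_def q_def)
  qed (use that(1-5) in simp_all)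
  show ?case
    unfolding cell_loop_def
    apply (subst wp_While_unfold)
    apply (simp only: cell_loop_def[symmetric])
    using facts r q bnd' k
    apply (cases "M (Suc i) = M q"; cases "mem s r + 1 < mem s (Suc r) + e"; cases "mem s (Suc (Suc r)) + 1 < min (mem s r + 1) (mem s (Suc r) + e)")
    apply (simp_all add: e_def del: band.simps)
    apply ((rule wp_mono[OF IH']; simp add: e_def del: band.simps)+)
    done
qed

definition row_loop :: prog where
  "row_loop = While 58 (seq [Op Add 59 59 19, Op Add 60 60 19, Load 61 59, Copy 62 60,
     Op Add 55 18 19, Op Sub 54 52 19, cell_loop, Op Sub 58 58 19])"

lemma row_loop:
  assumes "regs s 19 = 1" "regs s 18 = D" "regs s 52 = 2 * K + 2" "regs s 58 = k"
    "regs s 59 = i" "regs s 60 = p - K + i"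
    "D + 2 * K + 3 < 2 ^ w" "D + 2 * K + 3 \<le> m"
    "K + i + k + 4 < 2 ^ w" "p - K + i + k + 2 * K + 1 \<le> D" "i + k < D"
    "\<forall>a<D. mem s a = M a"
    "\<forall>j\<le>2 * K + 2. mem s (D + j) = band K M p i j"
  shows "wp w m row_loop s (\<lambda>t s'. t \<le> k * (22 * (2 * K + 1) + 9) + 1 \<and> tape s' = tape s \<and>
    (\<forall>i<54. regs s' i = regs s i) \<and>
    (\<forall>a. a < D \<or> D + 2 * K + 2 < a \<longrightarrow> mem s' a = mem s a) \<and>
    (\<forall>j\<le>2 * K + 2. mem s' (D + j) = band K M p (i + k) j))"
  using assms
proof (induction k arbitrary: s i)
  case 0
  then show ?case by (simp add: row_loop_def wp_While_unfold del: band.simps)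
next
  case (Suc k)
  define q where "q = p - K + i"
  have w: "0 < w" "1 < (2::nat) ^ w" using Suc.prems(9) by (cases w; simp)+
  have bd: "Suc i < 2 ^ w" "Suc i < m" "Suc q < 2 ^ w" "Suc D < 2 ^ w" "2 * K + 2 < 2 ^ w" "Suc k < 2 ^ w"
      "q + k + 2 * K + 2 \<le> D" "q + k < 2 ^ w"
    using Suc.prems(7-11) by (simp_all add: q_def)
  have step: "wp w m cell_loop u (\<lambda>t s'. t \<le> 22 * (2 * K + 1) + 1 \<and> tape s' = tape s \<and>
      (\<forall>i<54. regs s' i = regs u i) \<and> (\<forall>i\<in>{56..60}. regs s' i = regs u i) \<and>
      (\<forall>a. a < D \<or> D + 2 * K + 2 < a \<longrightarrow> mem s' a = mem s a) \<and>
      (\<forall>j\<le>2 * K + 2. mem s' (D + j) = band K M p (Suc i) j))"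
    if "mem u = mem s" "tape u = tape s" "\<forall>i<54. regs u i = regs s i" "regs u 61 = M (Suc i)"
      "regs u 54 = Suc (2 * K)" "regs u 55 = Suc D" "regs u 62 = Suc q" for u
  proof (rule wp_mono[OF cell_loop[of u M i "2 * K + 1" 0 K D p w m]])
    show "p - K + Suc i + 2 * K + 1 \<le> D" "K + i + 4 < 2 ^ w" using Suc.prems(9,10) by linarith+
    show "\<forall>j\<le>0. mem u (D + j) = band K M p (Suc i) j"
      using Suc.prems(13) that(1) by (cases i) auto
    show "\<forall>j. 0 < j \<and> j \<le> 2 * K + 2 \<longrightarrow> mem u (D + j) = band K M p i j"
      using Suc.prems(13) that(1) by (simp del: band.simps)
  qed (use that Suc.prems(1,7,8,12) in \<open>simp_all add: q_def del: band.simps\<close>)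
  have IH: "wp w m row_loop u (\<lambda>t s'. t \<le> k * (22 * (2 * K + 1) + 9) + 1 \<and> tape s' = tape s \<and>
    (\<forall>i<54. regs s' i = regs s i) \<and>
    (\<forall>a. a < D \<or> D + 2 * K + 2 < a \<longrightarrow> mem s' a = mem s a) \<and>
    (\<forall>j\<le>2 * K + 2. mem s' (D + j) = band K M p (i + Suc k) j))"
    if "tape u = tape s" "\<forall>i<54. regs u i = regs s i" "regs u 58 = k"
      "regs u 59 = Suc i" "regs u 60 = Suc q"
      "\<forall>a. a < D \<or> D + 2 * K + 2 < a \<longrightarrow> mem u a = mem s a"
      "\<forall>j\<le>2 * K + 2. mem u (D + j) = band K M p (Suc i) j" for u
  proof (rule wp_mono[OF Suc.IH[of u "Suc i"]])
    show "K + Suc i + k + 4 < 2 ^ w" "p - K + Suc i + k + 2 * K + 1 \<le> D" "Suc i + k < D"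
      using Suc.prems(9-11) by linarith+
  qed (use that Suc.prems(1-3,7,8,12) in \<open>simp_all add: q_def del: band.simps\<close>)
  have x: "mem s (Suc i) = M (Suc i)" using Suc.prems(11,12) by simp
  show ?case
    unfolding row_loop_def
    apply (subst wp_While_unfold)
    apply (simp only: row_loop_def[symmetric])
    using Suc.prems(1-5) Suc.prems(6)[folded q_def] w bd x
    apply (simp del: band.simps)
    apply (rule wp_mono[OF step]; simp del: band.simps)
    apply (rule wp_mono[OF IH]; simp del: band.simps)
    done
qed

text \<open>The distance of the whole strings sits in row \<open>length x\<close> on the diagonal
  \<open>length y + K + 1 - length x\<close>. If that lies outside the band, the lengths alone
  differ by more than \<open>K\<close>, and the candidate is rejected.\<close>

definition verify :: prog where
  "verify = seq [Op Add 51 15 19, Op Add 52 51 51, Const 53 0, Copy 55 18, Op Add 54 52 19, init_loop,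
     Const 59 0, Load 58 59, Op Sub 60 23 15, row_loop,
     Load 61 23, Const 59 0, Load 62 59, Op Add 63 61 51, Op Less 64 63 62,
     Cond 64 (Const 50 0) (seq [Op Sub 63 63 62, Op Less 64 52 63,
       Cond 64 (Const 50 0) (seq [Op Add 63 63 18, Load 65 63, Op Less 50 65 51])])]"

lemma verify:
  assumes "regs s 19 = 1" "regs s 15 = K" "regs s 18 = D" "regs s 23 = p"
    "holds_string (mem s) 0 x" "holds_string (mem s) p y" "length x \<le> d" "length y \<le> d"
    "K \<le> d" "d < p" "p + 2 * d + 2 \<le> D" "D + 2 * K + 3 < 2 ^ w" "D + 2 * K + 3 \<le> m"
  shows "wp w m verify s (\<lambda>t s'. t \<le> d * (22 * (2 * K + 1) + 9) + 16 * K + 60 \<and> tape s' = tape s \<and>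
    (\<forall>i<50. regs s' i = regs s i) \<and>
    (\<forall>a. a < D \<or> D + 2 * K + 2 < a \<longrightarrow> mem s' a = mem s a) \<and>
    regs s' 50 = of_bool (ED x y \<le> K))"
proof -
  define n where "n = length x"
  define M where "M = mem s"
  have M: "M 0 = n" "\<forall>i<n. M (Suc i) = x ! i" "M p = length y" "\<forall>j<length y. M (p + 1 + j) = y ! j"
    using assms(5,6) by (simp_all add: holds_string_def n_def M_def)
  have w: "0 < w" "1 < (2::nat) ^ w" using assms(12) by (cases w; simp)+
  define q where "q = p - K"
  have q: "q + K = p" "K \<le> p" using assms(9,10) by (simp_all add: q_def)
  have bd: "Suc K < 2 ^ w" "2 * K + 3 < 2 ^ w" "D < 2 ^ w" "0 < m" "p < m" "p < 2 ^ w" "n < 2 ^ w"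
      "length y + K + 1 < 2 ^ w" "D + 2 * K + 3 < 2 ^ w" "n \<le> d"
      "0 < D" "p < D" "D + 2 * K + 3 \<le> m"
    using assms(7-13) by (simp_all add: n_def)
  have init: "wp w m init_loop u (\<lambda>t s'. t \<le> 8 * (2 * K + 3) + 1 \<and> tape s' = tape s \<and>
      (\<forall>i<53. regs s' i = regs u i) \<and>
      (\<forall>a. a < D \<or> D + 2 * K + 2 < a \<longrightarrow> mem s' a = M a) \<and>
      (\<forall>j\<le>2 * K + 2. mem s' (D + j) = band K M p 0 j))"
    if "mem u = M" "tape u = tape s" "regs u 19 = 1" "regs u 51 = Suc K" "regs u 53 = 0" "regs u 55 = D"
      "regs u 54 = 2 * K + 3" for u
    by (rule wp_mono[OF init_loop[of u K "2 * K + 3" w m M p]])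
      (use that assms(12,13) bd in \<open>auto simp del: band.simps\<close>)
  have row: "wp w m row_loop u (\<lambda>t s'. t \<le> d * (22 * (2 * K + 1) + 9) + 1 \<and> tape s' = tape s \<and>
      (\<forall>i<54. regs s' i = regs u i) \<and>
      (\<forall>a. a < D \<or> D + 2 * K + 2 < a \<longrightarrow> mem s' a = M a) \<and>
      (\<forall>j\<le>2 * K + 2. mem s' (D + j) = band K M p n j))"
    if "tape u = tape s" "regs u 19 = 1" "regs u 18 = D" "regs u 52 = 2 * K + 2" "regs u 58 = n"
      "regs u 59 = 0" "regs u 60 = q" "\<forall>a. a < D \<or> D + 2 * K + 2 < a \<longrightarrow> mem u a = M a"
      "\<forall>j\<le>2 * K + 2. mem u (D + j) = band K M p 0 j" for u
  proof (rule wp_mono[OF row_loop[of u D K n 0 p w m M]])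
    show "D + 2 * K + 3 < 2 ^ w" "D + 2 * K + 3 \<le> m" by fact+
    show "K + 0 + n + 4 < 2 ^ w" "p - K + 0 + n + 2 * K + 1 \<le> D" "0 + n < D"
      using assms(7-13) bd(10) by linarith+
    fix t s'
    have "n * (22 * (2 * K + 1) + 9) \<le> d * (22 * (2 * K + 1) + 9)" using bd(10) by (rule mult_le_mono1)
    then have t: "t \<le> n * (22 * (2 * K + 1) + 9) + 1 \<Longrightarrow> t \<le> d * (22 * (2 * K + 1) + 9) + 1" by linarith
    show "t \<le> n * (22 * (2 * K + 1) + 9) + 1 \<and> tape s' = tape u \<and>
      (\<forall>i<54. regs s' i = regs u i) \<and>
      (\<forall>a. a < D \<or> D + 2 * K + 2 < a \<longrightarrow> mem s' a = mem u a) \<and>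
      (\<forall>j\<le>2 * K + 2. mem s' (D + j) = band K M p (0 + n) j) \<Longrightarrow>
      t \<le> d * (22 * (2 * K + 1) + 9) + 1 \<and> tape s' = tape s \<and>
      (\<forall>i<54. regs s' i = regs u i) \<and>
      (\<forall>a. a < D \<or> D + 2 * K + 2 < a \<longrightarrow> mem s' a = M a) \<and>
      (\<forall>j\<le>2 * K + 2. mem s' (D + j) = band K M p n j)"
      by (elim conjE, intro conjI t) (use that(1,8) in \<open>simp_all del: band.simps\<close>)
  qed (use that in \<open>simp_all add: q_def del: band.simps\<close>)
  have ED: "\<not> length y + Suc K < n \<Longrightarrow> \<not> 2 * K + 2 < length y + Suc K - n \<Longrightarrow>
      band K M p n (length y + Suc K - n) < Suc K \<longleftrightarrow> ED x y \<le> K"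
  proof -
    assume h: "\<not> length y + Suc K < n" "\<not> 2 * K + 2 < length y + Suc K - n"
    have "min (band K M p n (length y + Suc K - n)) (K + 1) =
        min (ED (take n x) (take (length y) y)) (K + 1)"
      using band_ED[of x M y p K n "length y + Suc K - n"] M q(2) h by (auto simp: n_def)
    then show "band K M p n (length y + Suc K - n) < Suc K \<longleftrightarrow> ED x y \<le> K"
      by (auto simp: n_def min_def split: if_splits)
  qed
  have ED': "length y + Suc K < n \<Longrightarrow> \<not> ED x y \<le> K" "2 * K + 2 < length y + Suc K - n \<Longrightarrow> \<not> ED x y \<le> K"
    using ED_length[of x y] ED_length[of y x] by (auto simp: n_def ED_sym)
  note M' = M(1,3)[unfolded M_def]
  define z :: nat where "z = of_bool (ED x y \<le> K)"
  define \<delta> where "\<delta> = length y + Suc K - n"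
  consider (short) "length y + Suc K < n" "z = 0"
    | (long) "n + \<delta> = length y + Suc K" "2 * K + 2 < \<delta>" "z = 0"
    | (band) "n + \<delta> = length y + Suc K" "\<delta> \<le> 2 * K + 2"
        "z = of_bool (band K (mem s) p n \<delta> < Suc K)"
    using ED ED' by (fastforce simp: z_def \<delta>_def M_def)
  note cases = this
  have \<delta>: "n + \<delta> = Suc (length y + K) \<Longrightarrow> Suc (length y + K) - n = \<delta>"
    "n + \<delta> = Suc (length y + K) \<Longrightarrow> Suc (D + (length y + K)) - n = D + \<delta>"
    by simp_all
  show ?thesis
    unfolding verify_def z_def[symmetric] using assms(1-4) w bd q(2)
    apply (simp del: band.simps)
    apply (rule wp_mono[OF init]; simp add: M_def del: band.simps)
     apply (simp add: M' del: band.simps)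
    apply (rule wp_mono[OF row]; simp add: M_def q_def M' del: band.simps)
    apply (rule cases)
      apply (simp_all add: add.commute[of _ D] del: band.simps)
     apply (simp_all add: \<delta> del: band.simps)
    done
qed

section \<open>Hash tables\<close>

text \<open>The value 0 means that there is none. As strings are inserted in increasing order at the
  front of their chain, bucket heads and links are both of this form.\<close>

fun last_index :: "(nat \<Rightarrow> bool) \<Rightarrow> nat \<Rightarrow> nat" where
  "last_index P 0 = 0"
| "last_index P (Suc j) = (if P (Suc j) then Suc j else last_index P j)"

lemma last_index_le: "last_index P j \<le> j"
  by (induction j) auto

lemma last_index_holds: "last_index P j \<noteq> 0 \<Longrightarrow> P (last_index P j)"
  by (induction j) auto

lemma last_index_greatest: "last_index P j < i \<Longrightarrow> i \<le> j \<Longrightarrow> \<not> P i"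
  by (induction j) (auto simp: le_Suc_eq split: if_splits)

text \<open>One loop instead of nested ones: a nonzero register 24 is the candidate to verify;
  otherwise the next table is opened, if register 22 has one left. Register 25 is the budget of
  false candidates, register 26 the flag to go on.\<close>

definition query_loop :: prog where
  "query_loop = While 26 (Cond 24
     (seq [Op Add 28 1 19, Op Mul 23 24 28, verify, Op Sub 25 25 19,
        Cond 50 (seq [Copy 0 23, Const 26 0]) (seq [Op Add 28 27 24, Load 24 28, Copy 26 25])])
     (Cond 22
       (seq [hash, Op Add 28 20 17, Op Add 27 28 13, Op Add 28 28 40, Load 24 28,
          Op Add 20 27 5, Op Add 20 20 19, Op Sub 22 22 19])
       (Const 26 0)))"

text \<open>A nonzero register 6 marks the trivial case, in which the first database string, at
  address \<open>d + 1\<close>, is always an answer.\<close>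

definition query :: prog where
  "query = Cond 6 (Op Add 0 1 19)
     (seq [Const 21 0, Copy 20 16, Copy 22 12, Const 24 0, Copy 25 14, Const 26 1, query_loop])"

text \<open>Query and strings lie below \<open>D\<close>, the row of the band at \<open>D\<close>,
  and from \<open>TB\<close> on the tables, each made of seed, bucket heads and links. The factor
  \<open>n + 2\<close> leaves \<open>d + 1\<close> free cells after the last string, because the
  band may read past its end; the 1 in \<open>stride\<close> comes from numbering links from
  1.\<close>

locale tables =
  fixes w m n d B T th R Nb L K :: nat
    and S :: "nat list list" and seeds :: "nat \<Rightarrow> nat list"
    and D TB SL stride :: nat
  defines "D \<equiv> (n + 2) * (d + 1)"
    and "TB \<equiv> D + 2 * d + 3"
    and "SL \<equiv> T * Suc B"
    and "stride \<equiv> SL + Nb + n + 1"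
  assumes m: "TB + R * stride \<le> m" "m < 2 ^ w"
    and n: "length S = n" and S: "\<And>x. x \<in> set S \<Longrightarrow> length x \<le> d \<and> fits B x"
    and B: "2 ^ B < (2::nat) ^ w" "2 < B"
    and K: "K < d" and Nb: "0 < Nb" and L: "0 < L" "L < 2 ^ w" and T: "T < 2 ^ w" and R: "R < 2 ^ w"
    and seeds: "\<And>k. k < R \<Longrightarrow> seeds k \<in> tapes w SL"
begin

definition bucket :: "nat \<Rightarrow> nat list \<Rightarrow> nat" where
  "bucket k x = fprint B th T x (seeds k) mod Nb"

text \<open>Database strings are numbered from 1, and 0 ends a chain.\<close>

definition str :: "nat \<Rightarrow> nat list" where
  "str j = S ! (j - 1)"

definition table :: "nat \<Rightarrow> nat" where
  "table k = TB + k * stride"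

definition mem_ok :: "(nat \<Rightarrow> nat) \<Rightarrow> bool" where
  "mem_ok M \<longleftrightarrow> (\<forall>j\<in>{1..n}. holds_string M (j * (d + 1)) (str j)) \<and>
     (\<forall>k<R. seg M (table k) SL = seeds k \<and>
       (\<forall>b<Nb. M (table k + SL + b) = last_index (\<lambda>j. bucket k (str j) = b) n) \<and>
       (\<forall>j\<in>{1..n}. M (table k + SL + Nb + j) =
          last_index (\<lambda>i. bucket k (str i) = bucket k (str j)) (j - 1)))"

definition regs_ok :: "(nat \<Rightarrow> nat) \<Rightarrow> bool" where
  "regs_ok r \<longleftrightarrow> r 1 = d \<and> r 5 = n \<and> r 6 = 0 \<and> r 9 = B \<and> r 10 = T \<and> r 11 = th \<and> r 12 = R \<and>
     r 13 = Nb \<and> r 14 = L \<and> r 15 = K \<and> r 16 = TB \<and> r 17 = SL \<and> r 18 = D \<and> r 19 = 1"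

lemma table_bounds:
  assumes "k < R"
  shows "table k + SL + Nb + n < m" "table (Suc k) = table k + SL + Nb + n + 1" "table (Suc k) \<le> m"
proof -
  have "table (Suc k) = table k + stride" by (simp add: table_def)
  then show 1: "table (Suc k) = table k + SL + Nb + n + 1" by (simp add: stride_def)
  have "Suc k * stride \<le> R * stride" using assms by (intro mult_le_mono1) simp
  then show 2: "table (Suc k) \<le> m" using m(1) by (simp add: table_def)
  show "table k + SL + Nb + n < m" using 1 2 by simp
qed

lemma str_bounds:
  assumes "j \<in> {1..n}"
  shows "d < j * (d + 1)" "j * (d + 1) + 2 * d + 2 \<le> D" "length (str j) \<le> d" "fits B (str j)" "str j \<in> set S"
proof -
  show "str j \<in> set S" using assms n by (auto simp: str_def)
  then show "length (str j) \<le> d" "fits B (str j)" using S by blast+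
  have "1 * (d + 1) \<le> j * (d + 1)" using assms by (intro mult_le_mono1) simp
  then show "d < j * (d + 1)" by simp
  have "j * (d + 1) \<le> n * (d + 1)" using assms by (intro mult_le_mono1) simp
  then show "j * (d + 1) + 2 * d + 2 \<le> D" by (simp add: D_def)
qed

text \<open>A query changes only the query cells and the band, so the data structure survives for
  the queries that follow.\<close>

lemma mem_ok_cong:
  assumes "mem_ok M" "\<And>a. d < a \<Longrightarrow> a < D \<or> TB \<le> a \<Longrightarrow> M' a = M a"
  shows "mem_ok M'"
proof -
  have "holds_string M' (j * (d + 1)) (str j)" if j: "j \<in> {1..n}" for j
  proof -
    have "holds_string M (j * (d + 1)) (str j)" using assms(1) j unfolding mem_ok_def by blast
    moreover have "M' (j * (d + 1) + i) = M (j * (d + 1) + i)" if "i \<le> d" for i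
      using str_bounds(1,2)[OF j] that by (intro assms(2)) auto
    ultimately show ?thesis using str_bounds(3)[OF j] unfolding holds_string_def
      by (metis Nat.add_0_right Suc_eq_plus1 Suc_leI add.assoc add.commute le0 order_less_le_trans)
  qed
  moreover have M': "M' (table k + i) = M (table k + i)" for k i
    using K by (intro assms(2)) (auto simp: table_def TB_def)
  then have "seg M' (table k) SL = seg M (table k) SL" for k
    by (intro seg_cong) (metis le_add_diff_inverse)
  ultimately show ?thesis using assms(1) M' unfolding mem_ok_def
    by (simp add: add.assoc)
qed

section \<open>Scanning the tables for one query\<close>

context
  fixes q :: "nat list"
begin

text \<open>The candidates already rejected when \<open>k\<close> tables have been opened and the
  scan of the last one stands at \<open>c\<close>: chains descend, so there the indices above
  \<open>c\<close> have been passed.\<close>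

definition hits :: "nat \<Rightarrow> nat \<Rightarrow> (nat \<times> nat) set" where
  "hits k c = {(k', j). k' < k \<and> j \<in> {1..n} \<and> bucket k' (str j) = bucket k' q \<and> (Suc k' = k \<longrightarrow> c < j)}"

text \<open>Depends on seeds and strings alone and not on a run, so that its probability can be
  computed: no candidate is near, or there are enough false ones to exhaust the budget.\<close>

definition failed :: bool where
  "failed \<longleftrightarrow> (\<forall>(k, j)\<in>hits R 0. K < ED q (str j)) \<or>
     L \<le> card {(k, j)\<in>hits R 0. K < ED q (str j)}"

definition running :: "nat \<Rightarrow> nat \<Rightarrow> nat \<Rightarrow> bool" where
  "running k c tok \<longleftrightarrow> k \<le> R \<and> c \<le> n \<and>
     (c \<noteq> 0 \<longrightarrow> 0 < k \<and> bucket (k - 1) (str c) = bucket (k - 1) q) \<and>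
     (\<forall>(k', j)\<in>hits k c. K < ED q (str j)) \<and> tok + card (hits k c) = L"

lemma finite_hits: "finite (hits k c)"
  by (rule finite_subset[of _ "{..<k} \<times> {1..n}"]) (auto simp: hits_def)

lemma running_init: "running 0 0 L"
  by (auto simp: running_def hits_def)

lemma running_open:
  assumes "running k 0 tok" "k < R"
  shows "running (Suc k) (last_index (\<lambda>j. bucket k (str j) = bucket k q) n) tok"
proof -
  let ?c = "last_index (\<lambda>j. bucket k (str j) = bucket k q) n"
  have "hits (Suc k) ?c = hits k 0"
    using last_index_greatest[of "\<lambda>j. bucket k (str j) = bucket k q" n]
    by (auto simp: hits_def less_Suc_eq)
  then show ?thesis using assms last_index_le[of "\<lambda>j. bucket k (str j) = bucket k q" n]
      last_index_holds[of "\<lambda>j. bucket k (str j) = bucket k q" n]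
    by (simp add: running_def)
qed

text \<open>A link leads to the largest smaller index in the same bucket, so following it adds
  exactly the rejected candidate to the hits and takes one token.\<close>

lemma running_next:
  assumes "running k c tok" "c \<noteq> 0" "K < ED q (str c)" "tok \<noteq> 0"
  shows "running k (last_index (\<lambda>i. bucket (k - 1) (str i) = bucket (k - 1) (str c)) (c - 1)) (tok - 1)"
proof -
  let ?P = "\<lambda>i. bucket (k - 1) (str i) = bucket (k - 1) (str c)"
  let ?c = "last_index ?P (c - 1)"
  have k: "0 < k" "bucket (k - 1) (str c) = bucket (k - 1) q" "c \<le> n" "k \<le> R"
    using assms(1,2) by (auto simp: running_def)
  have c': "?c < c" using last_index_le[of ?P "c - 1"] assms(2) by linarith
  have "(k', i) \<in> hits k ?c \<longleftrightarrow> (k', i) \<in> insert (k - 1, c) (hits k c)" for k' i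
  proof (cases "k' = k - 1")
    case True
    have "?c < i \<longleftrightarrow> c \<le> i" if "?P i"
      using last_index_greatest[of ?P "c - 1" i] that c' assms(2) by linarith
    then show ?thesis using True k assms(2) by (auto simp: hits_def)
  next
    case False
    then show ?thesis using k(1) by (auto simp: hits_def)
  qed
  then have H: "hits k ?c = insert (k - 1, c) (hits k c)" by auto
  moreover have "(k - 1, c) \<notin> hits k c" using k by (auto simp: hits_def)
  ultimately have "card (hits k ?c) = Suc (card (hits k c))" using finite_hits by simp
  moreover have "?c \<noteq> 0 \<longrightarrow> bucket (k - 1) (str ?c) = bucket (k - 1) q"
    using last_index_holds[of ?P "c - 1"] k(2) by simp
  moreover have "\<forall>(k', j)\<in>hits k ?c. K < ED q (str j)"
    unfolding H using assms(1,3) by (simp add: running_def)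
  ultimately show ?thesis using assms k c' unfolding running_def by linarith
qed

text \<open>Without tokens there are \<open>L\<close> far hits; without tables all hits have been
  seen and were far.\<close>

lemma running_failed:
  assumes "running k c tok" "tok = 0 \<or> k = R \<and> c = 0"
  shows failed
  using assms(2)
proof
  assume "tok = 0"
  have "hits k c \<subseteq> {(k, j)\<in>hits R 0. K < ED q (str j)}"
    using assms(1) by (auto simp: running_def hits_def)
  then have "card (hits k c) \<le> card {(k, j)\<in>hits R 0. K < ED q (str j)}"
    by (intro card_mono finite_subset[OF _ finite_hits]) auto
  then show failed using assms(1) \<open>tok = 0\<close> by (simp add: running_def failed_def)
next
  assume "k = R \<and> c = 0"
  then show failed using assms(1) by (auto simp: running_def failed_def)
qed

definition outcome :: "nat \<Rightarrow> bool" where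
  "outcome a \<longleftrightarrow> (\<exists>j\<in>{1..n}. a = j * (d + 1) \<and> ED q (str j) \<le> K) \<or> failed"

definition cost_table :: nat where
  "cost_table = T * (7 * B + 25) + 25"

definition cost_string :: nat where
  "cost_string = d * (22 * (2 * K + 1) + 9) + 16 * K + 75"

definition inv :: "state \<Rightarrow> bool" where
  "inv s \<longleftrightarrow> mem_ok (mem s) \<and> regs_ok (regs s) \<and> holds_string (mem s) 0 q \<and> regs s 21 = 0 \<and>
     (if regs s 26 = 0 then outcome (regs s 0) else
       (\<exists>k. running k (regs s 24) (regs s 25) \<and> regs s 25 \<noteq> 0 \<and> regs s 22 = R - k \<and>
         regs s 20 = table k \<and> (regs s 24 \<noteq> 0 \<longrightarrow> regs s 27 = table (k - 1) + SL + Nb)))"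

text \<open>Each unopened table and each remaining token is charged its full cost in advance; the
  last summand pays for ending the scan.\<close>

definition pot :: "state \<Rightarrow> nat" where
  "pot s = regs s 22 * cost_table + regs s 25 * cost_string + (if regs s 26 = 0 then 1 else 6)"

lemma query_loop:
  assumes q: "length q \<le> d" "fits B q" and "inv s"
  shows "wp w m query_loop s (\<lambda>t s'. inv s' \<and> regs s' 26 = 0 \<and> t \<le> pot s)"
  unfolding query_loop_def
proof (rule wp_While[of inv s _ w m _ pot])
  show "inv s" by fact
  show "1 \<le> pot s" for s by (simp add: pot_def)
  fix s assume inv: "inv s" and go: "regs s 26 \<noteq> 0"
  define M where "M = mem s"
  define c where "c = regs s 24"
  define tok where "tok = regs s 25"
  obtain k where k: "running k c tok" "tok \<noteq> 0" "regs s 22 = R - k" "regs s 20 = table k"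
      "c \<noteq> 0 \<longrightarrow> regs s 27 = table (k - 1) + SL + Nb"
    using inv go by (auto simp: inv_def c_def tok_def)
  have mo: "mem_ok M" and ho: "holds_string M 0 q" and z: "regs s 21 = 0"
    and ro: "regs_ok (regs s)"
    using inv by (auto simp: inv_def M_def)
  have r: "regs s 1 = d" "regs s 5 = n" "regs s 9 = B" "regs s 10 = T" "regs s 11 = th" "regs s 13 = Nb"
      "regs s 15 = K" "regs s 17 = SL" "regs s 18 = D" "regs s 19 = 1"
    using ro by (simp_all add: regs_ok_def)
  have rcong: "regs_ok r'" if "\<forall>i<20. 0 < i \<longrightarrow> r' i = regs s i" for r'
    using ro that by (simp add: regs_ok_def)
  have TBm: "TB \<le> m" "D + 2 * d + 3 \<le> m" using m(1) by (simp_all add: TB_def)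
  have w: "1 < (2::nat) ^ w" "0 < w" using m(2) TBm by (cases w; simp)+
  have kR: "k \<le> R" "c \<le> n" and tokL: "tok \<le> L" using k(1) by (simp_all add: running_def)
  show "wp w m (Cond 24
     (seq [Op Add 28 1 19, Op Mul 23 24 28, verify, Op Sub 25 25 19,
        Cond 50 (seq [Copy 0 23, Const 26 0]) (seq [Op Add 28 27 24, Load 24 28, Copy 26 25])])
     (Cond 22
       (seq [hash, Op Add 28 20 17, Op Add 27 28 13, Op Add 28 28 40, Load 24 28,
          Op Add 20 27 5, Op Add 20 20 19, Op Sub 22 22 19])
       (Const 26 0))) s (\<lambda>t s'. inv s' \<and> pot s' + t + 1 \<le> pot s)"
  proof (cases "c = 0")
    case False
    define p where "p = c * (d + 1)"
    have c: "c \<in> {1..n}" using False kR by simp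
    have k0: "0 < k" "k - 1 < R" using k(1) False by (auto simp: running_def)
    note sb = str_bounds[OF c, folded p_def]
    have pw: "p < 2 ^ w" "Suc d < 2 ^ w" using sb(1,2) TBm m(2) by linarith+
    have step: "wp w m verify u (\<lambda>t s'. t \<le> d * (22 * (2 * K + 1) + 9) + 16 * K + 60 \<and> tape s' = tape u \<and>
        (\<forall>i<50. regs s' i = regs u i) \<and> mem_ok (mem s') \<and> holds_string (mem s') 0 q \<and>
        regs s' 50 = of_bool (ED q (str c) \<le> K))"
      if "mem u = M" "\<forall>i<20. regs u i = regs s i" "regs u 23 = p" for u
    proof (rule wp_mono[OF verify[of u K D p q "str c" d]])
      show "holds_string (mem u) p (str c)"
        using mo c that(1) unfolding mem_ok_def p_def by blast
      show "D + 2 * K + 3 < 2 ^ w" "D + 2 * K + 3 \<le> m" using TBm m(2) K by linarith+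
      fix t s' assume h: "t \<le> d * (22 * (2 * K + 1) + 9) + 16 * K + 60 \<and> tape s' = tape u \<and>
        (\<forall>i<50. regs s' i = regs u i) \<and>
        (\<forall>a. a < D \<or> D + 2 * K + 2 < a \<longrightarrow> mem s' a = mem u a) \<and>
        regs s' 50 = of_bool (ED q (str c) \<le> K)"
      have "mem_ok (mem s')"
        by (rule mem_ok_cong[OF mo]) (use h that(1) K in \<open>auto simp: TB_def\<close>)
      moreover have "holds_string (mem s') 0 q"
        using ho h that(1) q(1) sb(1,2) by (simp add: holds_string_def)
      ultimately show "t \<le> d * (22 * (2 * K + 1) + 9) + 16 * K + 60 \<and> tape s' = tape u \<and>
        (\<forall>i<50. regs s' i = regs u i) \<and> mem_ok (mem s') \<and> holds_string (mem s') 0 q \<and>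
        regs s' 50 = of_bool (ED q (str c) \<le> K)" using h by blast
    qed (use that r ho q sb K in \<open>simp_all add: M_def\<close>)
    define c' where "c' = last_index (\<lambda>i. bucket (k - 1) (str i) = bucket (k - 1) (str c)) (c - 1)"
    have nx: "M' (table (k - 1) + SL + Nb + c) = c'" if "mem_ok M'" for M'
      using that c k0 unfolding mem_ok_def c'_def by blast
    have nb: "table (k - 1) + SL + Nb + c < m" using table_bounds(1)[OF k0(2)] kR(2) by linarith
    have pot: "pot s = (R - k) * cost_table + tok * cost_string + 6"
      using go k(3) by (simp add: pot_def tok_def)
    obtain tok' where tok': "tok = Suc tok'" using k(2) by (cases tok) auto
    have tokw: "Suc tok' < 2 ^ w" using tokL L(2) tok' by linarith
    have near: "outcome p" if "ED q (str c) \<le> K"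
      using that c unfolding outcome_def p_def by blast
    have far: "running k c' tok'" if "\<not> ED q (str c) \<le> K"
      using running_next[OF k(1) False] that by (simp add: tok' c'_def)
    have fail: "outcome a" if "\<not> ED q (str c) \<le> K" "tok' = 0" for a
      using running_failed[OF far[OF that(1)]] that(2) by (simp add: outcome_def)
    note kk = k(3,4) k(5)[rule_format, OF False]
    have pc: "c + c * d = p" by (simp add: p_def)
    have g: "0 < regs s 26" "regs s 25 = Suc tok'" "table (k - 1) + SL + Nb + c < 2 ^ w"
      using go tok' nb m(2) by (simp_all add: tok_def)
    note nx = nx[unfolded One_nat_def]
    show ?thesis
      apply (simp add: c_def[symmetric] False r)
      using r(1,10) pw w nb z tokw kk pc g
      apply (simp add: c_def[symmetric])
      apply (rule wp_mono[OF step])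
         apply (simp_all add: M_def)
      apply (cases "ED q (str c) \<le> K")
       apply (simp add: inv_def pot_def near rcong cost_string_def)
      apply (simp add: c_def[symmetric])
      apply (simp add: inv_def pot_def fail rcong nx)
      apply (auto simp: cost_string_def intro!: exI[of _ k] far)
      done
  next
    case True
    note kk = k(3,4)
    have g: "0 < regs s 26" "regs s 25 = tok" "regs s 24 = 0"
      using go True by (simp_all add: tok_def c_def)
    show ?thesis
    proof (cases "k = R")
      case True
      have "outcome (regs s 0)"
        using running_failed[OF k(1)] \<open>c = 0\<close> True by (simp add: outcome_def)
      then show ?thesis
        using g kk True ro mo ho z by (simp add: inv_def pot_def M_def regs_ok_def)
    next
      case False
      then have kR: "k < R" using kR by simp
      note tb = table_bounds[OF kR]
      define bk where "bk = bucket k q"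
      have bk: "bk < Nb" unfolding bk_def bucket_def using Nb by simp
      have sg: "seg M (table k) SL = seeds k" and hd: "M (table k + SL + bk) =
          last_index (\<lambda>j. bucket k (str j) = bucket k q) n"
        using mo kR bk unfolding mem_ok_def bk_def by blast+
      have wd: "M (table k + i) < 2 ^ w" if "i < T * Suc B" for i
      proof -
        have "seg M p' l ! i = M (p' + i)" if "i < l" for p' l i
          using that by (induction l arbitrary: p' i) (auto simp: nth_Cons split: nat.split)
        then have "seeds k ! i = M (table k + i)" using sg that by (metis SL_def)
        moreover have "seeds k ! i \<in> set (seeds k)"
          using seeds[OF kR] that by (intro nth_mem) (simp add: tapes_def SL_def)
        ultimately show ?thesis using seeds[OF kR] by (auto simp: tapes_def)
      qed
      have step: "wp w m hash u (\<lambda>t s'. t \<le> T * (7 * B + 25) + 7 \<and> mem s' = M \<and>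
          tape s' = tape u \<and> (\<forall>i<40. regs s' i = regs u i) \<and> regs s' 40 = bk)"
        if "mem u = M" "regs u = regs s" for u
      proof (rule wp_mono[OF hash[of u B T th w m q]])
        show "regs u 20 + T * Suc B < 2 ^ w" "regs u 20 + T * Suc B \<le> m"
          using tb(1) that(2) kk m(2) by (simp_all add: SL_def)
        show "regs u 21 + length q + 1 < 2 ^ w" "regs u 21 + length q < m"
          using that(2) z q(1) TBm m(2) by (simp_all add: TB_def)
        fix t s' assume "t \<le> T * (7 * B + 25) + 7 \<and> mem s' = mem u \<and> tape s' = tape u \<and>
          (\<forall>i<40. regs s' i = regs u i) \<and>
          regs s' 40 = fprint B th T q (seg (mem u) (regs u 20) (T * Suc B)) mod regs u 13"
        then show "t \<le> T * (7 * B + 25) + 7 \<and> mem s' = M \<and>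
          tape s' = tape u \<and> (\<forall>i<40. regs s' i = regs u i) \<and> regs s' 40 = bk"
          using that kk r sg by (simp add: bk_def bucket_def SL_def)
      qed (use that r B T wd ho z q(2) kk in auto)
      have run: "running (Suc k) (last_index (\<lambda>j. bucket k (str j) = bucket k q) n) tok"
        using running_open[OF _ kR] k(1) \<open>c = 0\<close> by simp
      obtain i where i: "R - k = Suc i" "R - Suc k = i" using kR by (cases "R - k") auto
      have wb: "table k + SL + Nb + n + 1 < 2 ^ w" "table k + SL + bk < m" "Suc i < 2 ^ w"
        using tb m(2) bk R i by linarith+
      show ?thesis
        using r(2,6,8,10) w g kk(1)[unfolded i] kk(2) wb z tb(2) bk
        apply simp
        apply (rule wp_mono[OF step]; simp add: M_def)
        apply (simp add: inv_def pot_def rcong k(2) i)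
        using mo ho run hd tb(2)
        apply (intro conjI exI[of _ "Suc k"])
               apply (simp_all add: M_def cost_table_def i)
        done
    qed
  qed
qed

lemma query:
  assumes q: "length q \<le> d" "fits B q" and s: "mem_ok (mem s)" "regs_ok (regs s)"
  shows "wp w m query (s\<lparr>mem := store_string 0 q (mem s)\<rparr>) (\<lambda>t s'. mem_ok (mem s') \<and> regs_ok (regs s') \<and>
    outcome (regs s' 0) \<and> t \<le> R * cost_table + L * cost_string + 20)"
proof -
  have mo: "mem_ok (store_string 0 q (mem s))"
    by (rule mem_ok_cong[OF s(1)]) (use q(1) in \<open>auto simp: store_string_def\<close>)
  have ho: "holds_string (store_string 0 q (mem s)) 0 q"
    by (auto simp: holds_string_def store_string_def)
  have loop: "wp w m query_loop u (\<lambda>t s'. mem_ok (mem s') \<and> regs_ok (regs s') \<and>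
      outcome (regs s' 0) \<and> t \<le> R * cost_table + L * cost_string + 6)"
    if "mem u = store_string 0 q (mem s)" "regs_ok (regs u)" "regs u 21 = 0" "regs u 20 = TB"
      "regs u 22 = R" "regs u 24 = 0" "regs u 25 = L" "regs u 26 = 1" for u
  proof (rule wp_mono[OF query_loop[OF q]])
    show "inv u"
    proof -
      have "running 0 (regs u 24) (regs u 25) \<and> regs u 25 \<noteq> 0 \<and> regs u 22 = R - 0 \<and>
          regs u 20 = table 0 \<and> (regs u 24 \<noteq> 0 \<longrightarrow> regs u 27 = table (0 - 1) + SL + Nb)"
        using that L(1) running_init by (simp add: table_def)
      then show ?thesis unfolding inv_def using that(1-3,8) mo ho by auto
    qed
    show "inv s' \<and> regs s' 26 = 0 \<and> t \<le> pot u \<Longrightarrow> mem_ok (mem s') \<and> regs_ok (regs s') \<and>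
      outcome (regs s' 0) \<and> t \<le> R * cost_table + L * cost_string + 6" for t s'
      using that by (simp add: inv_def pot_def)
  qed
  have r: "regs s 6 = 0" "regs s 16 = TB" "regs s 12 = R" "regs s 14 = L"
    using s(2) by (simp_all add: regs_ok_def)
  have w: "0 < w" "TB < 2 ^ w"
    using L by (cases w; simp) (use m in linarith)
  have rcong: "regs_ok r'" if "\<forall>i<20. r' i = regs s i" for r'
    using s(2) that by (simp add: regs_ok_def)
  show ?thesis
    unfolding query_def using r w R L(2)
    apply simp
    apply (rule wp_mono[OF loop]; simp add: rcong)
    done
qed

end

end

section \<open>Building the tables\<close>

definition seed_loop :: prog where
  "seed_loop = While 29 (seq [Rand 30, Store 28 30, Op Add 28 28 19, Op Sub 29 29 19])"

lemma seed_loop: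
  assumes "regs s 19 = 1" "regs s 29 = length vs" "regs s 28 = a" "tape s = vs @ rest"
    "a + length vs < 2 ^ w" "a + length vs \<le> m"
  shows "wp w m seed_loop s (\<lambda>t s'. tape s' = rest \<and> regs s' 28 = a + length vs \<and>
    (\<forall>i<28. regs s' i = regs s i) \<and> seg (mem s') a (length vs) = vs \<and>
    (\<forall>b. b < a \<or> a + length vs \<le> b \<longrightarrow> mem s' b = mem s b))"
  using assms
proof (induction vs arbitrary: s a)
  case Nil
  then show ?case by (simp add: seed_loop_def wp_While_unfold)
next
  case (Cons v vs)
  have w: "0 < w" "1 < (2::nat) ^ w" using Cons.prems(5) by (cases w; simp)+
  have IH: "wp w m seed_loop u (\<lambda>t s'. tape s' = rest \<and> regs s' 28 = a + length (v # vs) \<and>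
    (\<forall>i<28. regs s' i = regs s i) \<and> seg (mem s') a (length (v # vs)) = v # vs \<and>
    (\<forall>b. b < a \<or> a + length (v # vs) \<le> b \<longrightarrow> mem s' b = mem s b))"
    if "\<forall>i<28. regs u i = regs s i" "regs u 29 = length vs" "regs u 28 = Suc a" "tape u = vs @ rest"
      "mem u = (mem s)(a := v)" for u
    by (rule wp_mono[OF Cons.IH[of u "Suc a"]]) (use that Cons.prems in auto)
  have l: "Suc (length vs) < 2 ^ w" "Suc a < 2 ^ w" "a < m" using Cons.prems(5,6) by simp_all
  show ?case
    unfolding seed_loop_def
    apply (subst wp_While_unfold)
    apply (simp only: seed_loop_def[symmetric])
    using Cons.prems(1-4) w l
    apply simp
    apply (rule wp_mono[OF IH]; simp)
    done
qed

definition insert_loop :: prog where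
  "insert_loop = While 25 (seq [hash, Op Add 30 28 40, Load 31 30, Op Add 32 27 24, Store 32 31,
     Store 30 24, Op Add 24 24 19, Op Add 21 21 1, Op Add 21 21 19, Op Sub 25 25 19])"

definition build_loop :: prog where
  "build_loop = While 22 (seq [Copy 28 20, Copy 29 17, seed_loop, Op Add 27 28 13, Const 24 1,
     Op Add 21 1 19, Copy 25 5, insert_loop, Op Add 20 27 5, Op Add 20 20 19, Op Sub 22 22 19])"

context tables
begin

definition filled :: "(nat \<Rightarrow> nat) \<Rightarrow> nat \<Rightarrow> nat \<Rightarrow> bool" where
  "filled M k j \<longleftrightarrow> seg M (table k) SL = seeds k \<and>
     (\<forall>b<Nb. M (table k + SL + b) = last_index (\<lambda>i. bucket k (str i) = b) j) \<and>
     (\<forall>i\<in>{1..j}. M (table k + SL + Nb + i) =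
        last_index (\<lambda>i'. bucket k (str i') = bucket k (str i)) (i - 1))"

definition strings_ok :: "(nat \<Rightarrow> nat) \<Rightarrow> bool" where
  "strings_ok M \<longleftrightarrow> (\<forall>j\<in>{1..n}. holds_string M (j * (d + 1)) (str j))"

lemma mem_ok_alt: "mem_ok M \<longleftrightarrow> strings_ok M \<and> (\<forall>k<R. filled M k n)"
  by (simp add: mem_ok_def strings_ok_def filled_def)

lemma strings_ok_cong:
  assumes "strings_ok M" "\<And>a. a < D \<Longrightarrow> M' a = M a"
  shows "strings_ok M'"
  unfolding strings_ok_def
proof
  fix j assume j: "j \<in> {1..n}"
  have "holds_string M (j * (d + 1)) (str j)" using assms(1) j unfolding strings_ok_def by blast
  moreover have eq: "M' (j * (d + 1) + i) = M (j * (d + 1) + i)" if "i \<le> d" for i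
    using str_bounds(2)[OF j] that by (intro assms(2)) linarith
  have "M' (j * (d + 1) + 1 + i) = M (j * (d + 1) + 1 + i)" if "i < length (str j)" for i
    using eq[of "Suc i"] str_bounds(3)[OF j] that by simp
  ultimately show "holds_string M' (j * (d + 1)) (str j)"
    using eq[of 0] unfolding holds_string_def by simp
qed

lemma filled_cong:
  assumes "filled M k n" "\<And>a. table k \<le> a \<Longrightarrow> a < table k + stride \<Longrightarrow> M' a = M a"
  shows "filled M' k n"
proof -
  have "M' (table k + i) = M (table k + i)" if "i < stride" for i
    using that by (intro assms(2)) simp_all
  moreover have "seg M' (table k) SL = seg M (table k) SL"
    by (intro seg_cong assms(2)) (simp_all add: stride_def)
  ultimately show ?thesis
    using assms(1) unfolding filled_def by (simp add: add.assoc stride_def)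
qed

lemma seeds_less:
  assumes "k < R" "seg M (table k) SL = seeds k" "i < T * Suc B"
  shows "M (table k + i) < 2 ^ w"
proof -
  have "seg M p' l ! i = M (p' + i)" if "i < l" for p' l i
    using that by (induction l arbitrary: p' i) (auto simp: nth_Cons split: nat.split)
  then have "seeds k ! i = M (table k + i)" using assms(2,3) by (metis SL_def)
  moreover have "seeds k ! i \<in> set (seeds k)"
    using seeds[OF assms(1)] assms(3) by (intro nth_mem) (simp add: tapes_def SL_def)
  ultimately show ?thesis using seeds[OF assms(1)] by (auto simp: tapes_def)
qed

lemma hash_string:
  assumes "regs_ok (regs s)" "strings_ok (mem s)" "k < R" "seg (mem s) (table k) SL = seeds k"
    "regs s 20 = table k" "j \<in> {1..n}" "regs s 21 = j * (d + 1)"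
  shows "wp w (2 ^ w) hash s (\<lambda>t s'. mem s' = mem s \<and> tape s' = tape s \<and>
    (\<forall>i<40. regs s' i = regs s i) \<and> regs s' 40 = bucket k (str j))"
proof -
  have r: "regs s 9 = B" "regs s 10 = T" "regs s 11 = th" "regs s 13 = Nb" "regs s 19 = 1"
    using assms(1) by (simp_all add: regs_ok_def)
  have tb: "table k + T * Suc B < 2 ^ w"
    using table_bounds(1)[OF assms(3)] m(2) by (simp add: SL_def)
  note sb = str_bounds[OF assms(6)]
  have D: "D < 2 ^ w" using m by (simp add: TB_def)
  have ss: "holds_string (mem s) (j * (d + 1)) (str j)"
    using assms(2,6) unfolding strings_ok_def by blast
  have sd: "\<forall>i<T * Suc B. mem s (table k + i) < 2 ^ w"
    using seeds_less[OF assms(3,4)] by blast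
  have fp: "bucket k (str j) = fprint B th T (str j) (seg (mem s) (table k) (T * Suc B)) mod Nb"
    using assms(4) by (simp add: bucket_def SL_def)
  show ?thesis
  proof (rule wp_mono[OF hash[of s B T th w "2 ^ w" "str j"]])
    show "regs s 21 + length (str j) + 1 < 2 ^ w" "regs s 21 + length (str j) < 2 ^ w"
      using assms(7) sb(2,3) D by linarith+
  qed (use assms(5,7) r tb B T ss sd sb(4) fp in simp_all)
qed

lemma insert_loop:
  assumes "regs_ok (regs s)" "strings_ok (mem s)" "k < R" "filled (mem s) k j" "regs s 20 = table k"
    "regs s 21 = Suc j * (d + 1)" "regs s 24 = Suc j" "regs s 25 = l" "j + l = n"
    "regs s 28 = table k + SL" "regs s 27 = table k + SL + Nb"
  shows "wp w (2 ^ w) insert_loop s (\<lambda>t s'. tape s' = tape s \<and> (\<forall>i<20. regs s' i = regs s i) \<and>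
    regs s' 20 = regs s 20 \<and> regs s' 22 = regs s 22 \<and> regs s' 27 = regs s 27 \<and> filled (mem s') k n \<and>
    (\<forall>a. a < table k + SL \<or> table k + SL + Nb + n < a \<longrightarrow> mem s' a = mem s a))"
  using assms
proof (induction l arbitrary: s j)
  case 0
  then show ?case by (simp add: insert_loop_def wp_While_unfold)
next
  case (Suc l)
  define M where "M = mem s"
  define a where "a = table k + SL"
  define bk where "bk = bucket k (str (Suc j))"
  \<comment> \<open>The old head of the bucket becomes the link of the new string, which becomes the
    head.\<close>
  define M' where "M' = M(a + Nb + Suc j := M (a + bk), a + bk := Suc j)"
  have j: "Suc j \<in> {1..n}" using Suc.prems(9) by simp
  have bk: "bk < Nb" unfolding bk_def bucket_def using Nb by simp
  have tb: "a + Nb + n < 2 ^ w" using table_bounds(1)[OF Suc.prems(3)] m(2) by (simp add: a_def)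
  have fl: "seg M (table k) SL = seeds k" "\<forall>b<Nb. M (a + b) = last_index (\<lambda>i. bucket k (str i) = b) j"
     "\<forall>i\<in>{1..j}. M (a + Nb + i) = last_index (\<lambda>i'. bucket k (str i') = bucket k (str i)) (i - 1)"
    using Suc.prems(4) by (simp_all add: filled_def M_def a_def)
  have DT: "D \<le> table k" by (simp add: table_def TB_def)
  have out: "M' b = M b" if "b < a \<or> a + Nb + n < b" for b
    using that bk j by (auto simp: M'_def)
  have seg': "seg M' (table k) SL = seeds k"
    unfolding fl(1)[symmetric] by (rule seg_cong) (simp add: out a_def)
  have hd': "\<forall>b<Nb. M' (a + b) = last_index (\<lambda>i. bucket k (str i) = b) (Suc j)"
    using fl(2) by (auto simp: M'_def bk_def)
  have nx': "\<forall>i\<in>{1..Suc j}. M' (a + Nb + i) = last_index (\<lambda>i'. bucket k (str i') = bucket k (str i)) (i - 1)"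
    using fl(2,3) bk by (auto simp: M'_def bk_def le_Suc_eq)
  have filled': "filled M' k (Suc j)"
    using seg' hd' nx' by (simp add: filled_def a_def)
  have strings': "strings_ok M'"
    by (rule strings_ok_cong[OF Suc.prems(2)]) (use out DT in \<open>simp add: M_def a_def\<close>)
  have rcong: "regs_ok r'" if "\<forall>i<20. r' i = regs s i" for r'
    using Suc.prems(1) that by (simp add: regs_ok_def)
  have IH: "wp w (2 ^ w) insert_loop u (\<lambda>t s'. tape s' = tape s \<and> (\<forall>i<20. regs s' i = regs s i) \<and>
    regs s' 20 = regs s 20 \<and> regs s' 22 = regs s 22 \<and> regs s' 27 = regs s 27 \<and> filled (mem s') k n \<and>
    (\<forall>a. a < table k + SL \<or> table k + SL + Nb + n < a \<longrightarrow> mem s' a = mem s a))"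
    if "tape u = tape s" "\<forall>i<20. regs u i = regs s i" "regs u 20 = table k" "regs u 22 = regs s 22"
      "regs u 21 = Suc (Suc j) * (d + 1)" "regs u 24 = Suc (Suc j)" "regs u 25 = l"
      "regs u 28 = a" "regs u 27 = a + Nb" "mem u = M'" for u
  proof (rule wp_mono[OF Suc.IH[of u "Suc j"]])
    show "regs_ok (regs u)" using that(2) by (rule rcong)
    show "Suc j + l = n" using Suc.prems(9) by simp
    fix t s' assume "tape s' = tape u \<and> (\<forall>i<20. regs s' i = regs u i) \<and>
      regs s' 20 = regs u 20 \<and> regs s' 22 = regs u 22 \<and> regs s' 27 = regs u 27 \<and> filled (mem s') k n \<and>
      (\<forall>a. a < table k + SL \<or> table k + SL + Nb + n < a \<longrightarrow> mem s' a = mem u a)"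
    then show "tape s' = tape s \<and> (\<forall>i<20. regs s' i = regs s i) \<and>
      regs s' 20 = regs s 20 \<and> regs s' 22 = regs s 22 \<and> regs s' 27 = regs s 27 \<and> filled (mem s') k n \<and>
      (\<forall>a. a < table k + SL \<or> table k + SL + Nb + n < a \<longrightarrow> mem s' a = mem s a)"
      using that Suc.prems(5,11) out by (simp add: M_def a_def)
  qed (use that Suc.prems(3) strings' filled' in \<open>simp_all add: a_def\<close>)
  have step: "wp w (2 ^ w) hash u (\<lambda>t s'. mem s' = M \<and> tape s' = tape s \<and>
      (\<forall>i<40. regs s' i = regs s i) \<and> regs s' 40 = bk)"
    if "u = s" for u
    unfolding that
    by (rule wp_mono[OF hash_string[of s k "Suc j"]])
      (use Suc.prems j fl(1) in \<open>simp_all add: M_def bk_def\<close>)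
  have r: "regs s 1 = d" "regs s 19 = 1" using Suc.prems(1) by (simp_all add: regs_ok_def)
  have "Suc (Suc j) * (d + 1) \<le> (n + 1) * (d + 1)" using j by (intro mult_le_mono1) simp
  also have "\<dots> \<le> D" unfolding D_def by (intro mult_le_mono1) simp
  also have "\<dots> < 2 ^ w" using m by (simp add: TB_def)
  finally have ad: "Suc (Suc j) * (d + 1) < 2 ^ w" .
  have wb: "0 < w" "Suc (Suc j) < 2 ^ w" "a + bk < 2 ^ w" "a + Nb + Suc j < 2 ^ w" "Suc l < 2 ^ w"
    using tb bk j Nb Suc.prems(9) by (cases w; simp)+
  have bne: "bk \<noteq> Nb + Suc j" using bk by simp
  show ?case
    unfolding insert_loop_def
    apply (subst wp_While_unfold)
    apply (simp only: insert_loop_def[symmetric])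
    using r Suc.prems(5-8,10,11)[folded a_def] wb ad
    apply simp
    apply (rule wp_mono[OF step]; simp)
    apply (rule wp_mono[OF IH]; simp add: M'_def bne)
    done
qed

lemma build_loop:
  assumes "regs_ok (regs s)" "strings_ok (mem s)" "\<forall>k'<k. filled (mem s) k' n"
    "\<forall>a\<ge>table k. mem s a = 0" "regs s 20 = table k" "regs s 22 = l" "k + l = R"
    "tape s = concat (map seeds [k..<R])"
  shows "wp w (2 ^ w) build_loop s (\<lambda>t s'. mem_ok (mem s') \<and> (\<forall>i<20. regs s' i = regs s i))"
  using assms
proof (induction l arbitrary: s k)
  case 0
  then show ?case by (simp add: build_loop_def wp_While_unfold mem_ok_alt)
next
  case (Suc l)
  have k: "k < R" using Suc.prems(7) by simp
  have tape: "tape s = seeds k @ concat (map seeds [Suc k..<R])"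
    using Suc.prems(8) k by (simp add: upt_conv_Cons)
  have SL: "length (seeds k) = SL" using seeds[OF k] by (simp add: tapes_def)
  have DT: "D \<le> table k'" for k' by (simp add: table_def TB_def)
  note tb = table_bounds[OF k]
  have tk: "table k' + stride \<le> table k" if "k' < k" for k'
    using mult_le_mono1[of "Suc k'" k stride] that by (simp add: table_def)
  have rcong: "regs_ok r'" if "\<forall>i<20. r' i = regs s i" for r'
    using Suc.prems(1) that by (simp add: regs_ok_def)
  have r: "regs s 1 = d" "regs s 5 = n" "regs s 13 = Nb" "regs s 17 = SL" "regs s 19 = 1"
    using Suc.prems(1) by (simp_all add: regs_ok_def)
  have seed: "wp w (2 ^ w) seed_loop u (\<lambda>t s'. tape s' = concat (map seeds [Suc k..<R]) \<and>
      regs s' 28 = table k + SL \<and> (\<forall>i<28. regs s' i = regs s i) \<and> seg (mem s') (table k) SL = seeds k \<and>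
      (\<forall>b. b < table k \<or> table k + SL \<le> b \<longrightarrow> mem s' b = mem s b))"
    if "\<forall>i<28. regs u i = regs s i" "regs u 29 = SL" "regs u 28 = table k" "tape u = tape s"
      "mem u = mem s" for u
    by (rule wp_mono[OF seed_loop[of u "seeds k" "table k" "concat (map seeds [Suc k..<R])"]])
      (use that r tape SL tb(1) m(2) in simp_all)
  have ins: "wp w (2 ^ w) insert_loop u (\<lambda>t s'. tape s' = concat (map seeds [Suc k..<R]) \<and>
      (\<forall>i<20. regs s' i = regs s i) \<and> regs s' 20 = table k \<and> regs s' 22 = Suc l \<and>
      regs s' 27 = table k + SL + Nb \<and> strings_ok (mem s') \<and> (\<forall>k'<Suc k. filled (mem s') k' n) \<and>
      (\<forall>a\<ge>table (Suc k). mem s' a = 0))"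
    if u: "tape u = concat (map seeds [Suc k..<R])" "\<forall>i<20. regs u i = regs s i" "regs u 20 = table k"
      "regs u 22 = Suc l" "regs u 21 = Suc d" "regs u 24 = 1" "regs u 25 = n" "regs u 28 = table k + SL"
      "regs u 27 = table k + SL + Nb" "seg (mem u) (table k) SL = seeds k"
      "\<forall>b. b < table k \<or> table k + SL \<le> b \<longrightarrow> mem u b = mem s b" for u
  proof (rule wp_mono[OF insert_loop[of u k 0 n]])
    show "regs_ok (regs u)" using u(2) by (rule rcong)
    show st: "strings_ok (mem u)"
      by (rule strings_ok_cong[OF Suc.prems(2)]) (use u(11) DT[of k] in simp)
    \<comment> \<open>Untouched memory is zero and a zero head is an empty chain, so a new table
      needs no initialisation.\<close>
    show "filled (mem u) k 0"
      using u(10,11) Suc.prems(4) by (simp add: filled_def)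
    fix t s' assume h: "tape s' = tape u \<and> (\<forall>i<20. regs s' i = regs u i) \<and>
      regs s' 20 = regs u 20 \<and> regs s' 22 = regs u 22 \<and> regs s' 27 = regs u 27 \<and> filled (mem s') k n \<and>
      (\<forall>a. a < table k + SL \<or> table k + SL + Nb + n < a \<longrightarrow> mem s' a = mem u a)"
    have "strings_ok (mem s')"
      by (rule strings_ok_cong[OF st]) (use h DT[of k] in simp)
    moreover have "filled (mem s') k' n" if "k' < k" for k'
    proof (rule filled_cong)
      show "filled (mem s) k' n" using Suc.prems(3) that by blast
      show "mem s' a = mem s a" if "a < table k' + stride" for a
        using h u(11) tk[OF \<open>k' < k\<close>] that by simp
    qed
    moreover have "mem s' a = 0" if "table (Suc k) \<le> a" for a
      using h u(11) Suc.prems(4) that tb(2) by simp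
    ultimately show "tape s' = concat (map seeds [Suc k..<R]) \<and>
      (\<forall>i<20. regs s' i = regs s i) \<and> regs s' 20 = table k \<and> regs s' 22 = Suc l \<and>
      regs s' 27 = table k + SL + Nb \<and> strings_ok (mem s') \<and> (\<forall>k'<Suc k. filled (mem s') k' n) \<and>
      (\<forall>a\<ge>table (Suc k). mem s' a = 0)"
      using h u by (simp add: less_Suc_eq)
  qed (use u k in simp_all)
  have IH: "wp w (2 ^ w) build_loop u (\<lambda>t s'. mem_ok (mem s') \<and> (\<forall>i<20. regs s' i = regs s i))"
    if "tape u = concat (map seeds [Suc k..<R])" "\<forall>i<20. regs u i = regs s i"
      "regs u 20 = Suc (table k + SL + Nb + n)" "regs u 22 = l" "strings_ok (mem u)"
      "\<forall>k'<Suc k. filled (mem u) k' n" "\<forall>a\<ge>table (Suc k). mem u a = 0" for u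
    by (rule wp_mono[OF Suc.IH[of u "Suc k"]]) (use that rcong Suc.prems(7) tb(2) in simp_all)
  have wb: "Suc (table k + SL + Nb + n) < 2 ^ w" "Suc l < 2 ^ w" "0 < w" "1 < (2::nat) ^ w"
    using tb m(2) R Suc.prems(7) by (cases w; simp)+
  have "Suc d < D" by (simp add: D_def)
  then have dw: "Suc d < 2 ^ w" "n < 2 ^ w" using m wb by (simp_all add: TB_def)
  show ?case
    unfolding build_loop_def
    apply (subst wp_While_unfold)
    apply (simp only: build_loop_def[symmetric])
    using r Suc.prems(5,6) wb dw
    apply simp
    apply (rule wp_mono[OF seed]; simp)
    apply (rule wp_mono[OF ins]; simp)
    apply (rule wp_mono[OF IH]; simp)
    done
qed

end

section \<open>Choice of the parameters\<close>

definition pow_loop :: prog where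
  "pow_loop = While 20 (seq [Op Add 8 8 8, Op Add 7 7 19, Op Less 21 5 8, Op Sub 20 19 21])"

lemma pow_loop:
  assumes "regs s 5 = n" "regs s 7 = i" "regs s 8 = 2 ^ i" "regs s 19 = 1" "regs s 20 = 1"
    "i < l" "n < 2 ^ l" "\<forall>j<l. 2 ^ j \<le> n" "(2::nat) ^ l < 2 ^ w" "l < 2 ^ w"
  shows "wp w m pow_loop s (\<lambda>t s'. mem s' = mem s \<and> tape s' = tape s \<and> regs s' 7 = l \<and>
    regs s' 8 = 2 ^ l \<and> (\<forall>i<20. i \<noteq> 7 \<longrightarrow> i \<noteq> 8 \<longrightarrow> regs s' i = regs s i))"
  using assms
proof (induction "l - i" arbitrary: s i)
  case (Suc x)
  have w: "0 < w" "1 < (2::nat) ^ w" using Suc.prems(10) Suc.prems(6) by (cases w; simp)+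
  have "(2::nat) ^ Suc i \<le> 2 ^ l" using Suc.prems(6) by (intro power_increasing) auto
  then have b: "2 * (2::nat) ^ i < 2 ^ w" "Suc i < 2 ^ w" "2 ^ i + (2::nat) ^ i < 2 ^ w"
    using Suc.prems(6,9,10) unfolding power_Suc by linarith+
  show ?case
  proof (cases "Suc i = l")
    case True
    then have "n < 2 * 2 ^ i" using Suc.prems(7) by auto
    then show ?thesis unfolding pow_loop_def
      apply (subst wp_While_unfold)
      using Suc.prems(1-5) w b
      apply (simp add: mult_2[symmetric])
      apply (subst wp_While_unfold)
      apply (simp add: True[symmetric])
      done
  next
    case False
    then have "2 ^ Suc i \<le> n" using Suc.prems(6) Suc.prems(8)[rule_format, of "Suc i"] by linarith
    then have le: "\<not> n < 2 * 2 ^ i" by simp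
    have IH: "wp w m pow_loop u (\<lambda>t s'. mem s' = mem s \<and> tape s' = tape s \<and> regs s' 7 = l \<and>
      regs s' 8 = 2 ^ l \<and> (\<forall>i<20. i \<noteq> 7 \<longrightarrow> i \<noteq> 8 \<longrightarrow> regs s' i = regs s i))"
      if "mem u = mem s" "tape u = tape s" "regs u 7 = Suc i" "regs u 8 = 2 * 2 ^ i" "regs u 20 = 1"
        "\<forall>i<20. i \<noteq> 7 \<longrightarrow> i \<noteq> 8 \<longrightarrow> regs u i = regs s i" for u
      by (rule wp_mono[OF Suc.hyps(1)[of "Suc i" u]])
        (use that Suc.hyps(2) Suc.prems False in \<open>simp_all\<close>)
    show ?thesis unfolding pow_loop_def
      apply (subst wp_While_unfold)
      apply (simp only: pow_loop_def[symmetric])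
      using Suc.prems(1-5) w b le
      apply (simp add: mult_2[symmetric])
      apply (rule wp_mono[OF IH]; simp)
      done
  qed
qed simp

text \<open>Fixed-point evaluation of \<open>X * (a / b) ^ j\<close>, rounded down in each round.
  The cap keeps the values within a word; what matters in the end is whether it is reached.\<close>

fun capped_power :: "nat \<Rightarrow> nat \<Rightarrow> nat \<Rightarrow> nat \<Rightarrow> nat \<Rightarrow> nat" where
  "capped_power a b cap 0 X = X"
| "capped_power a b cap (Suc j) X = capped_power a b cap j (min cap (X * a div b))"

definition power_loop :: prog where
  "power_loop = While 27 (seq [Op Mul 25 25 23, Op Div 25 25 24, Op Less 28 26 25,
     Cond 28 (Copy 25 26) Skip, Op Sub 27 27 19])"

lemma power_loop:
  assumes "regs s 27 = j" "regs s 25 = X" "regs s 23 = a" "regs s 24 = b" "regs s 26 = cap"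
    "regs s 19 = 1" "X \<le> cap" "cap * a < 2 ^ w" "cap < 2 ^ w" "j < 2 ^ w"
  shows "wp w m power_loop s (\<lambda>t s'. mem s' = mem s \<and> tape s' = tape s \<and>
    regs s' 25 = capped_power a b cap j X \<and> (\<forall>i<25. regs s' i = regs s i) \<and>
    regs s' 26 = regs s 26 \<and> regs s' 29 = regs s 29)"
  using assms
proof (induction j arbitrary: s X)
  case 0
  then show ?case by (simp add: power_loop_def wp_While_unfold)
next
  case (Suc j)
  have w: "0 < w" "1 < (2::nat) ^ w" using Suc.prems(10) by (cases w; simp)+
  have "X * a \<le> cap * a" using Suc.prems(7) by (rule mult_le_mono1)
  then have b: "X * a < 2 ^ w" "Suc j < 2 ^ w" "X * a div b < 2 ^ w"
    using Suc.prems(8,10) div_le_dividend[of "X * a" b] by linarith+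
  have IH: "wp w m power_loop u (\<lambda>t s'. mem s' = mem s \<and> tape s' = tape s \<and>
    regs s' 25 = capped_power a b cap (Suc j) X \<and> (\<forall>i<25. regs s' i = regs s i) \<and>
    regs s' 26 = regs s 26 \<and> regs s' 29 = regs s 29)"
    if "mem u = mem s" "tape u = tape s" "regs u 25 = min cap (X * a div b)" "\<forall>i<25. regs u i = regs s i"
      "regs u 26 = cap" "regs u 29 = regs s 29" "regs u 27 = j" for u
    by (rule wp_mono[OF Suc.IH[of u "min cap (X * a div b)"]])
      (use that Suc.prems in \<open>simp_all\<close>)
  show ?case unfolding power_loop_def
    apply (subst wp_While_unfold)
    apply (simp only: power_loop_def[symmetric])
    using Suc.prems(1-6,9) w b
    apply simp
    apply (intro conjI impI)
     apply ((rule wp_mono[OF IH]; simp)+)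
    done
qed

text \<open>Searches downwards from \<open>M\<close> for the largest \<tau> at which the power of
  \<open>(4 * M - \<tau>) / (3 * \<tau>)\<close> reaches the cap. For
  \<open>\<theta> = \<tau> / M\<close> this ratio is \<open>1 / (3 * p)\<close>, so reaching the cap
  makes \<open>(3 * p) ^ (K + 1)\<close> at most \<open>1 / n\<close>. A linear search is affordable
  because preprocessing time is not restricted.\<close>

definition tau_loop :: prog where
  "tau_loop = While 22 (seq [Op Sub 21 21 19, Const 24 4, Op Mul 23 24 20, Op Sub 23 23 21,
     Const 24 3, Op Mul 24 24 21, Copy 25 29, Op Add 27 15 19, power_loop, Op Less 22 25 26])"

text \<open>The witness \<open>\<sigma>\<close> below \<open>t\<close> stops the search before it
  gets to 0.\<close>

lemma tau_loop:
  fixes M K cap X :: nat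
  defines "small \<equiv> \<lambda>\<tau>. capped_power (4 * M - \<tau>) (3 * \<tau>) cap (Suc K) X < cap"
  assumes "regs s 21 = t" "regs s 20 = M" "regs s 29 = X" "regs s 26 = cap" "regs s 15 = K"
    "regs s 19 = 1" "regs s 22 \<noteq> 0"
    "0 < \<sigma>" "\<sigma> < t" "\<not> small \<sigma>" "t \<le> M" "X \<le> cap" "cap * (4 * M) < 2 ^ w" "cap < 2 ^ w"
    "Suc K < 2 ^ w" "4 * M < 2 ^ w"
  shows "wp w m tau_loop s (\<lambda>_ s'. mem s' = mem s \<and> tape s' = tape s \<and> (\<forall>i<21. regs s' i = regs s i) \<and>
    (\<exists>\<tau>. 0 < \<tau> \<and> \<tau> < t \<and> \<not> small \<tau> \<and> (\<forall>\<tau>'. \<tau> < \<tau>' \<and> \<tau>' < t \<longrightarrow> small \<tau>') \<and>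
      regs s' 21 = \<tau> \<and> regs s' 23 = 4 * M - \<tau>))"
  using assms(2-)
proof (induction t arbitrary: s)
  case (Suc t)
  have t: "0 < t" "t < M" "\<sigma> \<le> t" using Suc.prems(8,9,11) by linarith+
  have w: "0 < w" "1 < (2::nat) ^ w" "3 < (2::nat) ^ w" "4 < (2::nat) ^ w"
      "M < 2 ^ w" "3 * t < 2 ^ w" "Suc t < 2 ^ w" "X < 2 ^ w" "t \<le> 4 * M"
    using Suc.prems(12,14,16) t by (cases w; simp)+
  have power: "wp w m power_loop u (\<lambda>_ s'. mem s' = mem s \<and> tape s' = tape s \<and>
      regs s' 25 = capped_power (4 * M - t) (3 * t) cap (Suc K) X \<and> (\<forall>i<21. regs s' i = regs s i) \<and>
      regs s' 21 = t \<and> regs s' 23 = 4 * M - t \<and> regs s' 26 = cap \<and> regs s' 29 = X)"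
    if "mem u = mem s" "tape u = tape s" "\<forall>i<21. regs u i = regs s i" "regs u 21 = t"
      "regs u 23 = 4 * M - t" "regs u 24 = 3 * t" "regs u 25 = X" "regs u 26 = cap" "regs u 27 = Suc K"
      "regs u 29 = X" for u
  proof (rule wp_mono[OF power_loop[of u "Suc K" X "4 * M - t" "3 * t" cap]])
    have "cap * (4 * M - t) \<le> cap * (4 * M)" by (intro mult_le_mono2) simp
    then show "cap * (4 * M - t) < 2 ^ w" using Suc.prems(13) by linarith
  qed (use that Suc.prems(6,12,14,15) in \<open>simp_all del: capped_power.simps\<close>)
  have IH: "wp w m tau_loop u (\<lambda>_ s'. mem s' = mem s \<and> tape s' = tape s \<and> (\<forall>i<21. regs s' i = regs s i) \<and>
    (\<exists>\<tau>. 0 < \<tau> \<and> \<tau> < Suc t \<and> \<not> small \<tau> \<and> (\<forall>\<tau>'. \<tau> < \<tau>' \<and> \<tau>' < Suc t \<longrightarrow> small \<tau>') \<and>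
      regs s' 21 = \<tau> \<and> regs s' 23 = 4 * M - \<tau>))"
    if "mem u = mem s" "tape u = tape s" "\<forall>i<21. regs u i = regs s i" "regs u 21 = t" "regs u 26 = cap"
      "regs u 29 = X" "regs u 22 \<noteq> 0" "small t" for u
  proof (rule wp_mono[OF Suc.IH[of u]])
    show "\<sigma> < t" using Suc.prems(10) t(3) that(8) by (cases "\<sigma> = t") auto
    fix t' s' assume h: "mem s' = mem u \<and> tape s' = tape u \<and> (\<forall>i<21. regs s' i = regs u i) \<and>
    (\<exists>\<tau>. 0 < \<tau> \<and> \<tau> < t \<and> \<not> small \<tau> \<and> (\<forall>\<tau>'. \<tau> < \<tau>' \<and> \<tau>' < t \<longrightarrow> small \<tau>') \<and>
      regs s' 21 = \<tau> \<and> regs s' 23 = 4 * M - \<tau>)"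
    then obtain \<tau> where \<tau>: "0 < \<tau>" "\<tau> < t" "\<not> small \<tau>" "\<forall>\<tau>'. \<tau> < \<tau>' \<and> \<tau>' < t \<longrightarrow> small \<tau>'"
      "regs s' 21 = \<tau>" "regs s' 23 = 4 * M - \<tau>" by blast
    have "\<forall>\<tau>'. \<tau> < \<tau>' \<and> \<tau>' < Suc t \<longrightarrow> small \<tau>'" using \<tau>(4) that(8) less_Suc_eq by metis
    then show "mem s' = mem s \<and> tape s' = tape s \<and> (\<forall>i<21. regs s' i = regs s i) \<and>
    (\<exists>\<tau>. 0 < \<tau> \<and> \<tau> < Suc t \<and> \<not> small \<tau> \<and> (\<forall>\<tau>'. \<tau> < \<tau>' \<and> \<tau>' < Suc t \<longrightarrow> small \<tau>') \<and>
      regs s' 21 = \<tau> \<and> regs s' 23 = 4 * M - \<tau>)"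
      using h \<tau> that(1-3) by (intro conjI exI[of _ \<tau>]) auto
  qed (use that Suc.prems in \<open>simp_all\<close>)
  have sm: "small t \<longleftrightarrow> capped_power (4 * M - t) (3 * t) cap (Suc K) X < cap" by (simp add: small_def)
  show ?case unfolding tau_loop_def
    apply (subst wp_While_unfold)
    apply (simp only: tau_loop_def[symmetric])
    using Suc.prems(1-7,15,16) w t(1)
    apply (simp del: capped_power.simps)
    apply (rule wp_mono[OF power]; simp del: capped_power.simps)
    apply (simp only: sm[symmetric])
    apply (cases "small t")
     apply (simp del: capped_power.simps)
     apply (rule wp_mono[OF IH]; simp del: capped_power.simps)
    apply (simp del: capped_power.simps add: tau_loop_def)
    apply (subst wp_While_unfold)
    apply (auto simp del: capped_power.simps)
    done
qed simp

text \<open>Rounded up, in contrast to \<open>capped_power\<close>: the number of tables must not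
  fall short of the required power. The cap is \<open>n\<close> because a scan of all strings is
  then the better choice.\<close>

fun capped_reps :: "nat \<Rightarrow> nat \<Rightarrow> nat \<Rightarrow> nat \<Rightarrow> nat \<Rightarrow> nat" where
  "capped_reps a b n 0 X = X"
| "capped_reps a b n (Suc j) X = capped_reps a b n j (min n (X * a div b + 1))"

definition reps_loop :: prog where
  "reps_loop = While 27 (seq [Op Mul 12 12 23, Op Div 12 12 21, Op Add 12 12 19, Op Less 28 5 12,
     Cond 28 (Copy 12 5) Skip, Op Sub 27 27 19])"

lemma reps_loop:
  assumes "regs s 27 = j" "regs s 12 = X" "regs s 23 = a" "regs s 21 = b" "regs s 5 = n"
    "regs s 19 = 1" "X \<le> n" "n * a + 1 < 2 ^ w" "n < 2 ^ w" "j < 2 ^ w"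
  shows "wp w m reps_loop s (\<lambda>t s'. mem s' = mem s \<and> tape s' = tape s \<and>
    regs s' 12 = capped_reps a b n j X \<and> (\<forall>i<22. i \<noteq> 12 \<longrightarrow> regs s' i = regs s i))"
  using assms
proof (induction j arbitrary: s X)
  case 0
  then show ?case by (simp add: reps_loop_def wp_While_unfold)
next
  case (Suc j)
  have w: "0 < w" "1 < (2::nat) ^ w" using Suc.prems(10) by (cases w; simp)+
  have "X * a \<le> n * a" using Suc.prems(7) by (rule mult_le_mono1)
  then have b: "X * a < 2 ^ w" "Suc j < 2 ^ w" "Suc (X * a div b) < 2 ^ w"
    using Suc.prems(8,10) div_le_dividend[of "X * a" b] by linarith+
  have IH: "wp w m reps_loop u (\<lambda>t s'. mem s' = mem s \<and> tape s' = tape s \<and>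
    regs s' 12 = capped_reps a b n (Suc j) X \<and> (\<forall>i<22. i \<noteq> 12 \<longrightarrow> regs s' i = regs s i))"
    if "mem u = mem s" "tape u = tape s" "regs u 12 = min n (X * a div b + 1)"
      "\<forall>i<22. i \<noteq> 12 \<longrightarrow> regs u i = regs s i" "regs u 23 = a" "regs u 27 = j" for u
    by (rule wp_mono[OF Suc.IH[of u "min n (X * a div b + 1)"]])
      (use that Suc.prems in \<open>simp_all\<close>)
  show ?case unfolding reps_loop_def
    apply (subst wp_While_unfold)
    apply (simp only: reps_loop_def[symmetric])
    using Suc.prems(1-6,9) w b
    apply simp
    apply (intro conjI impI)
     apply ((rule wp_mono[OF IH]; simp)+)
    done
qed

text \<open>Registers 7 to 10 receive the bit length \<open>l\<close> of \<open>n\<close>, the power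
  \<open>2 ^ l\<close>, the code width and the number of steps of a walk; register 15 receives the
  radius of verification.\<close>

definition sizes :: "nat \<Rightarrow> prog" where
  "sizes e = seq [Const 7 0, Const 8 1, Const 20 1, pow_loop, Const 20 e, Op Add 9 7 20,
     Op Add 10 1 7, Op Add 10 10 19, Const 20 3, Op Mul 10 10 20,
     Op Mul 15 3 7, Op Less 20 4 15, Cond 20 (Copy 15 4) Skip]"

definition rates :: "nat \<Rightarrow> prog" where
  "rates e = seq [Op Mul 20 8 8, Op Mul 20 20 8, Copy 21 20, Const 25 (2 ^ e), Op Mul 29 25 8,
     Op Mul 26 5 29, Const 22 1, tau_loop, Const 12 1, Copy 27 3, reps_loop]"

text \<open>Since \<open>M = 2 ^ (3 * l)\<close> and a word has \<open>10 * (e + 1) * l\<close>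
  bits, shifting \<tau> by \<open>(10 * e + 7) * l\<close> turns \<tau> / M into a threshold for a
  random word. If the repetitions hit the cap \<open>n\<close>, one table with a single bucket and
  budget \<open>n\<close> is used, which is a linear scan; otherwise the budget is 12 false
  candidates per table.\<close>

definition addresses :: "nat \<Rightarrow> prog" where
  "addresses e = seq [Const 28 (10 * e + 7), Op Mul 28 28 7, Op Shl 11 21 28,
     Op Less 28 12 5, Cond 28 (seq [Copy 13 8, Const 28 12, Op Mul 14 12 28])
       (seq [Copy 12 19, Copy 13 19, Copy 14 5]),
     Op Add 17 9 19, Op Mul 17 17 10,
     Const 20 2, Op Add 18 5 20, Op Add 20 1 19, Op Mul 18 18 20,
     Op Add 16 18 1, Op Add 16 16 1, Const 20 3, Op Add 16 16 20,
     Copy 20 16, Copy 22 12]"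

text \<open>\<open>G\<close> takes a tenth of the bits of a word. All quantities are bounded by
  powers of \<open>G\<close> with exponent at most 9, which reduces overflow checks to counting
  exponents.\<close>

locale parameters =
  fixes e l n d r K0 w G :: nat
  defines "G \<equiv> (2 ^ l) ^ (e + 1)"
  assumes e: "5 \<le> e" and n: "1 \<le> n" "n < 2 ^ l" "\<forall>j<l. 2 ^ j \<le> n" and d: "d < G"
    and w: "(2::nat) ^ w = G ^ 10" and r: "r \<le> K0" "K0 < d"
begin

definition N :: nat where "N = 2 ^ l"
text \<open>The cutoff at \<open>r * l\<close> keeps the band narrow for large \<open>c\<close>. It
  costs only a factor 2 in the number of tables, because
  \<open>n powr (1 / l) \<le> 2\<close>.\<close>

definition K :: nat where "K = min K0 (r * l)"
text \<open>The denominator of \<theta>. Being at least \<open>n * n\<close>, it is so fine that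
  passing to a neighbouring \<tau> changes \<open>rate \<tau> ^ r\<close> by a constant factor
  only.\<close>

definition M :: nat where "M = N * N * N"
text \<open>The fixed-point representation of 1. When it is at least \<open>2 * d\<close>, the
  \<open>K + 1\<close> roundings take away at most half of it.\<close>

definition X0 :: nat where "X0 = 2 ^ e * N"

lemma l: "1 \<le> l" "2 \<le> N" "N \<le> 2 * n" "n < N"
proof -
  show l: "1 \<le> l" using n by (cases l) auto
  then obtain l' where l': "l = Suc l'" by (cases l) auto
  have "2 ^ l' \<le> n" using n(3)[rule_format, of l'] l' by linarith
  moreover have "N = 2 * 2 ^ l'" unfolding N_def by (simp only: l' power_Suc)
  ultimately show "N \<le> 2 * n" by linarith
  show "n < N" using n(2) by (simp add: N_def)
  then show "2 \<le> N" using n(1) by simp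
qed

lemma G: "64 \<le> G" "N \<le> G" "n < G" "l < G" "X0 \<le> G" "2 ^ e \<le> G" "e < G"
proof -
  have G': "G = N ^ e * N" by (simp add: G_def N_def)
  have "(2::nat) ^ e \<le> N ^ e" using l(2) by (intro power_mono) auto
  then show X0: "X0 \<le> G" unfolding G' X0_def by (rule mult_le_mono1)
  have "(2::nat) ^ 5 \<le> 2 ^ e" using e by (intro power_increasing) auto
  then have "2 ^ 5 * 2 \<le> X0" unfolding X0_def using l(2) by (rule mult_le_mono)
  then show "64 \<le> G" using X0 by simp
  have "2 ^ e * 1 \<le> X0" unfolding X0_def using l(2) by (intro mult_le_mono2) simp
  then show "2 ^ e \<le> G" using X0 by linarith
  then show "e < G" using less_exp[of e] by linarith
  show NG: "N \<le> G" unfolding G' using l(2) by simp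
  then show "n < G" using l(4) by simp
  have "l < N" by (simp add: N_def)
  with NG show "l < G" by simp
qed

lemma small_const: "x \<le> 64 \<Longrightarrow> x \<le> G ^ 1"
  using G(1) by simp

lemma G_mult: "x \<le> G ^ i \<Longrightarrow> y \<le> G ^ j \<Longrightarrow> x * y \<le> G ^ (i + j)"
  by (simp add: power_add mult_le_mono)

lemma G_add: "x \<le> G ^ i \<Longrightarrow> y \<le> G ^ i \<Longrightarrow> x + y \<le> G ^ (i + 1)"
proof -
  assume "x \<le> G ^ i" "y \<le> G ^ i"
  then have "x + y \<le> 2 * G ^ i" by simp
  also have "\<dots> \<le> G * G ^ i" using G(1) by (intro mult_le_mono1) simp
  finally show ?thesis by simp
qed

lemma G_mono: "x \<le> G ^ i \<Longrightarrow> i \<le> j \<Longrightarrow> x \<le> G ^ j"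
  using power_increasing[of i j G] G(1) by linarith

lemma G_sum: "x \<le> G ^ i \<Longrightarrow> y \<le> G ^ j \<Longrightarrow> i < k \<Longrightarrow> j < k \<Longrightarrow> x + y \<le> G ^ k"
  using G_mono[OF G_add[OF G_mono G_mono], of x i "max i j" y j k] by simp

lemma word: "x \<le> G ^ i \<Longrightarrow> i \<le> 9 \<Longrightarrow> x < 2 ^ w"
proof -
  assume "x \<le> G ^ i" "i \<le> 9"
  then have "x \<le> G ^ 9" by (rule G_mono)
  also have "\<dots> < G ^ 10" using G(1) by (intro power_strict_increasing) auto
  finally show ?thesis by (simp add: w)
qed

lemma sizes:
  assumes "regs s 1 = d" "regs s 3 = r" "regs s 4 = K0" "regs s 5 = n" "regs s 19 = 1"
  shows "wp w m (sizes e) s (\<lambda>_ s'. mem s' = mem s \<and> tape s' = tape s \<and>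
    regs s' 7 = l \<and> regs s' 8 = N \<and> regs s' 9 = l + e \<and> regs s' 10 = 3 * (d + l + 1) \<and> regs s' 15 = K \<and>
    (\<forall>i\<in>{1, 3, 5, 6, 19}. regs s' i = regs s i))"
proof -
  have g: "d \<le> G ^ 1" "l \<le> G ^ 1" "e \<le> G ^ 1" "r \<le> G ^ 1" "N \<le> G ^ 1" using G d r by simp_all
  have dl: "d + l + 1 \<le> G ^ 3"
    using G_sum[OF G_sum[OF g(1,2), of 2] small_const[of 1], of 3] by simp
  have K0: "K0 \<le> G ^ 1" using r(2) g(1) by linarith
  have b: "3 < (2::nat) ^ w" "d + l + 1 < 2 ^ w" "3 * (d + l + 1) < 2 ^ w" "r * l < 2 ^ w"
      "l + e < 2 ^ w" "e < 2 ^ w" "K0 < 2 ^ w" "l < 2 ^ w" "1 < (2::nat) ^ w"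
    by (rule word[OF small_const] word[OF dl] word[OF G_mult[OF small_const dl]] word[OF G_mult[OF g(4,2)]]
        word[OF G_add[OF g(2,3)]] word[OF g(3)] word[OF K0] word[OF g(2)]; simp)+
  have w0: "0 < w" using b(1) by (cases w) auto
  have pow: "wp w m pow_loop u (\<lambda>t s'. mem s' = mem s \<and> tape s' = tape s \<and> regs s' 7 = l \<and>
    regs s' 8 = N \<and> (\<forall>i<20. i \<noteq> 7 \<longrightarrow> i \<noteq> 8 \<longrightarrow> regs s' i = regs s i))"
    if "mem u = mem s" "tape u = tape s" "regs u 7 = 0" "regs u 8 = 1" "regs u 20 = 1"
      "\<forall>i<20. i \<noteq> 7 \<longrightarrow> i \<noteq> 8 \<longrightarrow> regs u i = regs s i" for u
    by (rule wp_mono[OF pow_loop[of u n 0 l]])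
      (use that assms n l word[OF g(5)] b in \<open>simp_all add: N_def\<close>)
  show ?thesis
    unfolding sizes_def using assms b w0
    apply simp
    apply (rule wp_mono[OF pow]; simp)
    apply (auto simp: K_def)
    done
qed

definition small :: "nat \<Rightarrow> bool" where
  "small \<tau> \<longleftrightarrow> capped_power (4 * M - \<tau>) (3 * \<tau>) (n * X0) (Suc K) X0 < n * X0"

definition reps :: "nat \<Rightarrow> nat" where
  "reps \<tau> = capped_reps (4 * M - \<tau>) \<tau> n r 1"

text \<open>For \<tau> = 1 the ratio is at least \<open>n\<close>, so one multiplication reaches the
  cap and the others stay there. Hence the search is bound to succeed.\<close>

lemma not_small_1: "\<not> small 1"
proof -
  let ?cap = "n * X0"
  have fixpoint: "capped_power a b ?cap j ?cap = ?cap" if "0 < b" "b \<le> a" for a b j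
  proof (induction j)
    case (Suc j)
    have "?cap \<le> ?cap * a div b"
      using that mult_le_mono2[OF that(2), of ?cap] by (simp add: less_eq_div_iff_mult_less_eq)
    then show ?case using Suc by (simp add: min_absorb1)
  qed simp
  have "n \<le> M"
  proof -
    have "n \<le> N" using l(4) by simp
    also have "\<dots> = N * 1 * 1" by simp
    also have "\<dots> \<le> N * N * N" using l(2) by (intro mult_le_mono) auto
    finally show ?thesis by (simp add: M_def)
  qed
  then have a: "3 * n \<le> 4 * M - 1" "3 \<le> 4 * M - 1" using n(1) by linarith+
  have "X0 * (3 * n) \<le> X0 * (4 * M - 1)" using a(1) by (rule mult_le_mono2)
  then have "?cap \<le> X0 * (4 * M - 1) div 3" by (simp add: less_eq_div_iff_mult_less_eq algebra_simps)
  then have "capped_power (4 * M - 1) (3 * 1) ?cap (Suc K) X0 = ?cap"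
    using fixpoint[of 3 "4 * M - 1" K] a(2) by (simp add: min_absorb1)
  then show ?thesis by (simp add: small_def)
qed

lemma rates:
  assumes "regs s 3 = r" "regs s 5 = n" "regs s 8 = N" "regs s 15 = K" "regs s 19 = 1"
  shows "wp w m (rates e) s (\<lambda>_ s'. mem s' = mem s \<and> tape s' = tape s \<and>
    (\<forall>i<20. i \<noteq> 12 \<longrightarrow> regs s' i = regs s i) \<and>
    (\<exists>\<tau>. 0 < \<tau> \<and> \<tau> < M \<and> \<not> small \<tau> \<and> (\<forall>\<tau>'. \<tau> < \<tau>' \<and> \<tau>' < M \<longrightarrow> small \<tau>') \<and>
      regs s' 21 = \<tau> \<and> regs s' 12 = reps \<tau>))"
proof -
  have g: "N \<le> G ^ 1" "n \<le> G ^ 1" "X0 \<le> G ^ 1" "2 ^ e \<le> G ^ 1" "r \<le> G ^ 1" using G d r by simp_all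
  have M: "M \<le> G ^ 3" using G_mult[OF G_mult[OF g(1,1)] g(1)] by (simp add: M_def power3_eq_cube mult.assoc)
  have cap: "n * X0 \<le> G ^ 2" using G_mult[OF g(2,3)] by (simp add: power2_eq_square)
  have M4: "4 * M \<le> G ^ 4" using G_mult[OF small_const[of 4] M] by simp
  have nM: "n * (4 * M) + 1 \<le> G ^ 6"
    using G_sum[OF G_mult[OF g(2) M4] small_const[of 1], of 6] by simp
  have b: "N * N < 2 ^ w" "M < 2 ^ w" "X0 < 2 ^ w" "n * X0 < 2 ^ w" "2 ^ e < (2::nat) ^ w" "4 * M < 2 ^ w"
      "n * X0 * (4 * M) < 2 ^ w" "n * (4 * M) + 1 < 2 ^ w" "n < 2 ^ w" "r < 2 ^ w" "3 < (2::nat) ^ w"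
    by (rule word[OF G_mult[OF g(1,1)]] word[OF M] word[OF g(3)] word[OF cap] word[OF g(4)] word[OF M4]
        word[OF G_mult[OF cap M4]] word[OF nM] word[OF g(2)] word[OF g(5)] word[OF small_const]; simp)+
  have w0: "0 < w" "1 < (2::nat) ^ w" using b(11) by (cases w; simp)+
  have Kw: "Suc K < 2 ^ w"
    using r(2) d word[of G 1] by (simp add: K_def)
  have M2: "8 \<le> M" using mult_le_mono[OF mult_le_mono[OF l(2) l(2)] l(2)] by (simp add: M_def)
  have tau: "wp w m tau_loop u (\<lambda>_ s'. mem s' = mem s \<and> tape s' = tape s \<and> (\<forall>i<20. regs s' i = regs s i) \<and>
    (\<exists>\<tau>. 0 < \<tau> \<and> \<tau> < M \<and> \<not> small \<tau> \<and> (\<forall>\<tau>'. \<tau> < \<tau>' \<and> \<tau>' < M \<longrightarrow> small \<tau>') \<and>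
      regs s' 21 = \<tau> \<and> regs s' 23 = 4 * M - \<tau>))"
    if "mem u = mem s" "tape u = tape s" "\<forall>i<20. regs u i = regs s i" "regs u 20 = M" "regs u 21 = M"
      "regs u 22 = 1" "regs u 26 = n * X0" "regs u 29 = X0" for u
    by (rule wp_mono[OF tau_loop[of u M M X0 "n * X0" K 1]])
      (use that assms not_small_1 M2 b Kw n(1) in \<open>simp_all add: small_def del: capped_power.simps\<close>)
  have reps: "wp w m reps_loop u (\<lambda>t s'. mem s' = mem s \<and> tape s' = tape s \<and>
    (\<forall>i<20. i \<noteq> 12 \<longrightarrow> regs s' i = regs s i) \<and>
    (\<exists>\<tau>. 0 < \<tau> \<and> \<tau> < M \<and> \<not> small \<tau> \<and> (\<forall>\<tau>'. \<tau> < \<tau>' \<and> \<tau>' < M \<longrightarrow> small \<tau>') \<and>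
      regs s' 21 = \<tau> \<and> regs s' 12 = reps \<tau>))"
    if u: "mem u = mem s" "tape u = tape s" "\<forall>i<20. i \<noteq> 12 \<longrightarrow> regs u i = regs s i" "regs u 12 = 1" "regs u 27 = r"
      "\<exists>\<tau>. 0 < \<tau> \<and> \<tau> < M \<and> \<not> small \<tau> \<and> (\<forall>\<tau>'. \<tau> < \<tau>' \<and> \<tau>' < M \<longrightarrow> small \<tau>') \<and>
      regs u 21 = \<tau> \<and> regs u 23 = 4 * M - \<tau>" for u
  proof -
    obtain \<tau> where \<tau>: "0 < \<tau>" "\<tau> < M" "\<not> small \<tau>" "\<forall>\<tau>'. \<tau> < \<tau>' \<and> \<tau>' < M \<longrightarrow> small \<tau>'"
      "regs u 21 = \<tau>" "regs u 23 = 4 * M - \<tau>" using u(6) by blast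
    have "n * (4 * M - \<tau>) \<le> n * (4 * M)" by (intro mult_le_mono2) simp
    then have nM: "n * (4 * M - \<tau>) + 1 < 2 ^ w" using b(8) by linarith
    show ?thesis
    proof (rule wp_mono[OF reps_loop[of u r 1 "4 * M - \<tau>" \<tau> n]])
      fix t s' assume "mem s' = mem u \<and> tape s' = tape u \<and>
        regs s' 12 = capped_reps (4 * M - \<tau>) \<tau> n r 1 \<and> (\<forall>i<22. i \<noteq> 12 \<longrightarrow> regs s' i = regs u i)"
      then show "mem s' = mem s \<and> tape s' = tape s \<and>
        (\<forall>i<20. i \<noteq> 12 \<longrightarrow> regs s' i = regs s i) \<and>
        (\<exists>\<tau>. 0 < \<tau> \<and> \<tau> < M \<and> \<not> small \<tau> \<and> (\<forall>\<tau>'. \<tau> < \<tau>' \<and> \<tau>' < M \<longrightarrow> small \<tau>') \<and>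
          regs s' 21 = \<tau> \<and> regs s' 12 = reps \<tau>)"
        using \<tau> u(1-3) by (intro conjI exI[of _ \<tau>]) (simp_all add: reps_def)
    qed (use u \<tau> assms n(1) b(9,10) nM in simp_all)
  qed
  show ?thesis
    unfolding rates_def using assms b w0
    apply (simp add: M_def[symmetric] X0_def[symmetric])
    apply (rule wp_mono[OF tau]; simp)
    apply (rule wp_mono[OF reps]; simp)
    done
qed

lemma addresses:
  assumes "regs s 1 = d" "regs s 5 = n" "regs s 6 = 0" "regs s 7 = l" "regs s 8 = N" "regs s 9 = l + e"
    "regs s 10 = 3 * (d + l + 1)" "regs s 15 = K" "regs s 19 = 1" "regs s 21 = \<tau>" "regs s 12 = R0"
    "\<tau> < M" "R0 \<le> n"
  shows "wp w m (addresses e) s (\<lambda>_ s'. mem s' = mem s \<and> tape s' = tape s \<and>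
    (let R = (if R0 < n then R0 else 1); D = (n + 2) * (d + 1) in
     regs s' 1 = d \<and> regs s' 5 = n \<and> regs s' 6 = 0 \<and> regs s' 9 = l + e \<and> regs s' 10 = 3 * (d + l + 1) \<and>
     regs s' 11 = \<tau> * 2 ^ ((10 * e + 7) * l) \<and> regs s' 12 = R \<and>
     regs s' 13 = (if R0 < n then N else 1) \<and> regs s' 14 = (if R0 < n then 12 * R0 else n) \<and>
     regs s' 15 = K \<and> regs s' 16 = D + 2 * d + 3 \<and> regs s' 17 = 3 * (d + l + 1) * Suc (l + e) \<and>
     regs s' 18 = D \<and> regs s' 19 = 1 \<and> regs s' 20 = D + 2 * d + 3 \<and> regs s' 22 = R))"
proof -
  have g: "N \<le> G ^ 1" "n \<le> G ^ 1" "e \<le> G ^ 1" "d \<le> G ^ 1" "l \<le> G ^ 1" "R0 \<le> G ^ 1"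
    using G d assms(13) by simp_all
  have c: "10 * e + 7 \<le> G ^ 3"
    using G_sum[OF G_mult[OF small_const[of 10] g(3)] small_const[of 7], of 3] by simp
  have T: "3 * (d + l + 1) \<le> G ^ 4"
  proof -
    have "d + l + 1 \<le> G ^ 3"
      using G_sum[OF G_sum[OF g(4,5), of 2] small_const[of 1], of 3] by simp
    from G_mult[OF small_const[of 3] this] show ?thesis by simp
  qed
  have B: "Suc (l + e) \<le> G ^ 3"
    using G_sum[OF G_sum[OF g(5,3), of 2] small_const[of 1], of 3] by simp
  have n2: "n + 2 \<le> G ^ 2" and d1: "d + 1 \<le> G ^ 2"
    using G_sum[OF g(2) small_const[of 2], of 2] G_sum[OF g(4) small_const[of 1], of 2] by simp_all
  have D: "(n + 2) * (d + 1) \<le> G ^ 4" using G_mult[OF n2 d1] by simp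
  have D1: "(n + 2) * (d + 1) + d \<le> G ^ 5" using G_sum[OF D g(4), of 5] by simp
  have D2: "(n + 2) * (d + 1) + d + d \<le> G ^ 6" using G_sum[OF D1 g(4), of 6] by simp
  have D3: "(n + 2) * (d + 1) + d + d + 3 \<le> G ^ 7"
    using G_sum[OF D2 small_const[of 3], of 7] by simp
  have eq: "\<tau> * 2 ^ ((10 * e + 7) * l) < 2 ^ w"
  proof -
    have "M * 2 ^ ((10 * e + 7) * l) = 2 ^ w"
      unfolding w G_def M_def N_def by (simp flip: power_mult power_add add: algebra_simps)
    moreover have "\<tau> * 2 ^ ((10 * e + 7) * l) < M * 2 ^ ((10 * e + 7) * l)" using assms(12) by simp
    ultimately show ?thesis by simp
  qed
  have b: "10 * e + 7 < 2 ^ w" "(10 * e + 7) * l < 2 ^ w" "12 < (2::nat) ^ w" "12 * R0 < 2 ^ w" "N < 2 ^ w"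
      "n < 2 ^ w" "Suc (l + e) < 2 ^ w" "Suc (l + e) * (3 * (d + l + 1)) < 2 ^ w" "n + 2 < 2 ^ w"
      "d + 1 < 2 ^ w" "(n + 2) * (d + 1) < 2 ^ w" "(n + 2) * (d + 1) + d < 2 ^ w"
      "(n + 2) * (d + 1) + d + d < 2 ^ w" "(n + 2) * (d + 1) + d + d + 3 < 2 ^ w" "R0 < 2 ^ w"
    by (rule word[OF c] word[OF G_mult[OF c g(5)]] word[OF small_const] word[OF G_mult[OF small_const[of 12] g(6)]]
        word[OF g(1)] word[OF g(2)] word[OF B] word[OF G_mult[OF B T]] word[OF n2] word[OF d1]
        word[OF D] word[OF D1] word[OF D2] word[OF D3] word[OF g(6)]; simp)+
  have w0: "0 < w" "1 < (2::nat) ^ w" using b(3) by (cases w; simp)+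
  define D' T' c' where "D' = (n + 2) * (d + 1)" and "T' = 3 * (d + l + 1)" and "c' = 10 * e + 7"
  note b' = b[folded D'_def T'_def c'_def] eq[folded c'_def]
  have D': "(n + 2) * Suc d = D'" by (simp add: D'_def)
  have cw: "(10 * e + 7) mod 2 ^ w = c'" using b(1) by (simp add: c'_def)
  show ?thesis
    unfolding addresses_def Let_def D'_def[symmetric] T'_def[symmetric] c'_def[symmetric]
    using assms(1-11)[folded T'_def] b' w0 D'
    apply (cases "R0 < n")
     apply (simp_all add: algebra_simps)
    done
qed

end

section \<open>Rounding errors of the fixed-point powers\<close>

lemma real_div_bounds:
  shows "real (m div b) \<le> real m / b" "0 < b \<Longrightarrow> real m / b \<le> real (m div b) + 1"
proof -
  show "real (m div b) \<le> real m / b" by (rule of_nat_div_le_of_nat)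
  assume "0 < b"
  then have "m < (m div b + 1) * b" by (simp add: dividend_less_div_times)
  then have "real m < (real (m div b) + 1) * b" by (metis of_nat_1 of_nat_add of_nat_less_iff of_nat_mult)
  then show "real m / b \<le> real (m div b) + 1" using \<open>0 < b\<close> by (simp add: field_simps)
qed

lemma capped_power_le:
  assumes "0 < b"
  shows "real (capped_power a b cap j X) \<le> X * (real a / b) ^ j"
proof (induction j arbitrary: X)
  case (Suc j)
  have "real (capped_power a b cap (Suc j) X) \<le> real (min cap (X * a div b)) * (real a / b) ^ j"
    using Suc.IH by simp
  also have "\<dots> \<le> (X * real a / b) * (real a / b) ^ j"
  proof (rule mult_right_mono)
    have "real (min cap (X * a div b)) \<le> real (X * a div b)" by simp
    also have "\<dots> \<le> real (X * a) / b" by (rule real_div_bounds)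
    finally show "real (min cap (X * a div b)) \<le> X * real a / b" by simp
  qed simp
  finally show ?case by simp
qed simp

lemma capped_power_cap:
  assumes "0 < b" "b \<le> a"
  shows "capped_power a b cap j cap = cap"
proof (induction j)
  case (Suc j)
  have "cap \<le> cap * a div b"
    using assms mult_le_mono2[OF assms(2), of cap] by (simp add: less_eq_div_iff_mult_less_eq)
  then show ?case using Suc by (simp add: min_absorb1)
qed simp

text \<open>Each of the \<open>j\<close> roundings costs at most 1, scaled by the remaining growth.\<close>

lemma capped_power_ge:
  assumes "0 < b" "b \<le> a" "capped_power a b cap j X < cap"
  shows "(real X - j) * (real a / b) ^ j \<le> capped_power a b cap j X"
  using assms(3)
proof (induction j arbitrary: X)
  case (Suc j)
  let ?u = "real a / b" and ?Y = "X * a div b"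
  have u: "1 \<le> ?u" using assms by simp
  have Y: "min cap ?Y = ?Y"
  proof (rule ccontr)
    assume "min cap ?Y \<noteq> ?Y"
    then have "min cap ?Y = cap" by (simp add: min_def split: if_splits)
    then show False using Suc.prems capped_power_cap[OF assms(1,2)] by simp
  qed
  have "real X * ?u - 1 \<le> ?Y" using real_div_bounds(2)[OF assms(1), of "X * a"] by simp
  then have "(real X - Suc j) * ?u \<le> real ?Y - j"
    using mult_left_mono[OF u, of "real (Suc j)"] by (simp add: algebra_simps)
  then have "(real X - Suc j) * ?u * ?u ^ j \<le> (real ?Y - j) * ?u ^ j"
    using u by (intro mult_right_mono) auto
  also have "\<dots> \<le> capped_power a b cap (Suc j) X"
    using Suc.IH[of ?Y] Suc.prems Y by simp
  finally show ?case by (simp add: mult.assoc)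
qed simp

lemma capped_reps_le_cap: "X \<le> n \<Longrightarrow> capped_reps a b n j X \<le> n"
  by (induction j arbitrary: X) auto

text \<open>The slack 1/2 absorbs the 1 added in each round:
  \<open>X * u + 1 + 1 / 2 \<le> (X + 1 / 2) * u\<close> for \<open>u \<ge> 3\<close>.\<close>

lemma capped_reps_le:
  assumes "0 < b" "3 * b \<le> a"
  shows "real (capped_reps a b n j X) \<le> (X + 1 / 2) * (real a / b) ^ j"
proof (induction j arbitrary: X)
  case (Suc j)
  let ?u = "real a / b"
  have u: "3 \<le> ?u" using assms by (simp add: field_simps)
  have "real (min n (X * a div b + 1)) \<le> real (X * a div b) + 1" by simp
  also have "\<dots> \<le> X * ?u + 1" using real_div_bounds(1)[of "X * a" b] by simp
  finally have Y: "real (min n (X * a div b + 1)) \<le> X * ?u + 1" .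
  have "x + 1 / 2 \<le> y + v / 2" if "x \<le> y + 1" "3 \<le> v" for x y v :: real
    using that by linarith
  from this[OF Y u] have "real (min n (X * a div b + 1)) + 1 / 2 \<le> X * ?u + ?u / 2" .
  also have "\<dots> = (X + 1 / 2) * ?u" by (simp only: distrib_right) simp
  finally have "real (min n (X * a div b + 1)) + 1 / 2 \<le> (X + 1 / 2) * ?u" .
  then have "(real (min n (X * a div b + 1)) + 1 / 2) * ?u ^ j \<le> (X + 1 / 2) * ?u * ?u ^ j"
    using u by (intro mult_right_mono) auto
  with Suc.IH[of "min n (X * a div b + 1)"] show ?case by (simp add: mult.assoc)
qed simp

text \<open>Rounding up keeps the value above the exact power until it hits \<open>n\<close>, where
  it remains.\<close>

lemma capped_reps_ge:
  assumes "0 < b" "3 * b \<le> a" "1 \<le> X" "X \<le> n"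
  shows "capped_reps a b n j X = n \<or> X * (real a / b) ^ j \<le> capped_reps a b n j X"
  using assms(3,4)
proof (induction j arbitrary: X)
  case (Suc j)
  let ?u = "real a / b" and ?Y = "min n (X * a div b + 1)"
  have ind: "capped_reps a b n j ?Y = n \<or> ?Y * ?u ^ j \<le> capped_reps a b n j ?Y"
    using Suc.prems by (intro Suc.IH) auto
  show ?case
  proof (cases "n \<le> X * a div b + 1")
    case True
    have "capped_reps a b n i n = n" for i
    proof (induction i)
      case (Suc i)
      have "n \<le> n * a div b + 1"
      proof -
        have "n * b \<le> n * a" using assms(2) by (intro mult_le_mono2) simp
        then have "n \<le> n * a div b" using assms(1) by (simp add: less_eq_div_iff_mult_less_eq)
        then show ?thesis by simp
      qed
      then show ?case using Suc by (simp add: min_absorb1)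
    qed simp
    then show ?thesis using True by (simp add: min_absorb1)
  next
    case False
    have "real X * ?u \<le> real (X * a div b) + 1" using real_div_bounds(2)[OF assms(1), of "X * a"] by simp
    also have "\<dots> = real ?Y" using False by simp
    finally have "X * ?u * ?u ^ j \<le> ?Y * ?u ^ j" using assms by (intro mult_right_mono) auto
    then show ?thesis using ind by (auto simp: mult.assoc)
  qed
qed simp

context parameters
begin

text \<open>For \<open>\<theta> = \<tau> / M\<close> this is \<open>1 / s\<close> of
  \<open>coll_upper\<close>, and three times it is \<open>1 / p\<close> of
  \<open>coll_lower\<close>.\<close>

definition rate :: "nat \<Rightarrow> real" where
  "rate \<tau> = real (4 * M - \<tau>) / (3 * real \<tau>)"

lemma M: "n \<le> M" "8 \<le> M" "n * n \<le> M"
proof -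
  show "8 \<le> M" using mult_le_mono[OF mult_le_mono[OF l(2) l(2)] l(2)] by (simp add: M_def)
  have "n * n * 1 \<le> N * N * N" using l(2,4) by (intro mult_le_mono) auto
  then show nn: "n * n \<le> M" by (simp add: M_def)
  have "n * 1 \<le> n * n" using n(1) by (intro mult_le_mono) auto
  with nn show "n \<le> M" by linarith
qed

lemma rate_ge_1: "0 < \<tau> \<Longrightarrow> \<tau> \<le> M \<Longrightarrow> 1 \<le> rate \<tau>"
  by (simp add: rate_def field_simps of_nat_diff)

lemma not_small_rate:
  assumes "0 < \<tau>" "\<not> small \<tau>"
  shows "n \<le> rate \<tau> ^ Suc K"
proof -
  have X0: "0 < X0" using l(2) by (simp add: X0_def)
  have "real (n * X0) \<le> capped_power (4 * M - \<tau>) (3 * \<tau>) (n * X0) (Suc K) X0"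
    using assms(2) unfolding small_def of_nat_le_iff by simp
  also have "\<dots> \<le> X0 * rate \<tau> ^ Suc K"
    using capped_power_le[of "3 * \<tau>" "4 * M - \<tau>" "n * X0" "Suc K" X0] assms(1) by (simp add: rate_def)
  finally show ?thesis using X0 by (simp add: field_simps)
qed

text \<open>A converse of \<open>not_small_rate\<close>, with a factor 2 lost to rounding; at \<tau>
  = M the ratio is 1.\<close>

lemma small_rate:
  assumes "0 < \<tau>" "\<tau> \<le> M" "small \<tau> \<or> \<tau> = M" "2 * d \<le> X0"
  shows "rate \<tau> ^ Suc K \<le> 2 * n"
proof (cases "\<tau> = M")
  case True
  then have "rate \<tau> = 1" using assms(1) by (simp add: rate_def)
  then show ?thesis using n(1) by simp
next
  case False
  then have small: "small \<tau>" using assms(3) by simp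
  have X0: "0 < X0" using l(2) by (simp add: X0_def)
  have K: "2 * Suc K \<le> X0" using r(2) assms(4) by (simp add: K_def)
  have "(real X0 - Suc K) * rate \<tau> ^ Suc K \<le> capped_power (4 * M - \<tau>) (3 * \<tau>) (n * X0) (Suc K) X0"
    using capped_power_ge[of "3 * \<tau>" "4 * M - \<tau>" "n * X0" "Suc K" X0] assms(1,2) small
    by (simp add: rate_def small_def del: capped_power.simps)
  also have "\<dots> \<le> real (n * X0)" using small unfolding small_def of_nat_le_iff by simp
  finally have *: "(real X0 - Suc K) * rate \<tau> ^ Suc K \<le> real n * X0" by simp
  have "X0 / 2 * rate \<tau> ^ Suc K \<le> (real X0 - Suc K) * rate \<tau> ^ Suc K"
    using K rate_ge_1[OF assms(1,2)] by (intro mult_right_mono) auto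
  also note *
  also have "real n * X0 = X0 / 2 * (2 * real n)" by simp
  finally have "X0 / 2 * rate \<tau> ^ Suc K \<le> X0 / 2 * (2 * real n)" .
  then show ?thesis using X0 by (simp add: mult_le_cancel_left_pos del: power_Suc)
qed

text \<open>Numerator and denominator each change by a factor of at most
  \<open>1 + 1 / \<tau>\<close>.\<close>

lemma rate_step:
  assumes "0 < \<tau>" "\<tau> < M"
  shows "rate \<tau> \<le> rate (Suc \<tau>) * (1 + 1 / \<tau>) ^ 2"
proof -
  define a where "a = 4 * real M - \<tau> - 1"
  have a: "real \<tau> \<le> a" "0 < a" using assms by (simp_all add: a_def)
  have 1: "rate \<tau> = (a + 1) / (3 * \<tau>)" "rate (Suc \<tau>) = a / (3 * (\<tau> + 1))"
    using assms by (simp_all add: rate_def a_def of_nat_diff algebra_simps)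
  have "(a + 1) / a \<le> 1 + 1 / \<tau>"
    using a assms(1) by (simp add: field_simps)
  then have "(a + 1) / a * (a / (3 * \<tau>)) \<le> (1 + 1 / \<tau>) * (a / (3 * \<tau>))"
    using a by (intro mult_right_mono) auto
  moreover have "a / (3 * \<tau>) = rate (Suc \<tau>) * (1 + 1 / \<tau>)"
    unfolding 1 using assms(1) by (simp add: divide_simps)
  moreover have "(a + 1) / a * (a / (3 * \<tau>)) = rate \<tau>" using a(2) by (simp add: 1)
  ultimately have "rate \<tau> \<le> (1 + 1 / \<tau>) * (rate (Suc \<tau>) * (1 + 1 / \<tau>))" by metis
  then show ?thesis by (simp only: power2_eq_square mult_ac)
qed

lemma r_le_K: "r \<le> K"
  using r l(1) by (simp add: K_def)

text \<open>At \<tau> itself only a lower bound is known; the upper bound comes from the next value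
  \<open>Suc \<tau>\<close>, where \<open>small_rate\<close> gives
  \<open>rate ^ Suc K \<le> 2 * n\<close>. Raising this to the power \<open>r / Suc K\<close> gives
  the form of the bound, and stepping back to \<tau> costs
  \<open>(1 + 1 / \<tau>) ^ (2 * r)\<close>, a constant.\<close>

lemma rate_power:
  assumes \<tau>: "0 < \<tau>" "\<tau> < M" "small (Suc \<tau>) \<or> Suc \<tau> = M" and X0: "2 * d \<le> X0" and rn: "r < n"
  shows "rate \<tau> ^ r \<le> 2 * exp 7 * n powr (r / Suc K)"
proof -
  let ?v = "rate (Suc \<tau>)"
  have v: "1 \<le> ?v" using \<tau> by (intro rate_ge_1) auto
  have vK: "?v ^ Suc K \<le> 2 * n" using \<tau> X0 by (intro small_rate) auto
  have "?v \<le> ?v ^ Suc K" using self_le_power[OF v, of "Suc K"] by simp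
  with vK have "?v \<le> 2 * n" by linarith
  \<comment> \<open>The bound \<open>2 * n\<close> on the ratio keeps \<tau> large: since
    \<open>n * n \<le> M\<close>, it is at least \<open>2 * n / 7\<close>. The exponent
    \<open>2 * r / \<tau>\<close> is therefore at most 7 when \<open>r < n\<close>.\<close>
  then have "4 * real M \<le> (6 * real n + 1) * (\<tau> + 1)"
    using \<tau>(2) by (simp add: rate_def of_nat_diff field_simps)
  also have "\<dots> \<le> 7 * real n * (2 * \<tau>)" using n(1) \<tau>(1) by (intro mult_mono) auto
  finally have "2 * real M \<le> 7 * (real n * \<tau>)" by (simp add: algebra_simps)
  moreover have "real n * n \<le> M" using M(3) by (metis of_nat_le_iff of_nat_mult)
  ultimately have "real n * (2 * n) \<le> real n * (7 * \<tau>)" by simp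
  then have nt: "2 * real n \<le> 7 * \<tau>" using n(1) by simp
  have "(1 + 1 / real \<tau>) ^ (2 * r) \<le> exp (1 / \<tau>) ^ (2 * r)"
    by (intro power_mono exp_ge_add_one_self) auto
  also have "\<dots> = exp (2 * r / \<tau>)" by (simp flip: exp_of_nat_mult)
  also have "\<dots> \<le> exp 7" using nt rn \<tau>(1) by (simp add: field_simps)
  finally have e7: "(1 + 1 / real \<tau>) ^ (2 * r) \<le> exp 7" .
  have "rate \<tau> ^ r \<le> (?v * (1 + 1 / \<tau>) ^ 2) ^ r"
    using rate_step[OF \<tau>(1,2)] rate_ge_1[of \<tau>] \<tau> by (intro power_mono) auto
  also have "\<dots> = ?v ^ r * (1 + 1 / real \<tau>) ^ (2 * r)" by (simp add: power_mult_distrib power_mult)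
  also have "\<dots> \<le> ?v ^ r * exp 7" using e7 v by (intro mult_left_mono) auto
  also have "?v ^ r = (?v ^ Suc K) powr (r / Suc K)"
    using v by (simp add: powr_powr flip: powr_realpow del: power_Suc)
  also have "\<dots> \<le> (2 * n) powr (r / Suc K)" using vK v by (intro powr_mono2) auto
  also have "\<dots> = 2 powr (r / Suc K) * n powr (r / Suc K)" by (simp add: powr_mult)
  also have "\<dots> \<le> 2 powr 1 * n powr (r / Suc K)"
    using r_le_K by (intro mult_right_mono powr_mono) auto
  finally show ?thesis by (simp add: mult_ac)
qed

lemma reps_bounds:
  assumes "0 < \<tau>" "\<tau> < M"
  shows "reps \<tau> \<le> n" "1 \<le> reps \<tau>" "reps \<tau> \<noteq> n \<Longrightarrow> (3 * rate \<tau>) ^ r \<le> reps \<tau>"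
    "reps \<tau> \<le> 3 / 2 * (3 * rate \<tau>) ^ r"
proof -
  have Y: "real (4 * M - \<tau>) / \<tau> = 3 * rate \<tau>" by (simp add: rate_def)
  have 3: "3 * \<tau> \<le> 4 * M - \<tau>" using assms by simp
  show "reps \<tau> \<le> n" unfolding reps_def using n(1) by (rule capped_reps_le_cap)
  show ge: "reps \<tau> \<noteq> n \<Longrightarrow> (3 * rate \<tau>) ^ r \<le> reps \<tau>"
    using capped_reps_ge[OF assms(1) 3, of 1 n r] n(1) by (auto simp: reps_def Y)
  show "reps \<tau> \<le> 3 / 2 * (3 * rate \<tau>) ^ r"
    using capped_reps_le[OF assms(1) 3, of n r 1] by (simp add: reps_def Y)
  have "1 \<le> (3 * rate \<tau>) ^ r" using rate_ge_1[of \<tau>] assms by (intro one_le_power) auto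
  with ge n(1) show "1 \<le> reps \<tau>" by (cases "reps \<tau> = n") auto
qed

lemma reps_le:
  assumes \<tau>: "0 < \<tau>" "\<tau> < M" "small (Suc \<tau>) \<or> Suc \<tau> = M" and X0: "2 * d \<le> X0"
  shows "reps \<tau> \<le> 3 * exp 7 * 3 ^ r * n powr (r / Suc K)"
proof (cases "r < n")
  case True
  have "real (reps \<tau>) \<le> 3 / 2 * (3 ^ r * rate \<tau> ^ r)"
    using reps_bounds(4)[OF \<tau>(1,2)] by (simp add: power_mult_distrib)
  also have "\<dots> \<le> 3 / 2 * (3 ^ r * (2 * exp 7 * n powr (r / Suc K)))"
    using rate_power[OF \<tau> X0 True] by (intro mult_left_mono) auto
  finally show ?thesis by (simp add: mult_ac)
next
  \<comment> \<open>For \<open>r \<ge> n\<close> the cap \<open>n\<close> is itself below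
    \<open>3 ^ r\<close>.\<close>
  case False
  have "real (reps \<tau>) \<le> real n" using reps_bounds(1)[OF \<tau>(1,2)] by simp
  also have "\<dots> \<le> real r" using False by simp
  also have "\<dots> \<le> 3 ^ r" using of_nat_less_two_power[of r, where ?'a = real] power_mono[of 2 3 r] by (smt (verit))
  also have "\<dots> \<le> 3 * exp 7 * (3 ^ r * n powr (r / Suc K))"
  proof -
    have "1 \<le> n powr (r / Suc K)" using n(1) by (intro ge_one_powr_ge_zero) auto
    then have "3 ^ r * 1 \<le> 3 ^ r * n powr (r / Suc K)" by (intro mult_left_mono) auto
    moreover have "(1::real) * (3 ^ r * n powr (r / Suc K)) \<le> 3 * exp 7 * (3 ^ r * n powr (r / Suc K))"
      by (intro mult_right_mono) (use exp_ge_add_one_self[of "7::real"] in auto)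
    ultimately show ?thesis by simp
  qed
  finally show ?thesis by (simp add: mult.assoc)
qed

lemma powr_le:
  assumes "1 \<le> c" "K0 = nat \<lfloor>c * real r\<rfloor>"
  shows "n powr (r / Suc K) \<le> 2 * n powr (1 / c)"
proof (cases "K0 \<le> r * l")
  case True
  then have "K = K0" by (simp add: K_def)
  moreover have "c * r \<le> real K0 + 1" unfolding assms(2) by linarith
  ultimately have "c * r \<le> Suc K" by simp
  then have "r / Suc K \<le> 1 / c" using assms(1) by (simp add: field_simps)
  then have "n powr (r / Suc K) \<le> n powr (1 / c)" using n(1) by (intro powr_mono) auto
  then show ?thesis using powr_ge_zero[of n "1 / c"] by linarith
next
  case False
  \<comment> \<open>Here \<open>K = r * l\<close>, so the exponent is at most \<open>1 / l\<close>
    and the power at most 2, whatever \<open>c\<close> is.\<close>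
  have "n powr (r / Suc K) \<le> n powr (1 / l)"
  proof (rule powr_mono)
    have "0 < 1 + real l * r" by (simp add: add_pos_nonneg)
    then show "r / Suc K \<le> 1 / l" using False l(1) by (simp add: K_def field_simps)
  qed (use n(1) in simp)
  also have "\<dots> \<le> (2 ^ l) powr (1 / l)"
    using n(2) by (intro powr_mono2) (auto simp: less_imp_le)
  also have "\<dots> = 2" using l(1) by (simp add: powr_powr flip: powr_realpow)
  also have "\<dots> \<le> 2 * n powr (1 / c)"
    using n(1) assms(1) by (simp add: ge_one_powr_ge_zero)
  finally show ?thesis .
qed

end

section \<open>Failure probability\<close>

definition block :: "nat \<Rightarrow> nat list \<Rightarrow> nat \<Rightarrow> nat list" where
  "block m vs k = take m (drop (k * m) vs)"

lemma concat_blocks: "length vs = R * m \<Longrightarrow> concat (map (block m vs) [0..<R]) = vs"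
proof (induction R arbitrary: vs)
  case (Suc R)
  have "concat (map (block m (drop m vs)) [0..<R]) = drop m vs"
    using Suc.prems by (intro Suc.IH) simp
  moreover have "map (block m vs) [0..<Suc R] = take m vs # map (block m (drop m vs)) [0..<R]"
    by (rule nth_equalityI)
      (auto simp: nth_Cons block_def add.commute split: nat.split simp del: upt_Suc)
  ultimately show ?case by (simp del: upt_Suc)
qed simp

lemma block_tapes: "vs \<in> tapes w (R * m) \<Longrightarrow> k < R \<Longrightarrow> block m vs k \<in> tapes w m"
proof -
  assume vs: "vs \<in> tapes w (R * m)" and k: "k < R"
  have "Suc k * m \<le> R * m" using k by (intro mult_le_mono1) simp
  then show ?thesis using vs
    by (auto simp: tapes_def block_def dest: in_set_takeD in_set_dropD)
qed

text \<open>Independence of the seeds of different tables.\<close>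

lemma expect_blocks:
  "expect w (R * m) (\<lambda>vs. \<Prod>k<R. f k (block m vs k)) = (\<Prod>k<R. expect w m (f k))"
proof (induction R arbitrary: f)
  case (Suc R)
  have "expect w (Suc R * m) (\<lambda>vs. \<Prod>k<Suc R. f k (block m vs k)) =
      expect w m (\<lambda>xs. expect w (R * m) (\<lambda>ys. \<Prod>k<Suc R. f k (block m (xs @ ys) k)))"
    by (simp add: expect_append)
  also have "\<dots> = expect w m (\<lambda>xs. expect w (R * m) (\<lambda>ys. f 0 xs * (\<Prod>k<R. f (Suc k) (block m ys k))))"
    by (intro expect_cong) (auto simp: prod.lessThan_Suc_shift tapes_def block_def simp del: prod.lessThan_Suc)
  also have "\<dots> = (\<Prod>k<Suc R. expect w m (f k))"
    using Suc.IH[of "\<lambda>k. f (Suc k)"]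
    by (simp add: expect_mult expect_mult_right prod.lessThan_Suc_shift del: prod.lessThan_Suc)
  finally show ?case .
qed simp

lemma expect_block:
  assumes "k < R"
  shows "expect w (R * m) (\<lambda>vs. f (block m vs k)) = expect w m f"
proof -
  have "(\<Prod>k'<R. (if k' = k then f else (\<lambda>_. 1)) (block m vs k')) = f (block m vs k)" for vs
    using assms by (simp add: if_distrib[of "\<lambda>g. g _"] cong: if_cong)
  moreover have "(\<Prod>k'<R. expect w m (if k' = k then f else (\<lambda>_. 1))) = expect w m f"
    using assms by (simp add: if_distrib cong: if_cong)
  ultimately show ?thesis
    using expect_blocks[of w R m "\<lambda>k'. if k' = k then f else (\<lambda>_. 1)"] by simp
qed

text \<open>With hit probability \<open>p\<close> satisfying \<open>R * p \<ge> 1\<close>, all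
  tables miss the near string with probability at most \<open>exp (- (R * p))\<close>, hence at most
  1/2. The expected number of false candidates is at most \<open>3 * R\<close>, so by Markov's
  inequality \<open>12 * R\<close> of them occur with probability at most 1/4.\<close>

lemma failure_probability:
  fixes hit :: "'a \<Rightarrow> nat list \<Rightarrow> bool"
  assumes near: "1 \<le> R * expect w m (\<lambda>x. of_bool (hit j0 x))"
    and far: "\<And>j. j \<in> F \<Longrightarrow> expect w m (\<lambda>x. of_bool (hit j x)) \<le> 3 / n"
    and F: "finite F" "card F \<le> n" and L: "12 * R \<le> L" and n: "0 < n"
  shows "expect w (R * m) (\<lambda>vs. of_bool ((\<forall>k<R. \<not> hit j0 (block m vs k)) \<or>
    L \<le> card {(k, j). k < R \<and> j \<in> F \<and> hit j (block m vs k)})) \<le> 3 / 4"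
proof -
  let ?p = "expect w m (\<lambda>x. of_bool (hit j0 x))"
  let ?A = "\<lambda>vs. \<forall>k<R. \<not> hit j0 (block m vs k)"
  let ?C = "\<lambda>vs. {(k, j). k < R \<and> j \<in> F \<and> hit j (block m vs k)}"
  have R: "0 < R" using near by (cases R) auto
  have "expect w (R * m) (\<lambda>vs. of_bool (?A vs)) =
      expect w (R * m) (\<lambda>vs. \<Prod>k<R. 1 - of_bool (hit j0 (block m vs k)))"
  proof (rule expect_cong)
    fix vs
    show "of_bool (?A vs) = (\<Prod>k<R. 1 - of_bool (hit j0 (block m vs k)) :: real)"
    proof (cases "?A vs")
      case False
      then obtain k where "k < R" "hit j0 (block m vs k)" by blast
      then have "(\<Prod>k<R. 1 - of_bool (hit j0 (block m vs k)) :: real) = 0"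
        by (intro prod_zero) auto
      then show ?thesis using False by simp
    qed simp
  qed
  also have "\<dots> = (1 - ?p) ^ R"
    using expect_add[of w m "\<lambda>_. 1" "\<lambda>x. - 1 * of_bool (hit j0 x)"]
      expect_mult[of w m "- 1" "\<lambda>x. of_bool (hit j0 x)"]
    by (subst expect_blocks[of w R m "\<lambda>_ x. 1 - of_bool (hit j0 x)"]) simp
  also have "\<dots> \<le> exp (- ?p) ^ R"
  proof (rule power_mono)
    show "0 \<le> 1 - ?p" using expect_mono[of w m "\<lambda>x. of_bool (hit j0 x)" "\<lambda>_. 1"] by simp
    show "1 - ?p \<le> exp (- ?p)" using exp_ge_add_one_self[of "- ?p"] by simp
  qed
  also have "\<dots> = exp (- (R * ?p))" using exp_of_nat_mult[of R "- ?p"] by simp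
  also have "\<dots> \<le> exp (- 1)" using near by simp
  also have "\<dots> \<le> 1 / 2"
  proof -
    have "2 \<le> exp (1::real)" using exp_ge_add_one_self[of "1::real"] by simp
    then have "inverse (exp (1::real)) \<le> inverse 2" by (intro le_imp_inverse_le) auto
    then show ?thesis by (simp add: exp_minus)
  qed
  finally have A: "expect w (R * m) (\<lambda>vs. of_bool (?A vs)) \<le> 1 / 2" .
  have "expect w (R * m) (\<lambda>vs. of_bool (L \<le> card (?C vs))) \<le>
      expect w (R * m) (\<lambda>vs. 1 / L * (\<Sum>k<R. \<Sum>j\<in>F. of_bool (hit j (block m vs k))))"
  proof (rule expect_mono)
    fix vs
    have "?C vs = Sigma {..<R} (\<lambda>k. {j \<in> F. hit j (block m vs k)})" by auto
    then have "card (?C vs) = (\<Sum>k<R. card {j \<in> F. hit j (block m vs k)})"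
      using F(1) by simp
    then have eq: "real (card (?C vs)) = (\<Sum>k<R. \<Sum>j\<in>F. of_bool (hit j (block m vs k)))"
      using F(1) by (simp add: of_bool_def sum.If_cases Int_def)
    \<comment> \<open>Markov's inequality, pointwise.\<close>
    have "of_bool (L \<le> x) \<le> 1 / L * real x" for x :: nat
      using L R by (cases "L \<le> x") (simp_all add: field_simps)
    from this[of "card (?C vs)"] show "of_bool (L \<le> card (?C vs)) \<le>
        1 / L * (\<Sum>k<R. \<Sum>j\<in>F. of_bool (hit j (block m vs k)) :: real)"
      unfolding eq .
  qed
  also have "\<dots> = 1 / L * (\<Sum>k<R. \<Sum>j\<in>F. expect w m (\<lambda>x. of_bool (hit j x)))"
    unfolding expect_mult expect_sum
  proof (rule arg_cong[of _ _ "\<lambda>x. 1 / L * x"], rule sum.cong[OF refl], rule sum.cong[OF refl])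
    fix k j assume "k \<in> {..<R}"
    then show "expect w (R * m) (\<lambda>vs. of_bool (hit j (block m vs k))) = expect w m (\<lambda>x. of_bool (hit j x))"
      by (intro expect_block) simp
  qed
  also have "\<dots> \<le> 1 / L * (\<Sum>k<R. \<Sum>j\<in>F. 3 / n)"
    using far by (intro mult_left_mono sum_mono) auto
  also have "\<dots> = real R * (real (card F) * 3 / n) / L" by simp
  also have "\<dots> \<le> 1 / 4"
  proof -
    have "real (card F) * 3 / n \<le> 3" using F(2) n by (simp add: field_simps)
    then have "real R * (real (card F) * 3 / n) \<le> real R * 3" by (intro mult_left_mono) auto
    also have "real R * 3 \<le> real L / 4" using L by linarith
    finally have "real R * (real (card F) * 3 / n) \<le> real L / 4" .
    moreover have "0 < real L" using L R by simp
    ultimately show ?thesis by (subst pos_divide_le_eq) simp_all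
  qed
  finally have C: "expect w (R * m) (\<lambda>vs. of_bool (L \<le> card (?C vs))) \<le> 1 / 4" .
  have "expect w (R * m) (\<lambda>vs. of_bool (?A vs \<or> L \<le> card (?C vs))) \<le>
      expect w (R * m) (\<lambda>vs. of_bool (?A vs) + of_bool (L \<le> card (?C vs)))"
    by (rule expect_mono) auto
  with A C show ?thesis by (simp add: expect_add)
qed

section \<open>Assembly of the data structure and its correctness\<close>

context tables
begin

lemma serve_queries:
  assumes "mem_ok (mem s)" "regs_ok (regs s)" "\<forall>x\<in>set (qs @ [q]). length x \<le> d \<and> fits B x"
  shows "\<exists>s'. serve w m (R * cost_table + L * cost_string + 20) query s (qs @ [q]) s' \<and>
    mem_ok (mem s') \<and> outcome q (regs s' 0)"
  using assms
proof (induction qs arbitrary: s)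
  case Nil
  then obtain t s' where "exec w m query (s\<lparr>mem := store_string 0 q (mem s)\<rparr>) t s'"
    "mem_ok (mem s')" "outcome q (regs s' 0)" "t \<le> R * cost_table + L * cost_string + 20"
    using query[of q s] unfolding wp_def by auto
  moreover from this have "real t \<le> real (R * cost_table + L * cost_string + 20)" by linarith
  ultimately show ?case by (auto intro!: exI[of _ s'] serve.intros)
next
  case (Cons x qs)
  then obtain t s1 where 1: "exec w m query (s\<lparr>mem := store_string 0 x (mem s)\<rparr>) t s1"
    "mem_ok (mem s1)" "regs_ok (regs s1)" "t \<le> R * cost_table + L * cost_string + 20"
    using query[of x s] unfolding wp_def by auto
  obtain s' where "serve w m (R * cost_table + L * cost_string + 20) query s1 (qs @ [q]) s'"
    "mem_ok (mem s')" "outcome q (regs s' 0)"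
    using Cons.IH[OF 1(2,3)] Cons.prems(3) by auto
  moreover have "real t \<le> real (R * cost_table + L * cost_string + 20)" using 1(4) by linarith
  ultimately show ?case using serve.query[OF 1(1)] by (intro exI[of _ s']) simp
qed

end

text \<open>The threshold in register 4 is cut off at \<open>d\<close>, so equality with
  \<open>d\<close> detects the trivial case, where nothing has to be built.\<close>

definition prep :: "nat \<Rightarrow> prog" where
  "prep e = seq [Copy 5 0, Const 19 1, Op Equal 6 4 1,
     Cond 6 Skip (seq [sizes e, rates e, addresses e, build_loop])]"

context parameters
begin

text \<open>The value that \<open>tau_loop\<close> finds, described without a run, so that space,
  query time and seed length are fixed before the tape is drawn.\<close>

definition tau :: nat where "tau = Max {\<tau>. 0 < \<tau> \<and> \<tau> < M \<and> \<not> small \<tau>}"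
definition R0 :: nat where "R0 = reps tau"
definition R :: nat where "R = (if R0 < n then R0 else 1)"
definition Nb :: nat where "Nb = (if R0 < n then N else 1)"
definition L :: nat where "L = (if R0 < n then 12 * R0 else n)"
definition th :: nat where "th = tau * 2 ^ ((10 * e + 7) * l)"
definition B :: nat where "B = l + e"
definition T :: nat where "T = 3 * (d + l + 1)"
definition D :: nat where "D = (n + 2) * (d + 1)"
definition TB :: nat where "TB = D + 2 * d + 3"
definition SL :: nat where "SL = T * Suc B"
definition stride :: nat where "stride = SL + Nb + n + 1"
definition query_time :: nat where
  "query_time = R * (T * (7 * B + 25) + 25) + L * (d * (22 * (2 * K + 1) + 9) + 16 * K + 75) + 20"
definition mm :: nat where "mm = TB + R * stride"

lemma tau_unique:
  assumes "0 < \<tau>" "\<tau> < M" "\<not> small \<tau>" "\<forall>\<tau>'. \<tau> < \<tau>' \<and> \<tau>' < M \<longrightarrow> small \<tau>'"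
  shows "\<tau> = tau"
  unfolding tau_def
proof (rule Max_eqI[symmetric])
  show "\<And>y. y \<in> {\<tau>. 0 < \<tau> \<and> \<tau> < M \<and> \<not> small \<tau>} \<Longrightarrow> y \<le> \<tau>"
    using assms(4) by (metis (mono_tags, lifting) mem_Collect_eq not_le)
qed (use assms in auto)

lemma tau: "0 < tau" "tau < M" "\<not> small tau" "small (Suc tau) \<or> Suc tau = M"
proof -
  let ?A = "{\<tau>. 0 < \<tau> \<and> \<tau> < M \<and> \<not> small \<tau>}"
  have "1 \<in> ?A" using not_small_1 M(2) by simp
  then have "tau \<in> ?A" unfolding tau_def by (intro Max_in) auto
  then show t: "0 < tau" "tau < M" "\<not> small tau" by auto
  show "small (Suc tau) \<or> Suc tau = M"
  proof (rule ccontr)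
    assume "\<not> ?thesis"
    then have "Suc tau \<in> ?A" using t by auto
    then have "Suc tau \<le> tau" unfolding tau_def by (intro Max_ge) auto
    then show False by simp
  qed
qed

lemma R0: "R0 \<le> n" "1 \<le> R0"
  using reps_bounds(1,2)[OF tau(1,2)] by (simp_all add: R0_def)

lemma small_sizes: "R \<le> G ^ 1" "L \<le> G ^ 3" "T \<le> G ^ 4" "mm \<le> G ^ 9" "R \<le> R0" "0 < R" "0 < L" "0 < Nb"
proof -
  have g: "N \<le> G ^ 1" "n \<le> G ^ 1" "e \<le> G ^ 1" "d \<le> G ^ 1" "l \<le> G ^ 1" "R0 \<le> G ^ 1"
    using G d R0 by simp_all
  show R: "R \<le> G ^ 1" using g(6) G(1) by (simp add: R_def)
  show "R \<le> R0" "0 < R" "0 < L" "0 < Nb"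
    using R0 n(1) l(2) by (auto simp: R_def L_def Nb_def)
  have "12 * R0 \<le> G ^ 2" using G_mult[OF small_const[of 12] g(6)] by (simp add: power2_eq_square)
  then show "L \<le> G ^ 3" using G_mono[of "12 * R0" 2 3] G_mono[OF g(2), of 3] by (simp add: L_def)
  have "d + l + 1 \<le> G ^ 3" using G_sum[OF G_sum[OF g(4,5), of 2] small_const[of 1], of 3] by simp
  from G_mult[OF small_const[of 3] this] show T: "T \<le> G ^ 4" by (simp add: T_def)
  have B: "Suc B \<le> G ^ 3" using G_sum[OF G_sum[OF g(5,3), of 2] small_const[of 1], of 3] by (simp add: B_def)
  have SL: "SL \<le> G ^ 7" using G_mult[OF T B] by (simp add: SL_def del: mult_Suc_right)
  have Nb: "Nb \<le> G ^ 1" using g(1) G(1) by (simp add: Nb_def)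
  have "Nb + n + 1 \<le> G ^ 3" using G_sum[OF G_sum[OF Nb g(2), of 2] small_const[of 1], of 3] by simp
  moreover have "G ^ 3 \<le> G ^ 7" using G(1) by (intro power_increasing) auto
  ultimately have "stride \<le> 2 * G ^ 7" using SL by (simp add: stride_def)
  then have "R * stride \<le> G * (2 * G ^ 7)" using R by (intro mult_le_mono) auto
  moreover have "G * (2 * G ^ 7) = 2 * G ^ 8" using power_Suc[of G 7] by simp
  ultimately have 1: "R * stride \<le> 2 * G ^ 8" by linarith
  have n2: "n + 2 \<le> G ^ 2" and d1: "d + 1 \<le> G ^ 2"
    using G_sum[OF g(2) small_const[of 2], of 2] G_sum[OF g(4) small_const[of 1], of 2] by simp_all
  have D: "D \<le> G ^ 4" using G_mult[OF n2 d1] by (simp add: D_def)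
  have "D + d + d + 3 \<le> G ^ 7"
    using G_sum[OF G_sum[OF G_sum[OF D g(4), of 5] g(4), of 6] small_const[of 3], of 7] by simp
  moreover have "G ^ 7 \<le> G ^ 8" using G(1) by (intro power_increasing) auto
  ultimately have "TB \<le> G ^ 8" by (simp add: TB_def)
  with 1 have "mm \<le> 3 * G ^ 8" by (simp add: mm_def)
  also have "\<dots> \<le> G * G ^ 8" using G(1) by (intro mult_le_mono1) simp
  also have "\<dots> = G ^ 9" using power_Suc[of G 8] by simp
  finally show "mm \<le> G ^ 9" .
qed

lemma tables_axioms:
  assumes S: "length S = n" "\<And>x. x \<in> set S \<Longrightarrow> length x \<le> d \<and> fits B x"
    and vs: "vs \<in> tapes w (R * SL)"
  shows "tables w mm n d B T R Nb L K S (block SL vs)"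
proof unfold_locales
  show "(n + 2) * (d + 1) + 2 * d + 3 + R * (T * Suc B + Nb + n + 1) \<le> mm"
    by (simp add: mm_def TB_def D_def stride_def SL_def)
  show "mm < 2 ^ w" using word[OF small_sizes(4)] by simp
  have "e < w"
  proof -
    have "(2::nat) ^ e < 2 ^ w" using word[of "2 ^ e" 1] G(6) by simp
    then show ?thesis by simp
  qed
  show "2 ^ B < (2::nat) ^ w"
  proof -
    have "(2::nat) ^ B = X0" by (simp add: B_def X0_def N_def power_add)
    then show ?thesis using word[of X0 1] G(5) by simp
  qed
  show "2 < B" using e by (simp add: B_def)
  show "K < d" using r(2) by (simp add: K_def)
  show "L < 2 ^ w" "T < 2 ^ w" "R < 2 ^ w"
    using word[OF small_sizes(2)] word[OF small_sizes(3)] word[OF small_sizes(1)] by simp_all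
  show "\<And>k. k < R \<Longrightarrow> block SL vs k \<in> tapes w (T * Suc B)"
    using block_tapes[OF vs] by (simp add: SL_def)
qed (use S small_sizes(6-8) in simp_all)

context
  fixes S :: "nat list list" and vs :: "nat list"
  assumes S: "length S = n" "\<And>x. x \<in> set S \<Longrightarrow> length x \<le> d \<and> fits B x"
    and vs: "vs \<in> tapes w (R * SL)"
begin

interpretation tab: tables w mm n d B T th R Nb L K S "block SL vs" D TB SL stride
  by (rule tables_axioms[OF S vs]) (simp_all only: D_def TB_def SL_def stride_def)

lemma prep_tables:
  assumes "min r' d = r" "min (nat \<lfloor>c * real r'\<rfloor>) d = K0"
  shows "wp w (2 ^ w) (prep e) (prep_input \<sigma> d c r' S vs)
    (\<lambda>_ s. tab.mem_ok (mem s) \<and> tab.regs_ok (regs s))"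
proof -
  define s0 where "s0 = prep_input \<sigma> d c r' S vs"
  define mem0 where "mem0 = mem s0"
  have r0: "regs s0 0 = n" "regs s0 1 = d" "regs s0 3 = r" "regs s0 4 = K0" "tape s0 = vs"
    using assms S(1) by (simp_all add: s0_def prep_input_def)
  have cell: "mem0 (j * (d + 1) + i) = store_string 0 (S ! (j - 1)) (\<lambda>_. 0) i"
    if "j \<in> {1..n}" "i \<le> d" for i j
  proof -
    have "(j * (d + 1) + i) div (d + 1) = j" "(j * (d + 1) + i) mod (d + 1) = i"
      using that(2) div_mult_self3[of "d + 1" j i] mod_mult_self3[of j "d + 1" i] by simp_all
    then show ?thesis using that(1) S(1) by (simp only: mem0_def s0_def prep_input_def Let_def) simp
  qed
  have strings: "tab.strings_ok mem0"
    unfolding tab.strings_ok_def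
  proof
    fix j assume j: "j \<in> {1..n}"
    have len: "length (tab.str j) \<le> d" by (rule tab.str_bounds(3)[OF j])
    show "holds_string mem0 (j * (d + 1)) (tab.str j)"
      using cell[OF j, of 0] cell[OF j, of "Suc _"] len
      by (simp add: holds_string_def tab.str_def store_string_def add.assoc)
  qed
  have zero: "\<forall>a\<ge>tab.table 0. mem0 a = 0"
  proof (intro allI impI)
    fix a assume "tab.table 0 \<le> a"
    then have "(n + 2) * (d + 1) \<le> a" by (simp add: tab.table_def TB_def D_def)
    then have "n + 2 \<le> a div (d + 1)" by (simp add: less_eq_div_iff_mult_less_eq)
    then show "mem0 a = 0" using S(1) by (simp add: mem0_def s0_def prep_input_def Let_def)
  qed
  have tape: "tape s0 = concat (map (block SL vs) [0..<R])"
    using concat_blocks[of vs R SL] vs r0(5) by (simp add: tapes_def)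
  have w: "0 < w" "n < 2 ^ w" "1 < (2::nat) ^ w" "K0 \<noteq> d"
    using word[of n 1] G word[OF small_const, of 1] r(2) by (cases w; simp)+
  have addr: "wp w (2 ^ w) (addresses e) u (\<lambda>_ s'. mem s' = mem0 \<and> tape s' = vs \<and>
      tab.regs_ok (regs s') \<and> regs s' 20 = TB \<and> regs s' 22 = R)"
    if u: "mem u = mem0" "tape u = vs" "regs u 1 = d" "regs u 5 = n" "regs u 6 = 0" "regs u 7 = l"
      "regs u 8 = N" "regs u 9 = l + e" "regs u 10 = 3 * (d + l + 1)" "regs u 15 = K" "regs u 19 = 1"
      "0 < regs u 21" "regs u 21 < M" "\<not> small (regs u 21)"
      "\<forall>\<tau>'. regs u 21 < \<tau>' \<and> \<tau>' < M \<longrightarrow> small \<tau>'" "regs u 12 = reps (regs u 21)" for u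
  proof -
    have t: "regs u 21 = tau" using u(12-15) by (rule tau_unique)
    then have "regs u 12 = R0" using u(16) by (simp add: R0_def)
    show ?thesis
      by (rule wp_mono[OF addresses[OF u(3-11) t \<open>regs u 12 = R0\<close> tau(2) R0(1)]])
        (unfold tab.regs_ok_def, use u(1,2) in \<open>simp add: Let_def R_def Nb_def L_def th_def B_def T_def D_def
          TB_def SL_def\<close>)
  qed
  have build: "wp w (2 ^ w) build_loop u (\<lambda>_ s. tab.mem_ok (mem s) \<and> tab.regs_ok (regs s))"
    if "mem u = mem0" "tape u = vs" "tab.regs_ok (regs u)" "regs u 20 = TB" "regs u 22 = R" for u
    by (rule wp_mono[OF tab.build_loop[of u 0 R]])
      (use that strings zero tape r0(5) in \<open>simp_all add: tab.table_def tab.regs_ok_def\<close>)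
  show ?thesis
    unfolding s0_def[symmetric] prep_def using r0 w
    apply simp
    apply (rule wp_mono[OF sizes]; simp)
    apply (rule wp_mono[OF rates]; simp)
    apply (rule wp_mono[OF addr]; simp add: mem0_def)
    apply (rule wp_mono[OF build]; simp add: mem0_def)
    done
qed

lemma structure_works:
  assumes "min r' d = r" "min (nat \<lfloor>c * real r'\<rfloor>) d = K0"
    and q: "\<forall>x\<in>set (qs @ [q]). length x \<le> d \<and> fits B x"
  shows "\<exists>t s s'. exec w (2 ^ w) (prep e) (prep_input \<sigma> d c r' S vs) t s \<and>
    serve w mm query_time query s (qs @ [q]) s' \<and>
    ((\<exists>y\<in>set S. ED q y \<le> K \<and> holds_string (mem s') (regs s' 0) y \<and> regs s' 0 + length y < mm) \<or>
      tab.failed q)"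
proof -
  obtain t s where s: "exec w (2 ^ w) (prep e) (prep_input \<sigma> d c r' S vs) t s"
    "tab.mem_ok (mem s)" "tab.regs_ok (regs s)"
    using prep_tables[OF assms(1,2)] unfolding wp_def by blast
  obtain s' where s': "serve w mm query_time query s (qs @ [q]) s'"
    "tab.mem_ok (mem s')" "tab.outcome q (regs s' 0)"
    using tab.serve_queries[OF s(2,3) q] unfolding query_time_def tab.cost_table_def tab.cost_string_def by blast
  have "\<exists>y\<in>set S. ED q y \<le> K \<and> holds_string (mem s') (regs s' 0) y \<and> regs s' 0 + length y < mm"
    if j: "j \<in> {1..n}" "regs s' 0 = j * (d + 1)" "ED q (tab.str j) \<le> K" for j
  proof (intro bexI conjI)
    show "tab.str j \<in> set S" by (rule tab.str_bounds(5)[OF j(1)])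
    show "ED q (tab.str j) \<le> K" by fact
    show "holds_string (mem s') (regs s' 0) (tab.str j)"
      using s'(2) j(1) unfolding j(2) tab.mem_ok_def by blast
    show "regs s' 0 + length (tab.str j) < mm"
      using tab.str_bounds(2,3)[OF j(1)] j(2) by (simp add: mm_def TB_def)
  qed
  with s'(3) have "(\<exists>y\<in>set S. ED q y \<le> K \<and> holds_string (mem s') (regs s' 0) y \<and>
      regs s' 0 + length y < mm) \<or> tab.failed q"
    unfolding tab.outcome_def by blast
  with s(1) s'(1) show ?thesis by blast
qed

text \<open>Turns the failure event into an explicit function of the tape. The interpretation exists
  only for a given tape of the right form, whereas probabilities need the event for all
  tapes.\<close>

lemma failed_iff:
  "tab.failed q \<longleftrightarrow>
    (\<forall>k<R. \<forall>j\<in>{1..n}. ED q (S ! (j - 1)) \<le> K \<longrightarrow>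
      fprint B th T (S ! (j - 1)) (block SL vs k) mod Nb \<noteq> fprint B th T q (block SL vs k) mod Nb) \<or>
    L \<le> card {(k, j). k < R \<and> j \<in> {j \<in> {1..n}. K < ED q (S ! (j - 1))} \<and>
      fprint B th T (S ! (j - 1)) (block SL vs k) mod Nb = fprint B th T q (block SL vs k) mod Nb}"
proof -
  have "{(k, j)\<in>tab.hits q R 0. K < ED q (tab.str j)} =
      {(k, j). k < R \<and> j \<in> {j \<in> {1..n}. K < ED q (S ! (j - 1))} \<and>
      fprint B th T (S ! (j - 1)) (block SL vs k) mod Nb = fprint B th T q (block SL vs k) mod Nb}"
    by (auto simp: tab.hits_def tab.str_def tab.bucket_def)
  moreover have m: "(k, j) \<in> tab.hits q R 0 \<longleftrightarrow> k < R \<and> j \<in> {1..n} \<and>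
      fprint B th T (S ! (j - 1)) (block SL vs k) mod Nb = fprint B th T q (block SL vs k) mod Nb" for k j
    by (auto simp: tab.hits_def tab.str_def tab.bucket_def)
  have "(\<forall>(k, j)\<in>tab.hits q R 0. K < ED q (tab.str j)) \<longleftrightarrow>
      (\<forall>k j. (k, j) \<in> tab.hits q R 0 \<longrightarrow> K < ED q (S ! (j - 1)))"
    by (auto simp: tab.str_def)
  then have "(\<forall>(k, j)\<in>tab.hits q R 0. K < ED q (tab.str j)) \<longleftrightarrow>
      (\<forall>k<R. \<forall>j\<in>{1..n}. ED q (S ! (j - 1)) \<le> K \<longrightarrow>
      fprint B th T (S ! (j - 1)) (block SL vs k) mod Nb \<noteq> fprint B th T q (block SL vs k) mod Nb)"
    unfolding m by (meson not_less)
  ultimately show ?thesis unfolding tab.failed_def by simp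
qed

end

end

section \<open>Time and space\<close>

text \<open>The factor \<open>3 * exp 7\<close> from \<open>reps_le\<close> times the 2 from
  \<open>powr_le\<close>.\<close>

definition rep_factor :: real where "rep_factor = 6 * exp 7"

lemma rep_factor_ge_1: "1 \<le> rep_factor"
  using exp_ge_add_one_self[of "7::real"] by (simp add: rep_factor_def)

text \<open>Walks have at most \<open>9 * d * l\<close> steps of cost at most
  \<open>(32 + 7 * e) * l\<close>; adding 25 for opening a table gives \<open>313 + 63 * e\<close>.
  The number 1272 is 12 false candidates per table times 106 for verification, and 20 is the fixed
  cost of a query.\<close>

definition time_factor :: "nat \<Rightarrow> real" where
  "time_factor e = rep_factor * (313 + 63 * e) + 1272 * (rep_factor + 1) + 20"

definition space_factor :: "nat \<Rightarrow> real" where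
  "space_factor e = 11 + rep_factor * (3 * (2 ^ e + 3) * (e + 2) + 4)"

lemma factors_nonneg: "0 \<le> time_factor e" "0 \<le> space_factor e"
  using rep_factor_ge_1 by (simp_all add: time_factor_def space_factor_def)

context parameters
begin

definition failure :: "nat list list \<Rightarrow> nat list \<Rightarrow> nat list \<Rightarrow> bool" where
  "failure S q vs \<longleftrightarrow>
    (\<forall>k<R. \<forall>j\<in>{1..n}. ED q (S ! (j - 1)) \<le> K \<longrightarrow>
      fprint B th T (S ! (j - 1)) (block SL vs k) mod Nb \<noteq> fprint B th T q (block SL vs k) mod Nb) \<or>
    L \<le> card {(k, j). k < R \<and> j \<in> {j \<in> {1..n}. K < ED q (S ! (j - 1))} \<and>
      fprint B th T (S ! (j - 1)) (block SL vs k) mod Nb = fprint B th T q (block SL vs k) mod Nb}"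

lemma theta: "th / 2 ^ w = tau / M" "th \<le> 2 ^ w"
proof -
  have w': "(2::nat) ^ w = M * 2 ^ ((10 * e + 7) * l)"
    unfolding w G_def M_def N_def by (simp flip: power_mult power_add add: algebra_simps)
  then have "(2::real) ^ w = real M * 2 ^ ((10 * e + 7) * l)"
    by (metis of_nat_mult of_nat_numeral of_nat_power)
  then show "th / 2 ^ w = tau / M" by (simp add: th_def)
  show "th \<le> 2 ^ w" unfolding w' th_def using tau(2) by (intro mult_le_mono1) simp
qed

lemma rates_of_theta:
  fixes \<theta> :: real
  assumes "\<theta> = tau / M"
  shows "\<theta> / (4 - \<theta>) = 1 / (3 * rate tau)" "3 * \<theta> / (4 - \<theta>) = 1 / rate tau"
proof -
  have "0 < real M" "real tau < M" "0 < real tau" using tau by simp_all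
  then show "\<theta> / (4 - \<theta>) = 1 / (3 * rate tau)" "3 * \<theta> / (4 - \<theta>) = 1 / rate tau"
    by (simp_all add: assms rate_def of_nat_diff field_simps)
qed

lemma wl: "0 < w" "l \<le> w"
proof -
  have "(2::nat) ^ w = 2 ^ (l * (e + 1) * 10)" unfolding w G_def by (simp only: power_mult)
  then have "w = l * (e + 1) * 10" by simp
  then show "0 < w" "l \<le> w" using l(1) by simp_all
qed

lemma bucket_iff: "a mod N = b mod N \<longleftrightarrow> take_bit l (b XOR a) = 0" for a b :: nat
proof -
  have "x XOR z = 0 \<longleftrightarrow> z = x" for x z :: nat
    by (metis xor.assoc xor.left_neutral xor.right_neutral xor_self_eq)
  then show ?thesis by (simp add: N_def take_bit_eq_mod[symmetric])
qed

lemma failure_probability_bound: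
  assumes S: "length S = n" "\<And>x. x \<in> set S \<Longrightarrow> length x \<le> d \<and> fits B x"
    and q: "length q \<le> d" "fits B q" and y: "y \<in> set S" "ED q y \<le> r"
  shows "expect w (R * SL) (\<lambda>vs. of_bool (failure S q vs)) \<le> 3 / 4"
proof -
  obtain i where i: "i < n" "S ! i = y" using y(1) S(1) by (auto simp: in_set_conv_nth)
  define j0 where "j0 = Suc i"
  have j0: "j0 \<in> {1..n}" "S ! (j0 - 1) = y" using i by (simp_all add: j0_def)
  define F where "F = {j \<in> {1..n}. K < ED q (S ! (j - 1))}"
  have F: "finite F" "card F \<le> n" "j0 \<notin> F"
  proof -
    have "F \<subseteq> {1..n}" by (auto simp: F_def)
    from card_mono[OF _ this] finite_subset[OF this] show "finite F" "card F \<le> n" by simp_all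
    show "j0 \<notin> F" using j0(2) y(2) r_le_K by (simp add: F_def)
  qed
  show ?thesis
  proof (cases "R0 < n")
    \<comment> \<open>The linear scan cannot fail: the near string is not a false candidate, so
      there are fewer than \<open>n\<close> of those.\<close>
    case False
    then have P: "R = 1" "Nb = 1" "L = n" by (simp_all add: R_def Nb_def L_def)
    have "\<not> failure S q vs" for vs
    proof
      assume "failure S q vs"
      moreover have "ED q (S ! (j0 - 1)) \<le> K" using j0(2) y(2) r_le_K by simp
      ultimately have "n \<le> card {(k, j). k < (1::nat) \<and> j \<in> F}"
        using j0(1) unfolding failure_def P F_def[symmetric] by (auto simp del: One_nat_def)
      also have "{(k, j). k < (1::nat) \<and> j \<in> F} = {0} \<times> F" by auto
      also have "card \<dots> = card F" by (simp add: card_cartesian_product)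
      also have "\<dots> \<le> card ({1..n} - {j0})" using F(3) by (intro card_mono) (auto simp: F_def)
      also have "\<dots> < n" using j0(1) by simp
      finally show False by simp
    qed
    then show ?thesis by simp
  next
    case True
    then have P: "R = R0" "Nb = N" "L = 12 * R0" by (simp_all add: R_def Nb_def L_def)
    have u: "1 \<le> rate tau" using tau by (intro rate_ge_1) auto
    define hit where "hit j v \<longleftrightarrow> fprint B th T (S ! (j - 1)) v mod N = fprint B th T q v mod N" for j v
    have coll: "expect w SL (\<lambda>v. of_bool (hit j v)) = coll w l B th T q (S ! (j - 1))" for j
      by (simp add: coll_def hit_def bucket_iff SL_def)
    have SF: "length (S ! (j - 1)) \<le> d" "fits B (S ! (j - 1))" if "j \<in> {1..n}" for j
      using S that by auto
    have near: "1 \<le> R * expect w SL (\<lambda>v. of_bool (hit j0 v))"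
    proof -
      have "(1 / (3 * rate tau)) ^ r \<le> (1 / (3 * rate tau)) ^ ED q y"
        using y(2) u by (intro power_decreasing) auto
      also have "\<dots> \<le> coll w l B th T q y"
        using coll_lower[OF theta(2) wl q(2) SF(2)[OF j0(1)], of T]
        unfolding rates_of_theta(1)[OF theta(1)] j0(2) .
      finally have "(1 / (3 * rate tau)) ^ r \<le> expect w SL (\<lambda>v. of_bool (hit j0 v))"
        unfolding coll j0(2) .
      moreover have "(3 * rate tau) ^ r \<le> R"
        using reps_bounds(3)[OF tau(1,2)] True by (simp add: P R0_def)
      ultimately have "(3 * rate tau) ^ r * (1 / (3 * rate tau)) ^ r \<le> R * expect w SL (\<lambda>v. of_bool (hit j0 v))"
        using u by (intro mult_mono) auto
      moreover have "(3 * rate tau) ^ r * (1 / (3 * rate tau)) ^ r = 1"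
      proof -
        have "3 * rate tau * (1 / (3 * rate tau)) = 1" using u by simp
        then show ?thesis by (simp only: power_mult_distrib[symmetric] power_one)
      qed
      ultimately show ?thesis by linarith
    qed
    \<comment> \<open>Three contributions of at most \<open>1 / n\<close> each: survival at a
      distance above \<open>K\<close>, accidental agreement, and unfinished walks.\<close>
    have far: "expect w SL (\<lambda>v. of_bool (hit j v)) \<le> 3 / n" if "j \<in> F" for j
    proof -
      let ?z = "S ! (j - 1)"
      have j: "j \<in> {1..n}" "Suc K \<le> ED q ?z" using that by (auto simp: F_def)
      have n0: "0 < real n" using n(1) by simp
      have nl: "1 / 2 ^ l \<le> 1 / real n"
        using n(1,2) by (intro divide_left_mono) (auto simp: less_imp_le)
      have "(1 / rate tau) ^ ED q ?z \<le> (1 / rate tau) ^ Suc K"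
        using j(2) u by (intro power_decreasing) auto
      also have "\<dots> = 1 / rate tau ^ Suc K" by (simp add: power_divide)
      also have "\<dots> \<le> 1 / n"
        using not_small_rate[OF tau(1,3)] n0 by (intro divide_left_mono mult_pos_pos) linarith+
      finally have 1: "(1 / rate tau) ^ ED q ?z \<le> 1 / n" .
      have "((2 ^ length q - 1) + (2 ^ length ?z - 1)) * (3 / 4 :: real) ^ T \<le>
          (2 ^ d + 2 ^ d) * (3 / 4) ^ T"
      proof (rule mult_right_mono)
        have "(2::real) ^ length q \<le> 2 ^ d" "(2::real) ^ length ?z \<le> 2 ^ d"
          using q(1) SF(1)[OF j(1)] by (intro power_increasing; simp)+
        then show "(2 ^ length q - 1) + (2 ^ length ?z - 1) \<le> (2 ^ d + 2 ^ d :: real)" by linarith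
      qed simp
      also have "\<dots> \<le> (2 ^ d + 2 ^ d) * (1 / 2) ^ (d + l + 1)"
      proof (rule mult_left_mono)
        \<comment> \<open>Because \<open>(3 / 4) ^ 3 \<le> 1 / 2\<close>, three times
          \<open>d + l + 1\<close> steps bring the potential of at most \<open>2 ^ (d + 1)\<close>
          down to \<open>1 / 2 ^ l\<close>.\<close>
        have "(3 / 4 :: real) ^ T = ((3 / 4) ^ 3) ^ (d + l + 1)" by (simp only: T_def power_mult)
        also have "\<dots> \<le> (1 / 2) ^ (d + l + 1)" by (intro power_mono) (simp_all add: power3_eq_cube)
        finally show "(3 / 4 :: real) ^ T \<le> (1 / 2) ^ (d + l + 1)" .
      qed simp
      also have "(2 ^ d + 2 ^ d) * (1 / 2 :: real) ^ (d + l + 1) = 1 / 2 ^ l"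
        by (simp add: power_add power_divide)
      finally have 2: "((2 ^ length q - 1) + (2 ^ length ?z - 1)) * (3 / 4 :: real) ^ T \<le> 1 / 2 ^ l" .
      have "coll w l B th T q ?z \<le> 1 / n + 1 / n + 1 / n"
        using coll_upper[OF theta(2) wl q(2) SF(2)[OF j(1)], of T] 1 2 nl
        unfolding rates_of_theta(2)[OF theta(1)] by linarith
      then show ?thesis by (simp add: coll)
    qed
    have "expect w (R * SL) (\<lambda>vs. of_bool (failure S q vs)) \<le>
      expect w (R * SL) (\<lambda>vs. of_bool ((\<forall>k<R. \<not> hit j0 (block SL vs k)) \<or>
        L \<le> card {(k, j). k < R \<and> j \<in> F \<and> hit j (block SL vs k)}))"
    proof (rule expect_mono)
      fix vs
      have "failure S q vs \<Longrightarrow> (\<forall>k<R. \<not> hit j0 (block SL vs k)) \<or>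
        L \<le> card {(k, j). k < R \<and> j \<in> F \<and> hit j (block SL vs k)}"
      proof -
        assume "failure S q vs"
        moreover have "ED q (S ! (j0 - 1)) \<le> K" using j0(2) y(2) r_le_K by simp
        ultimately show ?thesis
          using j0(1) unfolding failure_def hit_def P(2) F_def[symmetric] by blast
      qed
      then show "of_bool (failure S q vs) \<le> (of_bool ((\<forall>k<R. \<not> hit j0 (block SL vs k)) \<or>
        L \<le> card {(k, j). k < R \<and> j \<in> F \<and> hit j (block SL vs k)}) :: real)"
        by (cases "failure S q vs") simp_all
    qed
    also have "\<dots> \<le> 3 / 4"
      by (rule failure_probability[where n = n]) (use near far F(1,2) n(1) P in auto)
    finally show ?thesis .
  qed
qed

context
  fixes c :: real
  assumes c: "1 \<le> c" "K0 = nat \<lfloor>c * real r\<rfloor>" and X0: "2 * d \<le> X0"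
begin

definition Z :: real where "Z = 3 ^ r * n powr (1 / c)"

lemma Z: "3 ^ r \<le> Z" "1 \<le> Z" "R0 \<le> rep_factor * Z"
proof -
  have "1 \<le> n powr (1 / c)" using n(1) c(1) by (intro ge_one_powr_ge_zero) auto
  then have "3 ^ r * 1 \<le> Z" unfolding Z_def by (intro mult_left_mono) auto
  then show "3 ^ r \<le> Z" by simp
  moreover have "(1::real) \<le> 3 ^ r" by simp
  ultimately show "1 \<le> Z" by linarith
  have "real R0 \<le> 3 * exp 7 * 3 ^ r * n powr (r / Suc K)"
    unfolding R0_def by (rule reps_le[OF tau(1,2,4) X0])
  also have "\<dots> \<le> 3 * exp 7 * 3 ^ r * (2 * n powr (1 / c))"
    by (intro mult_left_mono powr_le c) auto
  also have "\<dots> = rep_factor * Z" by (simp add: rep_factor_def Z_def)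
  finally show "R0 \<le> rep_factor * Z" .
qed

lemma l_bounds: "real l \<le> 2 * (1 + ln n)" "1 \<le> real l"
proof -
  show "1 \<le> real l" using l(1) by simp
  have "2 ^ (l - 1) \<le> n" using n(3) l(1) by simp
  then have "real (2 ^ (l - 1)) \<le> real n" by (rule of_nat_mono)
  then have "(2::real) ^ (l - 1) \<le> n" by simp
  then have "ln ((2::real) ^ (l - 1)) \<le> ln n" by (subst ln_le_cancel_iff) (use n(1) in auto)
  then have "real (l - 1) * ln 2 \<le> ln n" by (simp add: ln_realpow)
  moreover have "1 / 2 \<le> ln (2::real)" using ln_one_minus_pos_upper_bound[of "1/2"] by (simp add: ln_div)
  then have "real (l - 1) * (1 / 2) \<le> real (l - 1) * ln 2" by (intro mult_left_mono) auto
  ultimately have "real (l - 1) \<le> 2 * ln n" by linarith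
  then show "real l \<le> 2 * (1 + ln n)" using l(1) by (simp add: of_nat_diff)
qed

text \<open>The budget times the width of the band. If \<open>R0 < n\<close>, then
  \<open>3 ^ r \<le> R0 < 2 ^ l\<close>, so \<open>r < l\<close> and
  \<open>K + 1 \<le> l ^ 2\<close>. In a linear scan with \<open>r \<ge> l\<close>, the factor
  \<open>r\<close> is absorbed by the gap between \<open>2 ^ r\<close>, which is at least
  \<open>n\<close>, and \<open>3 ^ r\<close>, which is at most \<open>Z\<close>.\<close>

lemma verified_cells: "real L * (K + 1) \<le> 12 * (rep_factor + 1) * (real l ^ 2 * Z)"
proof -
  have l2: "1 \<le> real l ^ 2" "real l \<le> real l ^ 2" using l_bounds(2) self_le_power[of "real l" 2] by simp_all
  have "K \<le> r * l" by (simp add: K_def)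
  then have "real K \<le> real (r * l)" by (rule of_nat_mono)
  then have Kl: "real K + 1 \<le> r * l + 1" by simp
  have small_r: "r * l + 1 \<le> real l ^ 2" if "r < l"
  proof -
    have "r * l + 1 * l \<le> l * l" using mult_le_mono1[of "r + 1" l l] that by (simp add: algebra_simps)
    then have "r * l + 1 \<le> l * l" using l(1) by linarith
    then have "real (r * l + 1) \<le> real (l * l)" by (rule of_nat_mono)
    then show ?thesis by (simp add: power2_eq_square)
  qed
  have few: "real R0 * (K + 1) \<le> rep_factor * Z * real l ^ 2" if "r < l"
    using Z Kl small_r[OF that] rep_factor_ge_1 by (intro mult_mono) auto
  show ?thesis
  proof (cases "R0 < n")
    case True
    have "(3::real) ^ r \<le> (3 * rate tau) ^ r"
      using rate_ge_1[of tau] tau by (intro power_mono) auto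
    also have "\<dots> \<le> R0" using reps_bounds(3)[OF tau(1,2)] True by (simp add: R0_def)
    also have "real R0 < real (2 ^ l)" using True n(2) by (simp only: of_nat_less_iff)
    finally have "(3::real) ^ r < 2 ^ l" by simp
    moreover have "(2::real) ^ r \<le> 3 ^ r" by (intro power_mono) auto
    ultimately have "(2::real) ^ r < 2 ^ l" by linarith
    then have "r < l" by simp
    from few[OF this] have "real L * (K + 1) \<le> 12 * (rep_factor * Z * real l ^ 2)"
      using True by (simp add: L_def)
    also have "\<dots> \<le> 12 * ((rep_factor + 1) * (real l ^ 2 * Z))"
      using Z(2) by (simp add: algebra_simps)
    finally show ?thesis by (simp only: mult.assoc)
  next
    case False
    then have L: "L = n" "R0 = n" using R0 by (simp_all add: L_def)
    have "real n * (K + 1) \<le> (rep_factor + 1) * (real l ^ 2 * Z)"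
    proof (cases "r < l")
      case True
      have "real n * (K + 1) \<le> rep_factor * Z * real l ^ 2" using few[OF True] by (simp add: L)
      also have "\<dots> \<le> (rep_factor + 1) * (real l ^ 2 * Z)" using Z(2) by (simp add: algebra_simps)
      finally show ?thesis .
    next
      case False
      \<comment> \<open>With \<open>n \<le> 2 ^ r\<close> this gives
        \<open>n * r \<le> 3 ^ r\<close>.\<close>
      have "real r \<le> (3 / 2) ^ r"
      proof (induction r)
        case (Suc r)
        show ?case
        proof (cases "r < 2")
          case True
          then consider "r = 0" | "r = 1" by linarith
          then show ?thesis by cases simp_all
        next
          case False
          then have "real (Suc r) \<le> 3 / 2 * real r" by simp
          with Suc show ?thesis by simp
        qed
      qed simp
      moreover have "real n \<le> 2 ^ r"
      proof -
        have "n \<le> 2 ^ l" using n(2) by simp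
        also have "(2::nat) ^ l \<le> 2 ^ r" using False by (intro power_increasing) auto
        finally have "real n \<le> real (2 ^ r)" by (rule of_nat_mono)
        then show ?thesis by simp
      qed
      ultimately have "real n * r \<le> 2 ^ r * (3 / 2) ^ r" by (intro mult_mono) auto
      then have nr: "real n * r \<le> Z" using Z(1) by (simp only: power_mult_distrib[symmetric]) simp
      have "real n * (K + 1) \<le> real n * (r * l + 1)" using Kl by (intro mult_left_mono) auto
      also have "\<dots> = real n * r * l + real n" by (simp add: algebra_simps)
      also have "\<dots> \<le> Z * real l ^ 2 + rep_factor * Z * real l ^ 2"
      proof (rule add_mono)
        show "real n * r * l \<le> Z * real l ^ 2" using nr l2 Z(2) by (intro mult_mono) auto
        have "real n \<le> rep_factor * Z * 1" using Z(3) by (simp add: L)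
        also have "\<dots> \<le> rep_factor * Z * real l ^ 2" using l2 rep_factor_ge_1 Z(2) by (intro mult_left_mono) auto
        finally show "real n \<le> rep_factor * Z * real l ^ 2" .
      qed
      finally show ?thesis by (simp add: algebra_simps)
    qed
    moreover have "0 \<le> (rep_factor + 1) * (real l ^ 2 * Z)" using rep_factor_ge_1 Z(2) by simp
    ultimately have "real n * (K + 1) \<le> 12 * ((rep_factor + 1) * (real l ^ 2 * Z))" by linarith
    then show ?thesis unfolding L by (simp only: mult.assoc)
  qed
qed

lemma query_time_le:
  assumes "1 \<le> d"
  shows "query_time \<le> time_factor e * (real l ^ 2 * (d * Z))"
proof -
  let ?D = "real l ^ 2 * (d * Z)"
  have d1: "1 \<le> real d" and l1: "1 \<le> real l" using assms l_bounds(2) by simp_all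
  have l2: "1 \<le> real l ^ 2" "real l \<le> real l ^ 2"
    using l_bounds(2) self_le_power[of "real l" 2] by simp_all
  have dl: "real d \<le> real d * l" "real l \<le> real d * l" "1 \<le> real d * l"
    using d1 l1 mult_mono[of 1 "real d" 1 "real l"] by simp_all
  have T: "real T \<le> 9 * (real d * l)" using dl by (simp add: T_def)
  have B: "real (7 * B + 25) \<le> (32 + 7 * e) * real l"
  proof -
    have "real e * 1 \<le> real e * l" using l1 by (intro mult_left_mono) auto
    then show ?thesis using l1 by (simp add: B_def algebra_simps)
  qed
  have "real T * real (7 * B + 25) \<le> 9 * (real d * l) * ((32 + 7 * e) * real l)"
    using T B by (intro mult_mono) auto
  also have "\<dots> = (288 + 63 * e) * (d * real l ^ 2)" by (simp add: power2_eq_square algebra_simps)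
  finally have "real T * real (7 * B + 25) \<le> (288 + 63 * e) * (d * real l ^ 2)" .
  moreover have dl2: "1 \<le> d * real l ^ 2" using d1 l2(1) mult_mono[of 1 "real d" 1 "real l ^ 2"] by simp
  ultimately have ct: "real (T * (7 * B + 25) + 25) \<le> (313 + 63 * e) * (d * real l ^ 2)"
    by (simp add: algebra_simps)
  have "real R \<le> rep_factor * Z" using small_sizes(5) Z(3) by linarith
  then have 1: "real R * real (T * (7 * B + 25) + 25) \<le> rep_factor * Z * ((313 + 63 * e) * (d * real l ^ 2))"
    using ct rep_factor_ge_1 Z(2) by (intro mult_mono) auto
  have "real (d * (22 * (2 * K + 1) + 9) + 16 * K + 75) \<le> 106 * d * (real K + 1)"
  proof -
    have "d * (22 * (2 * K + 1) + 9) + 16 * K + 75 \<le> d * (22 * (2 * K + 1) + 9) + d * (16 * K + 75)"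
      using mult_le_mono1[OF assms, of "16 * K + 75"] by simp
    also have "\<dots> \<le> 106 * d * (K + 1)" by (simp add: algebra_simps)
    finally have "real (d * (22 * (2 * K + 1) + 9) + 16 * K + 75) \<le> real (106 * d * (K + 1))"
      by (rule of_nat_mono)
    then show ?thesis by (simp add: algebra_simps)
  qed
  then have "real L * real (d * (22 * (2 * K + 1) + 9) + 16 * K + 75) \<le> real L * (106 * d * (real K + 1))"
    by (intro mult_left_mono) auto
  also have "\<dots> = 106 * d * (real L * (real K + 1))" by simp
  also have "\<dots> \<le> 106 * d * (12 * (rep_factor + 1) * (real l ^ 2 * Z))"
    using verified_cells by (intro mult_left_mono) (auto simp: add.commute)
  finally have 2: "real L * real (d * (22 * (2 * K + 1) + 9) + 16 * K + 75) \<le> 106 * d * (12 * (rep_factor + 1) * (real l ^ 2 * Z))" .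
  have "1 * 1 \<le> d * real l ^ 2 * Z" using dl2 Z(2) by (intro mult_mono) auto
  then have 3: "20 \<le> 20 * ?D" by (simp add: mult_ac)
  have "real query_time = real R * real (T * (7 * B + 25) + 25) +
      real L * real (d * (22 * (2 * K + 1) + 9) + 16 * K + 75) + 20"
    unfolding query_time_def by (simp only: of_nat_add of_nat_mult of_nat_numeral)
  also have "\<dots> \<le> rep_factor * Z * ((313 + 63 * e) * (d * real l ^ 2)) + 106 * d * (12 * (rep_factor + 1) * (real l ^ 2 * Z)) + 20 * ?D"
    using 1 2 3 by linarith
  also have "\<dots> = time_factor e * ?D" by (simp add: time_factor_def algebra_simps)
  finally show ?thesis .
qed

text \<open>The assumption d = O(n) enters as \<open>2 * d \<le> X0\<close>: it bounds a seed by
  order \<open>n * l\<close> words, so that it is covered, like the bucket heads and links, by the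
  term with \<open>n * Z\<close>.\<close>

lemma mm_le:
  assumes "1 \<le> d"
  shows "mm \<le> space_factor e * (l * (real n * Z + real d * n))"
proof -
  have n1: "1 \<le> real n" and d1: "1 \<le> real d" and l1: "1 \<le> real l" using n(1) assms l_bounds(2) by simp_all
  have Nn: "real N \<le> 2 * real n" using of_nat_mono[OF l(3), where ?'a = real] by simp
  have "l < N" by (simp add: N_def)
  then have ln: "real l \<le> 2 * n" using Nn by linarith
  have "2 * real d \<le> 2 ^ e * real N" using of_nat_mono[OF X0, where ?'a = real] by (simp add: X0_def)
  also have "\<dots> \<le> 2 ^ e * (2 * real n)" using Nn by (intro mult_left_mono) auto
  finally have dn: "real d \<le> 2 ^ e * n" by simp
  have T: "real T \<le> 3 * (2 ^ e + 3) * n" using dn ln n1 by (simp add: T_def algebra_simps)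
  have B: "real (Suc B) \<le> (e + 2) * real l"
  proof -
    have "real e * 1 \<le> real e * l" using l1 by (intro mult_left_mono) auto
    then show ?thesis using l1 by (simp add: B_def algebra_simps)
  qed
  have "real T * real (Suc B) \<le> 3 * (2 ^ e + 3) * n * ((e + 2) * real l)"
    using T B by (intro mult_mono) auto
  then have SL: "real SL \<le> 3 * (2 ^ e + 3) * (e + 2) * (n * l)"
    unfolding SL_def of_nat_mult by (simp add: algebra_simps)
  have "real Nb \<le> 2 * n" using Nn n1 by (simp add: Nb_def)
  then have stride: "real stride \<le> (3 * (2 ^ e + 3) * (e + 2) + 4) * (n * l)"
  proof -
    define h where "h = real n * real l"
    define a where "a = 3 * (2 ^ e + 3) * (real e + 2)"
    have "real SL \<le> a * h" using SL by (simp add: a_def h_def algebra_simps)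
    moreover have "real n \<le> h" using mult_left_mono[OF l1, of "real n"] by (simp add: h_def)
    moreover have "real stride = real SL + real Nb + real n + 1" by (simp add: stride_def)
    ultimately have "real stride \<le> a * h + 4 * h" using n1 \<open>real Nb \<le> 2 * n\<close> by linarith
    then show ?thesis by (simp add: h_def a_def algebra_simps)
  qed
  have "real R \<le> rep_factor * Z" using small_sizes(5) Z(3) by linarith
  then have 1: "real R * real stride \<le> rep_factor * Z * ((3 * (2 ^ e + 3) * (e + 2) + 4) * (n * l))"
    using stride rep_factor_ge_1 Z(2) by (intro mult_mono) auto
  have dn1: "real d \<le> real d * n" "real n \<le> real d * n" "1 \<le> real d * n"
    using n1 d1 mult_mono[of 1 "real d" 1 "real n"] by simp_all
  have "real TB = real d * n + n + 4 * d + 5" by (simp add: TB_def D_def algebra_simps)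
  then have "real TB \<le> 11 * (real d * n)" using dn1 by simp
  also have "\<dots> \<le> 11 * (d * real n) * l" using l1 d1 n1 by simp
  finally have 2: "real TB \<le> 11 * (d * real n) * l" .
  have "real mm = real TB + real R * real stride" by (simp add: mm_def)
  also have "\<dots> \<le> 11 * (d * real n) * l + rep_factor * Z * ((3 * (2 ^ e + 3) * (e + 2) + 4) * (n * l))"
    using 1 2 by linarith
  also have "\<dots> \<le> space_factor e * (l * (real n * Z + real d * n))"
  proof -
    define k where "k = 3 * (2 ^ e + 3) * (real e + 2) + 4"
    define a where "a = real l * (real n * Z)"
    define b where "b = real l * (real d * n)"
    have k: "0 \<le> rep_factor * k" using rep_factor_ge_1 by (simp add: k_def)
    have ab: "0 \<le> a" "0 \<le> b" using Z(2) by (simp_all add: a_def b_def)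
    have "11 * b + rep_factor * k * a \<le> (11 + rep_factor * k) * (a + b)"
      using ab mult_nonneg_nonneg[OF k ab(2)] by (simp add: algebra_simps)
    then show ?thesis by (simp add: space_factor_def k_def a_def b_def algebra_simps)
  qed
  finally show ?thesis .
qed

lemma query_time_polylog:
  assumes "1 \<le> d"
  shows "query_time \<le> polylog (4 * (time_factor e + space_factor e)) 2 n * (real d * 3 ^ r * n powr (1 / c))"
proof -
  have "0 \<le> ln (real n)" using n(1) by simp
  then have "real l ^ 2 \<le> (2 * (1 + ln n)) ^ 2" using l_bounds by (intro power_mono) auto
  then have l2: "real l ^ 2 \<le> 4 * (1 + ln n) ^ 2" by (simp only: power_mult_distrib) simp
  have "query_time \<le> time_factor e * (real l ^ 2 * (d * Z))" by (rule query_time_le[OF assms])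
  also have "\<dots> \<le> (time_factor e + space_factor e) * (4 * (1 + ln n) ^ 2 * (d * Z))"
    using factors_nonneg Z(2) l2 by (intro mult_mono) auto
  finally show ?thesis by (simp only: polylog_def Z_def mult_ac)
qed

lemma mm_polylog:
  assumes "1 \<le> d"
  shows "mm \<le> polylog (4 * (time_factor e + space_factor e)) 2 n *
    (3 ^ r * n powr (1 + 1 / c) + real d * n)"
proof -
  have ln: "0 \<le> ln (real n)" using n(1) by simp
  then have "1 * (1 + ln n) \<le> (1 + ln n) * (1 + ln n)" by (intro mult_right_mono) auto
  then have l2: "real l \<le> 4 * (1 + ln n) ^ 2" using l_bounds(1) ln unfolding power2_eq_square by linarith
  have "mm \<le> space_factor e * (l * (real n * Z + real d * n))" by (rule mm_le[OF assms])
  also have "\<dots> \<le> (time_factor e + space_factor e) * (4 * (1 + ln n) ^ 2 * (real n * Z + real d * n))"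
    using factors_nonneg Z(2) l2 by (intro mult_mono) auto
  also have "real n * Z = 3 ^ r * n powr (1 + 1 / c)" using n(1) by (simp add: Z_def powr_add)
  finally show ?thesis by (simp only: polylog_def mult_ac)
qed

lemma structure_correct:
  assumes S: "length S = n" "\<And>x. x \<in> set S \<Longrightarrow> length x \<le> d \<and> fits B x"
    and q: "\<forall>x\<in>set (qs @ [q]). length x \<le> d \<and> fits B x"
  shows "(\<forall>vs\<in>tapes w (R * SL). \<exists>t s s'. exec w (2 ^ w) (prep e) (prep_input \<sigma> d c r S vs) t s \<and>
      serve w mm query_time query s (qs @ [q]) s') \<and>
    1 / 4 \<le> measure_pmf.prob (pmf_of_set (tapes w (R * SL)))
      {vs. \<exists>t s s'. exec w (2 ^ w) (prep e) (prep_input \<sigma> d c r S vs) t s \<and>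
        serve w mm query_time query s (qs @ [q]) s' \<and> correct_answer mm c r (set S) q s'}"
    (is "_ \<and> 1 / 4 \<le> measure_pmf.prob _ {vs. ?good vs}")
proof
  have thresholds: "min r d = r" "min (nat \<lfloor>c * real r\<rfloor>) d = K0" using r c(2) by simp_all
  have works: "\<exists>t s s'. exec w (2 ^ w) (prep e) (prep_input \<sigma> d c r S vs) t s \<and>
      serve w mm query_time query s (qs @ [q]) s' \<and>
      ((\<exists>y\<in>set S. ED q y \<le> K \<and> holds_string (mem s') (regs s' 0) y \<and> regs s' 0 + length y < mm) \<or>
        failure S q vs)" if vs: "vs \<in> tapes w (R * SL)" for vs
  proof -
    have "tables.failed n B T th R Nb L K S (block SL vs) q \<longleftrightarrow> failure S q vs"
      unfolding failure_def by (rule failed_iff[OF S vs])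
    note failed = this[symmetric]
    show ?thesis unfolding failed by (rule structure_works[OF S vs thresholds q])
  qed
  then show "\<forall>vs\<in>tapes w (R * SL). \<exists>t s s'. exec w (2 ^ w) (prep e) (prep_input \<sigma> d c r S vs) t s \<and>
      serve w mm query_time query s (qs @ [q]) s'" by blast
  have "real K \<le> c * r"
  proof -
    have "0 \<le> c * real r" using c(1) by simp
    then have "real K0 \<le> c * r" unfolding c(2) by linarith
    moreover have "K \<le> K0" by (simp add: K_def)
    ultimately show ?thesis by linarith
  qed
  then have good: "?good vs" if vs: "vs \<in> tapes w (R * SL)"
    and ok: "(\<exists>y\<in>set S. ED q y \<le> r) \<longrightarrow> \<not> failure S q vs" for vs
  proof -
    obtain t s s' where s: "exec w (2 ^ w) (prep e) (prep_input \<sigma> d c r S vs) t s"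
      "serve w mm query_time query s (qs @ [q]) s'"
      "(\<exists>y\<in>set S. ED q y \<le> K \<and> holds_string (mem s') (regs s' 0) y \<and> regs s' 0 + length y < mm) \<or>
        failure S q vs" using works[OF vs] by blast
    have "correct_answer mm c r (set S) q s'"
      unfolding correct_answer_def
    proof
      assume "\<exists>y\<in>set S. ED q y \<le> r"
      with s(3) ok obtain y where y: "y \<in> set S" "ED q y \<le> K"
        "holds_string (mem s') (regs s' 0) y" "regs s' 0 + length y < mm" by blast
      have "real (ED q y) \<le> c * r" using y(2) \<open>real K \<le> c * r\<close> by linarith
      with y show "\<exists>y'\<in>set S. real (ED q y') \<le> c * real r \<and>
        holds_string (mem s') (regs s' 0) y' \<and> regs s' 0 + length y' < mm" by blast
    qed
    with s(1,2) show ?thesis by blast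
  qed
  show "1 / 4 \<le> measure_pmf.prob (pmf_of_set (tapes w (R * SL))) {vs. ?good vs}"
  proof (cases "\<exists>y\<in>set S. ED q y \<le> r")
    case True
    then obtain y where y: "y \<in> set S" "ED q y \<le> r" by blast
    have "1 = expect w (R * SL) (\<lambda>vs. 1)" by simp
    also have "\<dots> \<le> expect w (R * SL) (\<lambda>vs. of_bool (?good vs) + of_bool (failure S q vs))"
    proof (rule expect_mono)
      fix vs assume vs: "vs \<in> tapes w (R * SL)"
      show "(1::real) \<le> of_bool (?good vs) + of_bool (failure S q vs)"
      proof (cases "failure S q vs")
        case False
        then have "?good vs" by (intro good[OF vs]) simp
        then have "of_bool (?good vs) = (1::real)" by (simp only: of_bool_eq)
        then show ?thesis by simp
      qed simp
    qed
    also have "\<dots> = expect w (R * SL) (\<lambda>vs. of_bool (?good vs)) + expect w (R * SL) (\<lambda>vs. of_bool (failure S q vs))"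
      by (rule expect_add)
    also have "expect w (R * SL) (\<lambda>vs. of_bool (failure S q vs)) \<le> 3 / 4"
      by (rule failure_probability_bound[OF S _ _ y]) (use q in auto)
    finally show ?thesis unfolding prob_tapes by linarith
  next
    case False
    have "1 = expect w (R * SL) (\<lambda>vs. 1)" by simp
    also have "\<dots> \<le> expect w (R * SL) (\<lambda>vs. of_bool (?good vs))"
    proof (rule expect_mono)
      fix vs assume vs: "vs \<in> tapes w (R * SL)"
      have "?good vs" by (rule good[OF vs]) (use False in blast)
      then show "(1::real) \<le> of_bool (?good vs)" by (simp only: of_bool_eq)
    qed
    finally show ?thesis unfolding prob_tapes by linarith
  qed
qed

end

end

text \<open>If the larger threshold is at least \<open>d\<close>, then every database string is an answer.\<close>

lemma trivial_query:
  assumes "1 < (2::nat) ^ w" "d + 1 < 2 ^ w" "regs s 1 = d" "regs s 6 = 1" "regs s 19 = 1"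
    "holds_string (mem s) (d + 1) y" "\<forall>x\<in>set (qs @ [q]). length x \<le> d"
  shows "\<exists>s'. serve w m 2 query s (qs @ [q]) s' \<and> regs s' 0 = d + 1 \<and>
    holds_string (mem s') (d + 1) y"
  using assms
proof (induction qs arbitrary: s)
  case Nil
  have "wp w m query (s\<lparr>mem := store_string 0 q (mem s)\<rparr>) (\<lambda>t s'. t = 2 \<and> regs s' 0 = d + 1 \<and>
      mem s' = store_string 0 q (mem s))"
    using Nil.prems by (simp add: query_def)
  then obtain s' where s': "exec w m query (s\<lparr>mem := store_string 0 q (mem s)\<rparr>) 2 s'" "regs s' 0 = d + 1"
    "mem s' = store_string 0 q (mem s)" unfolding wp_def by blast
  have "holds_string (mem s') (d + 1) y"
    using Nil.prems(6,7) by (auto simp: s'(3) holds_string_def store_string_def)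
  moreover have "serve w m 2 query s ([] @ [q]) s'"
    using serve.query[OF s'(1), of 2 "[]"] serve.none by simp
  ultimately show ?case using s'(2) by blast
next
  case (Cons x qs)
  have "wp w m query (s\<lparr>mem := store_string 0 x (mem s)\<rparr>) (\<lambda>t s'. t = 2 \<and>
      (\<forall>i. 0 < i \<longrightarrow> regs s' i = regs s i) \<and> mem s' = store_string 0 x (mem s))"
    using Cons.prems by (simp add: query_def)
  then obtain s1 where s1: "exec w m query (s\<lparr>mem := store_string 0 x (mem s)\<rparr>) 2 s1"
    "\<forall>i. 0 < i \<longrightarrow> regs s1 i = regs s i" "mem s1 = store_string 0 x (mem s)" unfolding wp_def by blast
  have "holds_string (mem s1) (d + 1) y"
    using Cons.prems(6,7) by (auto simp: s1(3) holds_string_def store_string_def)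
  then obtain s' where "serve w m 2 query s1 (qs @ [q]) s'" "regs s' 0 = d + 1"
    "holds_string (mem s') (d + 1) y"
    using Cons.IH[of s1] Cons.prems(1-5,7) s1(2) by auto
  then show ?case using serve.query[OF s1(1), of 2 "qs @ [q]" s'] by auto
qed

text \<open>The first database string is returned, whose cells lie between \<open>d + 1\<close> and
  \<open>2 * d + 1\<close>. A query takes two steps: the test of register 6 and one
  addition.\<close>

lemma trivial_structure:
  assumes w: "1 < (2::nat) ^ w" "d + 1 < 2 ^ w" "length S < 2 ^ w" and S: "S \<noteq> []" "\<forall>x\<in>set S. length x \<le> d"
    and d: "0 \<le> c" "d \<le> nat \<lfloor>c * real r\<rfloor>" and q: "\<forall>x\<in>set (qs @ [q]). length x \<le> d"
  shows "\<exists>t s s'. exec w (2 ^ w) (prep e) (prep_input \<sigma> d c r S vs) t s \<and>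
    serve w (2 * d + 3) 2 query s (qs @ [q]) s' \<and> correct_answer (2 * d + 3) c r (set S) q s'"
proof -
  have S0: "S ! 0 \<in> set S" "length (S ! 0) \<le> d" using S by (auto intro!: nth_mem)
  let ?s = "prep_input \<sigma> d c r S vs"
  have cell: "(Suc d + i) div (Suc d) = 1" "(Suc d + i) mod (Suc d) = i" if "i \<le> d" for i
    using div_add_self1[of "Suc d" i] mod_add_self1[of "Suc d" i] that by simp_all
  have "mem ?s (d + 1 + i) = store_string 0 (S ! 0) (\<lambda>_. 0) i" if "i \<le> d" for i
    using cell[OF that] S(1) by (simp add: prep_input_def Let_def Suc_le_eq)
  from this[of 0] this[of "Suc _"] have hs: "holds_string (mem ?s) (d + 1) (S ! 0)"
    using S0(2) by (simp add: holds_string_def store_string_def)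
  have w0: "0 < w" using w(1) by (cases w) auto
  have "wp w (2 ^ w) (prep e) ?s (\<lambda>_ s. mem s = mem ?s \<and> regs s 1 = d \<and> regs s 6 = 1 \<and> regs s 19 = 1)"
    using w0 w(2,3) d(2) by (simp add: prep_def prep_input_def)
  then obtain t s where s: "exec w (2 ^ w) (prep e) ?s t s" "mem s = mem ?s" "regs s 1 = d"
    "regs s 6 = 1" "regs s 19 = 1" unfolding wp_def by blast
  obtain s' where s': "serve w (2 * d + 3) 2 query s (qs @ [q]) s'" "regs s' 0 = d + 1"
    "holds_string (mem s') (d + 1) (S ! 0)"
    using trivial_query[OF w(1,2) s(3-5), of "S ! 0" qs q "2 * d + 3"] hs q by (auto simp: s(2))
  have "max (length q) (length (S ! 0)) \<le> d" using S0(2) q by simp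
  then have "ED q (S ! 0) \<le> d" using ED_le_max[of q "S ! 0"] by linarith
  moreover have "0 \<le> c * real r" using d(1) by simp
  ultimately have "real (ED q (S ! 0)) \<le> c * r" using d(2) by linarith
  then have "correct_answer (2 * d + 3) c r (set S) q s'"
    using S0 s'(2,3) unfolding correct_answer_def by (intro impI bexI[of _ "S ! 0"]) auto
  with s(1) s'(1) show ?thesis by blast
qed

section \<open>Choice of the constants and conclusion\<close>

lemma log2_ceiling:
  assumes "1 \<le> n"
  shows "n < 2 ^ nat \<lceil>log 2 (real n + 1)\<rceil>" "\<forall>j<nat \<lceil>log 2 (real n + 1)\<rceil>. 2 ^ j \<le> n"
proof -
  define l where "l = nat \<lceil>log 2 (real n + 1)\<rceil>"
  have "log 2 (real n + 1) \<le> real l" unfolding l_def by linarith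
  then have "real n + 1 \<le> 2 powr real l" by (subst (asm) log_le_iff) auto
  then have "real (n + 1) \<le> real (2 ^ l)" by (simp add: powr_realpow)
  then show "n < 2 ^ nat \<lceil>log 2 (real n + 1)\<rceil>" by (simp only: of_nat_le_iff l_def)
  show "\<forall>j<nat \<lceil>log 2 (real n + 1)\<rceil>. 2 ^ j \<le> n"
  proof (intro allI impI)
    fix j assume "j < nat \<lceil>log 2 (real n + 1)\<rceil>"
    then have "real j < log 2 (real n + 1)" by linarith
    then have "2 powr real j < real n + 1" by (subst (asm) less_log_iff) auto
    then have "real (2 ^ j) < real (n + 1)" by (simp add: powr_realpow)
    then show "2 ^ j \<le> n" by (simp only: of_nat_less_iff)
  qed
qed

theorem theorem1p1:
  fixes A :: real
  shows "\<exists>(prep :: prog) (query :: prog) (b :: nat) (C :: real) (k :: nat).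
    \<forall>(\<sigma> :: nat) (d :: nat) (c :: real) (r :: nat) (S :: nat list list) (n :: nat) (w :: nat).
      n = length S \<and> distinct S \<and> set S \<subseteq> strings \<sigma> d \<and> 1 \<le> n \<and> 1 \<le> d \<and>
      real d \<le> A * real n \<and> real \<sigma> \<le> A * real n \<and> 1 \<le> c \<and> w = word_size b n \<longrightarrow>
      (\<exists>(m :: nat) (T :: real).
        real m \<le> polylog C k n *
          (3 ^ r * real n powr (1 + 1 / c) + real d * real n) \<and>
        T \<le> polylog C k n * (real d * 3 ^ r * real n powr (1 / c)) \<and>
        (\<forall>qs q. set qs \<subseteq> strings \<sigma> d \<and> q \<in> strings \<sigma> d \<longrightarrow>
          (\<exists>l.
            (\<forall>vs \<in> tapes w l. \<exists>t s s'.
              exec w (2 ^ w) prep (prep_input \<sigma> d c r S vs) t s \<and>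
              serve w m T query s (qs @ [q]) s') \<and>
            measure_pmf.prob (pmf_of_set (tapes w l))
              {vs. \<exists>t s s'.
                exec w (2 ^ w) prep (prep_input \<sigma> d c r S vs) t s \<and>
                serve w m T query s (qs @ [q]) s' \<and>
                correct_answer m c r (set S) q s'} > 1 / 10)))"
proof -
  \<comment> \<open>Chosen such that \<open>2 * \<sigma> + 3\<close> and \<open>2 * d + 3\<close>
    are at most \<open>2 ^ (l + e)\<close>: codes then fit in \<open>l + e\<close> bits, and
    \<open>2 * d \<le> X0\<close>. The lower bound 5 on \<open>e\<close> gives
    \<open>64 \<le> G\<close>, which covers the small constants.\<close>
  obtain e0 where e0: "2 * A + 3 < 2 ^ e0" using real_arch_pow[of 2 "2 * A + 3"] by auto
  define e where "e = max 5 e0"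
  have e: "5 \<le> e" "2 * A + 3 < 2 ^ e"
  proof -
    show "5 \<le> e" by (simp add: e_def)
    have "(2::real) ^ e0 \<le> 2 ^ e" by (intro power_increasing) (auto simp: e_def)
    with e0 show "2 * A + 3 < 2 ^ e" by linarith
  qed
  define C where "C = 4 * (time_factor e + space_factor e)"
  show ?thesis
  \<comment> \<open>Words of \<open>10 * (e + 1) * l\<close> bits are ten digits in base
    \<open>G\<close>. The exponent 2 of the logarithm comes from \<open>l ^ 2\<close>, both in the
    cost of a walk and in \<open>verified_cells\<close>.\<close>
  proof (rule exI[of _ "prep e"], rule exI[of _ query], rule exI[of _ "10 * (e + 1)"], rule exI[of _ C],
      rule exI[of _ 2], intro allI impI)
    fix \<sigma> d :: nat and c :: real and r :: nat and S :: "nat list list" and n w :: nat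
    assume A: "n = length S \<and> distinct S \<and> set S \<subseteq> strings \<sigma> d \<and> 1 \<le> n \<and> 1 \<le> d \<and>
      real d \<le> A * real n \<and> real \<sigma> \<le> A * real n \<and> 1 \<le> c \<and> w = word_size (10 * (e + 1)) n"
    define l where "l = nat \<lceil>log 2 (real n + 1)\<rceil>"
    define G where "G = ((2::nat) ^ l) ^ (e + 1)"
    have n: "1 \<le> n" "n < 2 ^ l" "\<forall>j<l. 2 ^ j \<le> n" using log2_ceiling[of n] A by (simp_all add: l_def)
    have w: "(2::nat) ^ w = G ^ 10"
    proof -
      have "w = 10 * (e + 1) * l" using A unfolding word_size_def l_def by blast
      then have "w = l * (e + 1) * 10" by (simp only: mult_ac)
      then show ?thesis by (simp only: G_def power_mult)
    qed
    have l1: "1 \<le> l" using n by (cases l) auto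
    have "real n \<le> real (2 ^ l)" using n(2) by (simp only: of_nat_le_iff less_imp_le)
    then have n_le: "real n \<le> 2 ^ l" by simp
    have d\<sigma>: "real d \<le> A * real n" "real \<sigma> \<le> A * real n" using A by blast+
    have A_n: "2 * (A * n) + 3 \<le> 2 ^ e * 2 ^ l"
    proof -
      have "2 * (A * n) + 3 \<le> (2 * A + 3) * n" using n(1) by (simp add: algebra_simps)
      also have "\<dots> \<le> 2 ^ e * real n" using e(2) by (intro mult_right_mono) auto
      also have "\<dots> \<le> 2 ^ e * 2 ^ l" using n_le by (intro mult_left_mono) auto
      finally show ?thesis .
    qed
    have "real (2 * d + 3) \<le> real (2 ^ e * 2 ^ l)" using d\<sigma>(1) A_n by simp
    then have d: "2 * d + 3 \<le> 2 ^ e * 2 ^ l" by (simp only: of_nat_le_iff)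
    have "real (2 * \<sigma> + 3) \<le> real (2 ^ e * 2 ^ l)" using d\<sigma>(2) A_n by simp
    then have \<sigma>: "2 * \<sigma> + 3 \<le> 2 ^ e * 2 ^ l" by (simp only: of_nat_le_iff)
    have "(2::nat) ^ e * 2 ^ l \<le> 2 ^ (l * e) * 2 ^ l"
      using l1 by (intro mult_le_mono1 power_increasing) auto
    then have XG: "2 ^ e * 2 ^ l \<le> G" by (simp add: G_def power_mult)
    have strings: "length x \<le> d \<and> fits (l + e) x" if "x \<in> strings \<sigma> d" for x
    proof -
      have "2 * a + 3 < 2 ^ (l + e)" if "a \<in> set x" for a
      proof -
        have "a < \<sigma>" using that \<open>x \<in> strings \<sigma> d\<close> by (auto simp: strings_def)
        then show ?thesis using \<sigma> by (simp add: power_add mult.commute)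
      qed
      moreover have "1 < (2::nat) ^ (l + e)" using e(1) by (intro one_less_power) auto
      ultimately show ?thesis using that by (simp add: fits_def strings_def)
    qed
    have S: "length S = n" "\<And>x. x \<in> set S \<Longrightarrow> length x \<le> d \<and> fits (l + e) x"
      using A strings by auto
    have C: "4 \<le> C"
      using rep_factor_ge_1 by (simp add: C_def time_factor_def space_factor_def)
    show "\<exists>(m :: nat) (T :: real).
        real m \<le> polylog C 2 n * (3 ^ r * real n powr (1 + 1 / c) + real d * real n) \<and>
        T \<le> polylog C 2 n * (real d * 3 ^ r * real n powr (1 / c)) \<and>
        (\<forall>qs q. set qs \<subseteq> strings \<sigma> d \<and> q \<in> strings \<sigma> d \<longrightarrow>
          (\<exists>l.
            (\<forall>vs \<in> tapes w l. \<exists>t s s'.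
              exec w (2 ^ w) (prep e) (prep_input \<sigma> d c r S vs) t s \<and>
              serve w m T query s (qs @ [q]) s') \<and>
            measure_pmf.prob (pmf_of_set (tapes w l))
              {vs. \<exists>t s s'.
                exec w (2 ^ w) (prep e) (prep_input \<sigma> d c r S vs) t s \<and>
                serve w m T query s (qs @ [q]) s' \<and>
                correct_answer m c r (set S) q s'} > 1 / 10))"
    proof (cases "d \<le> nat \<lfloor>c * real r\<rfloor>")
      case True
      have "G ^ 1 \<le> G ^ 10" using XG d by (intro power_increasing) auto
      then have "G \<le> 2 ^ w" by (simp add: w)
      moreover have "1 * 2 ^ l \<le> (2::nat) ^ e * 2 ^ l" by (intro mult_le_mono1) simp
      ultimately have sizes: "1 < (2::nat) ^ w" "d + 1 < 2 ^ w" "length S < 2 ^ w"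
        using d XG n(2) S(1) by linarith+
      have triv: "\<exists>t s s'. exec w (2 ^ w) (prep e) (prep_input \<sigma> d c r S vs) t s \<and>
          serve w (2 * d + 3) 2 query s (qs @ [q]) s' \<and> correct_answer (2 * d + 3) c r (set S) q s'"
        if "set qs \<subseteq> strings \<sigma> d \<and> q \<in> strings \<sigma> d" for qs q vs
        by (rule trivial_structure[OF sizes _ _ _ True])
          (use that S n(1) A in \<open>auto simp: strings_def\<close>)
      have d1: "1 \<le> real d" and n1: "1 \<le> real n" and c1: "0 < c" using A by auto
      have pl: "4 \<le> polylog C 2 n"
      proof -
        have "1 \<le> (1 + ln (real n)) ^ 2" using n1 by (intro one_le_power) simp
        then have "4 * 1 \<le> C * (1 + ln (real n)) ^ 2" using C by (intro mult_mono) auto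
        then show ?thesis by (simp add: polylog_def)
      qed
      have pw: "1 \<le> real n powr (1 / c)" using n1 c1 by (intro ge_one_powr_ge_zero) auto
      have r3: "(1::real) \<le> 3 ^ r" by simp
      have "1 * 1 \<le> 3 ^ r * real n powr (1 + 1 / c)"
        using r3 n1 c1 by (intro mult_mono ge_one_powr_ge_zero) auto
      moreover have dn: "real d * 1 \<le> real d * real n" using n1 by (intro mult_left_mono) auto
      ultimately have "1 + real d \<le> 3 ^ r * real n powr (1 + 1 / c) + real d * real n" by linarith
      then have "4 * (1 + real d) \<le>
          polylog C 2 n * (3 ^ r * real n powr (1 + 1 / c) + real d * real n)"
        using pl by (intro mult_mono) auto
      then have m: "real (2 * d + 3) \<le>
          polylog C 2 n * (3 ^ r * real n powr (1 + 1 / c) + real d * real n)"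
        by simp
      have "1 * 1 * 1 \<le> real d * 3 ^ r * real n powr (1 / c)"
        using d1 r3 pw by (intro mult_mono) auto
      then have "4 * 1 \<le> polylog C 2 n * (real d * 3 ^ r * real n powr (1 / c))"
        using pl by (intro mult_mono) auto
      then have T: "2 \<le> polylog C 2 n * (real d * 3 ^ r * real n powr (1 / c))" by simp
      show ?thesis
      proof (rule exI[of _ "2 * d + 3"], rule exI[of _ "2::real"], intro conjI allI impI)
        fix qs q assume "set qs \<subseteq> strings \<sigma> d \<and> q \<in> strings \<sigma> d"
        note triv = triv[OF this]
        have runs: "\<forall>vs \<in> tapes w 0. \<exists>t s s'. exec w (2 ^ w) (prep e) (prep_input \<sigma> d c r S vs) t s \<and>
            serve w (2 * d + 3) 2 query s (qs @ [q]) s'"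
          using triv by blast
        show "\<exists>l. (\<forall>vs \<in> tapes w l. \<exists>t s s'.
              exec w (2 ^ w) (prep e) (prep_input \<sigma> d c r S vs) t s \<and>
              serve w (2 * d + 3) 2 query s (qs @ [q]) s') \<and>
            measure_pmf.prob (pmf_of_set (tapes w l))
              {vs. \<exists>t s s'.
                exec w (2 ^ w) (prep e) (prep_input \<sigma> d c r S vs) t s \<and>
                serve w (2 * d + 3) 2 query s (qs @ [q]) s' \<and>
                correct_answer (2 * d + 3) c r (set S) q s'} > 1 / 10"
          \<comment> \<open>The trivial structure draws no random words, so the empty tape will
            do.\<close>
          unfolding prob_tapes by (rule exI[of _ 0], rule conjI[OF runs], (unfold triv[THEN eqTrueI] of_bool_eq expect_const; simp))
      qed (use m T in simp_all)
    next
      case False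
      define K0 where "K0 = nat \<lfloor>c * real r\<rfloor>"
      have K0: "r \<le> K0" "K0 < d"
      proof -
        have "1 * real r \<le> c * r" using A by (intro mult_right_mono) auto
        then show "r \<le> K0" unfolding K0_def by linarith
        show "K0 < d" using False by (simp add: K0_def)
      qed
      have dG: "d < G" and dX: "2 * d \<le> 2 ^ e * 2 ^ l" using d XG by linarith+
      interpret parameters e l n d r K0 w G
        by unfold_locales (use e n dG w K0 in \<open>auto simp: G_def\<close>)
      have X0: "2 * d \<le> X0" using dX by (simp add: X0_def N_def)
      have c: "1 \<le> c" "K0 = nat \<lfloor>c * real r\<rfloor>" using A by (simp_all add: K0_def)
      have d1: "1 \<le> d" using A by simp
      have B: "l + e = B" by (simp add: B_def)
      note S = S[unfolded B] and strings = strings[unfolded B]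
      show ?thesis
      proof (rule exI[of _ mm], rule exI[of _ "real query_time"], intro conjI allI impI)
        show "real mm \<le> polylog C 2 n * (3 ^ r * real n powr (1 + 1 / c) + real d * real n)"
          using mm_polylog[OF c X0 d1] by (simp add: C_def)
        show "real query_time \<le> polylog C 2 n * (real d * 3 ^ r * real n powr (1 / c))"
          using query_time_polylog[OF c X0 d1] by (simp add: C_def)
        fix qs q assume "set qs \<subseteq> strings \<sigma> d \<and> q \<in> strings \<sigma> d"
        then have q: "\<forall>x\<in>set (qs @ [q]). length x \<le> d \<and> fits B x" using strings by auto
        show "\<exists>l. (\<forall>vs \<in> tapes w l. \<exists>t s s'.
              exec w (2 ^ w) (prep e) (prep_input \<sigma> d c r S vs) t s \<and>
              serve w mm query_time query s (qs @ [q]) s') \<and>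
            measure_pmf.prob (pmf_of_set (tapes w l))
              {vs. \<exists>t s s'.
                exec w (2 ^ w) (prep e) (prep_input \<sigma> d c r S vs) t s \<and>
                serve w mm query_time query s (qs @ [q]) s' \<and>
                correct_answer mm c r (set S) q s'} > 1 / 10"
          by (rule exI[of _ "R * SL"], rule conjI[OF structure_correct[OF c X0 S q, THEN conjunct1]
                less_le_trans[OF _ structure_correct[OF c X0 S q, THEN conjunct2]]]) simp_all
      qed
    qed
  qed
qed

end
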